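(* Let $R$ be a commutative ring with $R=2R$ (i.e. $2$ is a unit of $R$), and let $I$ be an ideal of $R$. Let $(P,\langle\,,\rangle)$ be a locally split orthogonal $R$-module with $P$ of rank $2n$, $n\ge 2$, and let $Q=R^2\oplus P$ with the induced form of $\mathbb{H}(R)\oplus P$. Then $$\mathrm{Trans}_{\mathrm{O}}(Q,IQ,\langle\,,\rangle)=\mathrm{ETrans}_{\mathrm{O}}(Q,IQ,\langle\,,\rangle).$$
   Context: All rings are commutative with identity. An orthogonal $R$-module is a pair $(P,\langle\,,\rangle)$ where $P$ is a finitely generated projective $R$-module of even (constant) rank and $\langle\,,\rangle:P\times P\to R$ is a symmetric bilinear form that is non-degenerate (the induced map $P\to P^*=\mathrm{Hom}_R(P,R)$ is an isomorphism). An element $u\in P$ is unimodular if $\phi(u)=1$ for some $R$-linear $\phi:P\to R$. The hyperbolic plane $\mathbb{H}(R)$ is $R^2$ with form $\langle (a_1,b_1),(a_2,b_2)\rangle=a_1b_2+a_2b_1$; $Q=R^2\oplus P$ carries the orthogonal-sum form $\langle (a,b,p),(a',b',p')\rangle=ab'+a'b+\langle p,p'\rangle$. An orthogonal transvection of an orthogonal module $M$ is a map $\tau(m)=m-\langle u,m\rangle v+\langle v,m\rangle u$ where $u,v\in M$ satisfy $\langle u,u\rangle=\langle v,v\rangle=\langle u,v\rangle=0$ and at least one of $u,v$ is unimodular. For an ideal $I$, $\mathrm{Trans}_{\mathrm{O}}(M,IM,\langle\,,\rangle)$ is the group generated by the orthogonal transvections of $M$ for which $u\in IM$ or $v\in IM$.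 The elementary orthogonal transvections of $Q$ are, for $q\in P$ with $\langle q,q\rangle=0$, the maps $\rho(q):(a,b,p)\mapsto(a,\,b+\langle p,q\rangle,\,p-aq)$ and $\mu(q):(a,b,p)\mapsto(a+\langle p,q\rangle,\,b,\,p-bq)$; $\mathrm{ETrans}_{\mathrm{O}}(Q,\langle\,,\rangle)$ is the group they generate. $\mathrm{ETrans}_{\mathrm{O}}(IQ,\langle\,,\rangle)$ is the subgroup generated by $\rho(q),\mu(q)$ with $q\in IP$, and $\mathrm{ETrans}_{\mathrm{O}}(Q,IQ,\langle\,,\rangle)$ is its normal closure in $\mathrm{ETrans}_{\mathrm{O}}(Q,\langle\,,\rangle)$. An orthogonal module $(P,\langle\,,\rangle)$ is split if there is a direct summand $N\subseteq P$ with $N=N^\perp=\{p\in P:\langle p,x\rangle=0\ \forall x\in N\}$; it is locally split if $(P_{\mathfrak m},\langle\,,\rangle)$ is split over $R_{\mathfrak m}$ for every maximal ideal $\mathfrak m$ of $R$. *)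

theory Defs
  imports "HOL-Algebra.Module" "HOL-Algebra.Ideal" "HOL-Algebra.Bij" "HOL-Algebra.Generated_Groups"
begin

definition locR_cls :: "('a, 'c) ring_scheme \<Rightarrow> 'a set \<Rightarrow> 'a \<times> 'a \<Rightarrow> ('a \<times> 'a) set" where
  "locR_cls R S x = {y. fst y \<in> carrier R \<and> snd y \<in> S \<and>
     (\<exists>u\<in>S. u \<otimes>\<^bsub>R\<^esub> ((snd y \<otimes>\<^bsub>R\<^esub> fst x) \<ominus>\<^bsub>R\<^esub> (snd x \<otimes>\<^bsub>R\<^esub> fst y)) = \<zero>\<^bsub>R\<^esub>)}"

definition localize_ring :: "('a, 'c) ring_scheme \<Rightarrow> 'a set \<Rightarrow> ('a \<times> 'a) set ring" where
  "localize_ring R S =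
    \<lparr> carrier = {locR_cls R S (r, s) | r s. r \<in> carrier R \<and> s \<in> S},
      mult = (\<lambda>A B. let x = (SOME x. x \<in> A); y = (SOME y. y \<in> B) in
                 locR_cls R S (fst x \<otimes>\<^bsub>R\<^esub> fst y, snd x \<otimes>\<^bsub>R\<^esub> snd y)),
      one = locR_cls R S (\<one>\<^bsub>R\<^esub>, \<one>\<^bsub>R\<^esub>),
      zero = locR_cls R S (\<zero>\<^bsub>R\<^esub>, \<one>\<^bsub>R\<^esub>),
      add = (\<lambda>A B. let x = (SOME x. x \<in> A); y = (SOME y. y \<in> B) in
                 locR_cls R S ((snd y \<otimes>\<^bsub>R\<^esub> fst x) \<oplus>\<^bsub>R\<^esub> (snd x \<otimes>\<^bsub>R\<^esub> fst y),
                               snd x \<otimes>\<^bsub>R\<^esub> snd y)) \<rparr>"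

definition locM_cls :: "('a, 'c) ring_scheme \<Rightarrow> ('a, 'b) module \<Rightarrow> 'a set \<Rightarrow> 'b \<times> 'a \<Rightarrow> ('b \<times> 'a) set" where
  "locM_cls R M S x = {y. fst y \<in> carrier M \<and> snd y \<in> S \<and>
     (\<exists>u\<in>S. u \<odot>\<^bsub>M\<^esub> ((snd y \<odot>\<^bsub>M\<^esub> fst x) \<ominus>\<^bsub>M\<^esub> (snd x \<odot>\<^bsub>M\<^esub> fst y)) = \<zero>\<^bsub>M\<^esub>)}"

definition localize_mod :: "('a, 'c) ring_scheme \<Rightarrow> ('a, 'b) module \<Rightarrow> 'a set \<Rightarrow> (('a \<times> 'a) set, ('b \<times> 'a) set) module" where
  "localize_mod R M S =
    \<lparr> carrier = {locM_cls R M S (m, s) | m s. m \<in> carrier M \<and> s \<in> S},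
      mult = (\<lambda>A B. undefined),
      one = undefined,
      zero = locM_cls R M S (\<zero>\<^bsub>M\<^esub>, \<one>\<^bsub>R\<^esub>),
      add = (\<lambda>A B. let x = (SOME x. x \<in> A); y = (SOME y. y \<in> B) in
                 locM_cls R M S ((snd y \<odot>\<^bsub>M\<^esub> fst x) \<oplus>\<^bsub>M\<^esub> (snd x \<odot>\<^bsub>M\<^esub> fst y),
                                 snd x \<otimes>\<^bsub>R\<^esub> snd y)),
      smult = (\<lambda>A X. let a = (SOME a. a \<in> A); x = (SOME x. x \<in> X) in
                 locM_cls R M S (fst a \<odot>\<^bsub>M\<^esub> fst x, snd a \<otimes>\<^bsub>R\<^esub> snd x)) \<rparr>"

definition localize_form :: "('a, 'c) ring_scheme \<Rightarrow> ('a, 'b) module \<Rightarrow> 'a set \<Rightarrow> ('b \<Rightarrow> 'b \<Rightarrow> 'a)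
     \<Rightarrow> ('b \<times> 'a) set \<Rightarrow> ('b \<times> 'a) set \<Rightarrow> ('a \<times> 'a) set" where
  "localize_form R M S B X Y = (let x = (SOME x. x \<in> X); y = (SOME y. y \<in> Y) in
      locR_cls R S (B (fst x) (fst y), snd x \<otimes>\<^bsub>R\<^esub> snd y))"

definition lin_functional :: "('a, 'c) ring_scheme \<Rightarrow> ('a, 'b, 'd) module_scheme \<Rightarrow> ('b \<Rightarrow> 'a) \<Rightarrow> bool" where
  "lin_functional R M \<phi> \<longleftrightarrow> \<phi> \<in> carrier M \<rightarrow> carrier R \<and>
     (\<forall>x\<in>carrier M. \<forall>y\<in>carrier M. \<phi> (x \<oplus>\<^bsub>M\<^esub> y) = \<phi> x \<oplus>\<^bsub>R\<^esub> \<phi> y) \<and>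
     (\<forall>a\<in>carrier R. \<forall>x\<in>carrier M. \<phi> (a \<odot>\<^bsub>M\<^esub> x) = a \<otimes>\<^bsub>R\<^esub> \<phi> x)"

text \<open>Finitely generated projective: a direct summand (retract) of a free module R^k, i.e. there are
 a linear map P \<rightarrow> R^k, p \<mapsto> (\<phi>_i p)_i, and the linear map R^k \<rightarrow> P, (a_i) \<mapsto> \<Sum> a_i x_i,
 whose composite is the identity of P.\<close>

definition fg_projective :: "('a, 'c) ring_scheme \<Rightarrow> ('a, 'b) module \<Rightarrow> bool" where
  "fg_projective R M \<longleftrightarrow> (\<exists>(k::nat) x \<phi>. (\<forall>i<k. x i \<in> carrier M \<and> lin_functional R M (\<phi> i)) \<and>
     (\<forall>m\<in>carrier M. m = finsum M (\<lambda>i. \<phi> i m \<odot>\<^bsub>M\<^esub> x i) {..<k}))"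

definition free_of_rank :: "('r, 'c) ring_scheme \<Rightarrow> ('r, 'b) module \<Rightarrow> nat \<Rightarrow> bool" where
  "free_of_rank R M r \<longleftrightarrow> (\<exists>e. (\<forall>i<r. e i \<in> carrier M) \<and>
     (\<forall>m\<in>carrier M. \<exists>!a. a \<in> {..<r} \<rightarrow>\<^sub>E carrier R \<and> m = finsum M (\<lambda>i. a i \<odot>\<^bsub>M\<^esub> e i) {..<r}))"

definition const_rank :: "('a, 'c) ring_scheme \<Rightarrow> ('a, 'b) module \<Rightarrow> nat \<Rightarrow> bool" where
  "const_rank R M r \<longleftrightarrow> (\<forall>\<pp>. primeideal \<pp> R \<longrightarrow>
     free_of_rank (localize_ring R (carrier R - \<pp>)) (localize_mod R M (carrier R - \<pp>)) r)"

definition symmetric_bilinear :: "('a, 'c) ring_scheme \<Rightarrow> ('a, 'b, 'd) module_scheme \<Rightarrow> ('b \<Rightarrow> 'b \<Rightarrow> 'a) \<Rightarrow> bool" where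
  "symmetric_bilinear R M B \<longleftrightarrow>
     (\<forall>x\<in>carrier M. \<forall>y\<in>carrier M. B x y = B y x) \<and>
     (\<forall>y\<in>carrier M. lin_functional R M (\<lambda>x. B x y))"

definition nondegenerate :: "('a, 'c) ring_scheme \<Rightarrow> ('a, 'b, 'd) module_scheme \<Rightarrow> ('b \<Rightarrow> 'b \<Rightarrow> 'a) \<Rightarrow> bool" where
  "nondegenerate R M B \<longleftrightarrow> (\<forall>\<phi>. lin_functional R M \<phi> \<longrightarrow>
     (\<exists>!p. p \<in> carrier M \<and> (\<forall>x\<in>carrier M. B p x = \<phi> x)))"

definition orthogonal_module_rank :: "('a, 'c) ring_scheme \<Rightarrow> ('a, 'b) module \<Rightarrow> ('b \<Rightarrow> 'b \<Rightarrow> 'a) \<Rightarrow> nat \<Rightarrow> bool" where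
  "orthogonal_module_rank R M B r \<longleftrightarrow> module R M \<and> fg_projective R M \<and> even r \<and> const_rank R M r \<and>
     symmetric_bilinear R M B \<and> nondegenerate R M B"

definition orth_compl :: "('a, 'b, 'd) module_scheme \<Rightarrow> ('b \<Rightarrow> 'b \<Rightarrow> 'a) \<Rightarrow> 'a \<Rightarrow> 'b set \<Rightarrow> 'b set" where
  "orth_compl M B z N = {p \<in> carrier M. \<forall>x\<in>N. B p x = z}"

definition direct_summand :: "('a, 'c) ring_scheme \<Rightarrow> ('a, 'b, 'd) module_scheme \<Rightarrow> 'b set \<Rightarrow> bool" where
  "direct_summand R M N \<longleftrightarrow> submodule N R M \<and> (\<exists>N'. submodule N' R M \<and> N \<inter> N' = {\<zero>\<^bsub>M\<^esub>} \<and>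
     (\<forall>m\<in>carrier M. \<exists>a\<in>N. \<exists>b\<in>N'. m = a \<oplus>\<^bsub>M\<^esub> b))"

definition split_form :: "('a, 'c) ring_scheme \<Rightarrow> ('a, 'b, 'd) module_scheme \<Rightarrow> ('b \<Rightarrow> 'b \<Rightarrow> 'a) \<Rightarrow> bool" where
  "split_form R M B \<longleftrightarrow> (\<exists>N. direct_summand R M N \<and> N = orth_compl M B \<zero>\<^bsub>R\<^esub> N)"

definition locally_split :: "('a, 'c) ring_scheme \<Rightarrow> ('a, 'b) module \<Rightarrow> ('b \<Rightarrow> 'b \<Rightarrow> 'a) \<Rightarrow> bool" where
  "locally_split R M B \<longleftrightarrow> (\<forall>\<mm>. maximalideal \<mm> R \<longrightarrow>
     split_form (localize_ring R (carrier R - \<mm>)) (localize_mod R M (carrier R - \<mm>))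
                (localize_form R M (carrier R - \<mm>) B))"

definition hyp_sum :: "('a, 'c) ring_scheme \<Rightarrow> ('a, 'b) module \<Rightarrow> ('a, 'a \<times> 'a \<times> 'b) module" where
  "hyp_sum R P =
    \<lparr> carrier = carrier R \<times> carrier R \<times> carrier P,
      mult = (\<lambda>x y. undefined), one = undefined,
      zero = (\<zero>\<^bsub>R\<^esub>, \<zero>\<^bsub>R\<^esub>, \<zero>\<^bsub>P\<^esub>),
      add = (\<lambda>(a, b, p) (a', b', p'). (a \<oplus>\<^bsub>R\<^esub> a', b \<oplus>\<^bsub>R\<^esub> b', p \<oplus>\<^bsub>P\<^esub> p')),
      smult = (\<lambda>r (a, b, p). (r \<otimes>\<^bsub>R\<^esub> a, r \<otimes>\<^bsub>R\<^esub> b, r \<odot>\<^bsub>P\<^esub> p)) \<rparr>"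

definition hyp_form :: "('a, 'c) ring_scheme \<Rightarrow> ('b \<Rightarrow> 'b \<Rightarrow> 'a) \<Rightarrow> 'a \<times> 'a \<times> 'b \<Rightarrow> 'a \<times> 'a \<times> 'b \<Rightarrow> 'a" where
  "hyp_form R B = (\<lambda>(a, b, p) (a', b', p'). (a \<otimes>\<^bsub>R\<^esub> b') \<oplus>\<^bsub>R\<^esub> (a' \<otimes>\<^bsub>R\<^esub> b) \<oplus>\<^bsub>R\<^esub> B p p')"

definition unimodular :: "('a, 'c) ring_scheme \<Rightarrow> ('a, 'b, 'd) module_scheme \<Rightarrow> 'b \<Rightarrow> bool" where
  "unimodular R M u \<longleftrightarrow> (\<exists>\<phi>. lin_functional R M \<phi> \<and> \<phi> u = \<one>\<^bsub>R\<^esub>)"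

definition orth_transv :: "('a, 'b, 'd) module_scheme \<Rightarrow> ('b \<Rightarrow> 'b \<Rightarrow> 'a) \<Rightarrow> 'b \<Rightarrow> 'b \<Rightarrow> 'b \<Rightarrow> 'b" where
  "orth_transv M B u v = (\<lambda>m \<in> carrier M. (m \<ominus>\<^bsub>M\<^esub> (B u m \<odot>\<^bsub>M\<^esub> v)) \<oplus>\<^bsub>M\<^esub> (B v m \<odot>\<^bsub>M\<^esub> u))"

definition transv_data :: "('a, 'c) ring_scheme \<Rightarrow> ('a, 'b, 'd) module_scheme \<Rightarrow> ('b \<Rightarrow> 'b \<Rightarrow> 'a) \<Rightarrow> 'b \<Rightarrow> 'b \<Rightarrow> bool" where
  "transv_data R M B u v \<longleftrightarrow> u \<in> carrier M \<and> v \<in> carrier M \<and>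
     B u u = \<zero>\<^bsub>R\<^esub> \<and> B v v = \<zero>\<^bsub>R\<^esub> \<and> B u v = \<zero>\<^bsub>R\<^esub> \<and> (unimodular R M u \<or> unimodular R M v)"

definition ideal_submod :: "('a, 'b, 'd) module_scheme \<Rightarrow> 'a set \<Rightarrow> 'b set" where
  "ideal_submod M I = {finsum M (\<lambda>j. a j \<odot>\<^bsub>M\<^esub> x j) {..<(k::nat)} | k a x. \<forall>j<k. a j \<in> I \<and> x j \<in> carrier M}"

definition Trans_O_rel :: "('a, 'c) ring_scheme \<Rightarrow> ('a, 'b, 'd) module_scheme \<Rightarrow> ('b \<Rightarrow> 'b \<Rightarrow> 'a) \<Rightarrow> 'a set \<Rightarrow> ('b \<Rightarrow> 'b) set" where
  "Trans_O_rel R M B I = generate (BijGroup (carrier M))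
     {orth_transv M B u v | u v. transv_data R M B u v \<and> (u \<in> ideal_submod M I \<or> v \<in> ideal_submod M I)}"

definition rho_tr :: "('a, 'c) ring_scheme \<Rightarrow> ('a, 'b) module \<Rightarrow> ('b \<Rightarrow> 'b \<Rightarrow> 'a) \<Rightarrow> 'b \<Rightarrow> 'a \<times> 'a \<times> 'b \<Rightarrow> 'a \<times> 'a \<times> 'b" where
  "rho_tr R P B q = (\<lambda>x \<in> carrier (hyp_sum R P).
     (case x of (a, b, p) \<Rightarrow> (a, b \<oplus>\<^bsub>R\<^esub> B p q, p \<ominus>\<^bsub>P\<^esub> (a \<odot>\<^bsub>P\<^esub> q))))"

definition mu_tr :: "('a, 'c) ring_scheme \<Rightarrow> ('a, 'b) module \<Rightarrow> ('b \<Rightarrow> 'b \<Rightarrow> 'a) \<Rightarrow> 'b \<Rightarrow> 'a \<times> 'a \<times> 'b \<Rightarrow> 'a \<times> 'a \<times> 'b" where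
  "mu_tr R P B q = (\<lambda>x \<in> carrier (hyp_sum R P).
     (case x of (a, b, p) \<Rightarrow> (a \<oplus>\<^bsub>R\<^esub> B p q, b, p \<ominus>\<^bsub>P\<^esub> (b \<odot>\<^bsub>P\<^esub> q))))"

definition elem_gens :: "('a, 'c) ring_scheme \<Rightarrow> ('a, 'b) module \<Rightarrow> ('b \<Rightarrow> 'b \<Rightarrow> 'a) \<Rightarrow> 'b set
     \<Rightarrow> ('a \<times> 'a \<times> 'b \<Rightarrow> 'a \<times> 'a \<times> 'b) set" where
  "elem_gens R P B X = {rho_tr R P B q | q. q \<in> X \<and> B q q = \<zero>\<^bsub>R\<^esub>} \<union>
                       {mu_tr R P B q | q. q \<in> X \<and> B q q = \<zero>\<^bsub>R\<^esub>}"

definition ETrans_O :: "('a, 'c) ring_scheme \<Rightarrow> ('a, 'b) module \<Rightarrow> ('b \<Rightarrow> 'b \<Rightarrow> 'a)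
     \<Rightarrow> ('a \<times> 'a \<times> 'b \<Rightarrow> 'a \<times> 'a \<times> 'b) set" where
  "ETrans_O R P B = generate (BijGroup (carrier (hyp_sum R P))) (elem_gens R P B (carrier P))"

definition ETrans_O_ideal :: "('a, 'c) ring_scheme \<Rightarrow> ('a, 'b) module \<Rightarrow> ('b \<Rightarrow> 'b \<Rightarrow> 'a) \<Rightarrow> 'a set
     \<Rightarrow> ('a \<times> 'a \<times> 'b \<Rightarrow> 'a \<times> 'a \<times> 'b) set" where
  "ETrans_O_ideal R P B I = generate (BijGroup (carrier (hyp_sum R P))) (elem_gens R P B (ideal_submod P I))"

definition ETrans_O_rel :: "('a, 'c) ring_scheme \<Rightarrow> ('a, 'b) module \<Rightarrow> ('b \<Rightarrow> 'b \<Rightarrow> 'a) \<Rightarrow> 'a set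
     \<Rightarrow> ('a \<times> 'a \<times> 'b \<Rightarrow> 'a \<times> 'a \<times> 'b) set" where
  "ETrans_O_rel R P B I = (let G = BijGroup (carrier (hyp_sum R P)) in
     generate G {g \<otimes>\<^bsub>G\<^esub> h \<otimes>\<^bsub>G\<^esub> inv\<^bsub>G\<^esub> g | g h. g \<in> ETrans_O R P B \<and> h \<in> ETrans_O_ideal R P B I})"

end

theory Submission
  imports Defs
begin

text \<open>
  For isotropic \<open>u\<close> and \<open>v \<bottom> u\<close> let \<open>T(u, v)\<close> be the Eichler transformation, an orthogonal transvection
  when \<open>v\<close> is isotropic. It is additive in \<open>v\<close>, so the \<open>x \<in> R\<close> with \<open>T(u, xRv) \<subseteq> ETrans(Q, IQ)\<close> form an
  ideal, and it suffices to find, for each maximal ideal \<open>\<mm>\<close>, an element of it outside \<open>\<mm>\<close>; no polynomial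
  extension is needed.

  At \<open>\<mm>\<close> the module \<open>P\<close> contains two orthogonal planes spanned by isotropic \<open>e\<^sub>i, f\<^sub>i\<close> with \<open>\<langle>e\<^sub>i, f\<^sub>i\<rangle> \<notin> \<mm>\<close>.
  If \<open>(e, f)\<close> is a plane whose transvections are known to be elementary and \<open>v\<close> is isotropic and
  orthogonal to \<open>e, f, w\<close>, then, up to such transvections, \<open>T(v, \<langle>e, f\<rangle>\<^sup>2 w)\<close> is a commutator of
  \<open>T(e, v)\<close> with \<open>T(f, w')\<close>, where \<open>w'\<close> is the component of \<open>w\<close> orthogonal to the plane. Applied to the plane of
  \<open>R\<^sup>2\<close> this makes every \<open>T(y, w)\<close> with isotropic \<open>y \<in> P\<close> elementary. Applied to the planes in \<open>P\<close> it handles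
  \<open>T(u, \<langle>u, f\<rangle>y - \<langle>u, y\<rangle>f)\<close> whenever \<open>y \<in> P\<close> is isotropic and orthogonal to one of them; such \<open>y\<close>
  generate \<open>P\<close> at \<open>\<mm>\<close>, and together with \<open>T(u, cu) = 1\<close> these vectors exhaust \<open>\<langle>u, f\<rangle>\<^sup>2v\<close>. Since \<open>u\<close> is
  unimodular, \<open>\<langle>u, f\<rangle> \<notin> \<mm>\<close> can be arranged by an elementary conjugation.
\<close>

section \<open>Symmetric bilinear spaces and transvections\<close>

text \<open>Isotropic vectors are not closed under addition, so a parameter cannot be split into
  summands that are treated separately as long as only plain transvections are allowed. The term
  with half of \<langle>v, v\<rangle> in the Eichler transformation restores additivity for every
  \<open>v\<close> orthogonal to \<open>u\<close>; here 2 must be a unit. Statements at \<mm> are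
  phrased in the module itself, with scalars outside \<mm> in place of denominators. Every witness
  is then an actual element of the elementary group, and no group element over the localization has
  to be lifted. This is also why planes have a pairing outside \<mm> instead of 1, and why powers of
  the pairings accumulate. The two planes come from the Lagrangian at \<mm>. If the form took only
  values in \<mm> on pairs of a vector of the Lagrangian and any vector, Nakayama elimination would
  kill the Lagrangian. A single plane cannot contain three vectors that are independent at \<mm>, so
  there is room for a second one; this uses that the rank is at least 4.\<close>

locale orth_space = module R M for R (structure) and M (structure) +
  fixes B :: "'c \<Rightarrow> 'c \<Rightarrow> 'a" and h :: 'a
  assumes B_closed [simp]: "\<lbrakk>x \<in> carrier M; y \<in> carrier M\<rbrakk> \<Longrightarrow> B x y \<in> carrier R"
    and B_sym: "\<lbrakk>x \<in> carrier M; y \<in> carrier M\<rbrakk> \<Longrightarrow> B x y = B y x"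
    and B_add_l [simp]: "\<lbrakk>x \<in> carrier M; y \<in> carrier M; z \<in> carrier M\<rbrakk> \<Longrightarrow> B (x \<oplus>\<^bsub>M\<^esub> y) z = B x z \<oplus> B y z"
    and B_smult_l [simp]: "\<lbrakk>a \<in> carrier R; x \<in> carrier M; y \<in> carrier M\<rbrakk> \<Longrightarrow> B (a \<odot>\<^bsub>M\<^esub> x) y = a \<otimes> B x y"
    \<comment> \<open>Nondegeneracy in the form that turns module identities into ring identities.\<close>
    and B_sep: "\<lbrakk>x \<in> carrier M; y \<in> carrier M; \<And>z. z \<in> carrier M \<Longrightarrow> B x z = B y z\<rbrakk> \<Longrightarrow> x = y"
    and half_closed [simp]: "h \<in> carrier R"
    and half: "h \<oplus> h = \<one>"
begin

lemma B_add_r [simp]: "\<lbrakk>x \<in> carrier M; y \<in> carrier M; z \<in> carrier M\<rbrakk> \<Longrightarrow> B z (x \<oplus>\<^bsub>M\<^esub> y) = B z x \<oplus> B z y"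
  by (metis B_add_l B_sym M.a_closed)

lemma B_smult_r [simp]: "\<lbrakk>a \<in> carrier R; x \<in> carrier M; y \<in> carrier M\<rbrakk> \<Longrightarrow> B y (a \<odot>\<^bsub>M\<^esub> x) = a \<otimes> B y x"
  by (metis B_smult_l B_sym smult_closed)

lemma B_zero_l [simp]: "x \<in> carrier M \<Longrightarrow> B \<zero>\<^bsub>M\<^esub> x = \<zero>"
  by (metis B_smult_l M.zero_closed B_closed R.l_null R.zero_closed smult_l_null)

lemma B_zero_r [simp]: "x \<in> carrier M \<Longrightarrow> B x \<zero>\<^bsub>M\<^esub> = \<zero>"
  by (metis B_sym B_zero_l M.zero_closed)

lemma B_uminus_l [simp]: "\<lbrakk>x \<in> carrier M; y \<in> carrier M\<rbrakk> \<Longrightarrow> B (\<ominus>\<^bsub>M\<^esub> x) y = \<ominus> B x y"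
  by (metis B_add_l B_closed B_zero_l M.add.inv_closed M.l_neg R.minus_equality)

lemma B_uminus_r [simp]: "\<lbrakk>x \<in> carrier M; y \<in> carrier M\<rbrakk> \<Longrightarrow> B y (\<ominus>\<^bsub>M\<^esub> x) = \<ominus> B y x"
  by (metis B_sym B_uminus_l M.add.inv_closed)

lemma B_minus_l [simp]: "\<lbrakk>x \<in> carrier M; y \<in> carrier M; z \<in> carrier M\<rbrakk> \<Longrightarrow> B (x \<ominus>\<^bsub>M\<^esub> y) z = B x z \<ominus> B y z"
  by (simp add: a_minus_def)

lemma B_minus_r [simp]: "\<lbrakk>x \<in> carrier M; y \<in> carrier M; z \<in> carrier M\<rbrakk> \<Longrightarrow> B z (x \<ominus>\<^bsub>M\<^esub> y) = B z x \<ominus> B z y"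
  by (simp add: a_minus_def)

text \<open>The quadratic form whose polar form is \<open>B\<close>; \<open>h\<close> is the inverse
  of 2.\<close>

definition q where "q v = h \<otimes> B v v"

lemma q_closed [simp]: "v \<in> carrier M \<Longrightarrow> q v \<in> carrier R"
  by (simp add: q_def)

lemma q_twice: "v \<in> carrier M \<Longrightarrow> q v \<oplus> q v = B v v"
  by (metis B_closed half half_closed q_def R.l_distr R.l_one)

lemma q_add: "\<lbrakk>v \<in> carrier M; w \<in> carrier M\<rbrakk> \<Longrightarrow> q (v \<oplus>\<^bsub>M\<^esub> w) = q v \<oplus> q w \<oplus> B v w"
proof -
  assume *: "v \<in> carrier M" "w \<in> carrier M"
  have "h \<otimes> (B v v \<oplus> B v w \<oplus> (B v w \<oplus> B w w)) = h \<otimes> B v v \<oplus> h \<otimes> B w w \<oplus> (h \<oplus> h) \<otimes> B v w"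
    using * by (simp add: R.cring_simprules del: half)
  with * show ?thesis by (simp add: q_def half B_sym[of w v])
qed

text \<open>The Eichler transformation. For isotropic \<open>v\<close> the term with
  \<open>q v\<close> vanishes and the transvection of the theorem is left; for other
  \<open>v\<close> orthogonal to \<open>u\<close> that term keeps the map an isometry.\<close>

definition T where "T u v = (\<lambda>m \<in> carrier M. (m \<ominus>\<^bsub>M\<^esub> (B u m \<odot>\<^bsub>M\<^esub> v)) \<oplus>\<^bsub>M\<^esub> ((B v m \<ominus> q v \<otimes> B u m) \<odot>\<^bsub>M\<^esub> u))"

lemma T_closed [simp]: "\<lbrakk>u \<in> carrier M; v \<in> carrier M; m \<in> carrier M\<rbrakk> \<Longrightarrow> T u v m \<in> carrier M"
  by (simp add: T_def)

lemma T_apply: "m \<in> carrier M \<Longrightarrow> T u v m = (m \<ominus>\<^bsub>M\<^esub> (B u m \<odot>\<^bsub>M\<^esub> v)) \<oplus>\<^bsub>M\<^esub> ((B v m \<ominus> q v \<otimes> B u m) \<odot>\<^bsub>M\<^esub> u)"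
  by (simp add: T_def)

text \<open>The cross term \<open>B v w\<close> in \<open>q\<close> of the sum appears on the right
  when \<open>B v\<close> is evaluated at the image of the inner map.\<close>

lemma T_add:
  assumes "u \<in> carrier M" "v \<in> carrier M" "w \<in> carrier M" "m \<in> carrier M" "B u u = \<zero>" "B u v = \<zero>" "B u w = \<zero>"
  shows "T u (v \<oplus>\<^bsub>M\<^esub> w) m = T u v (T u w m)"
  by (rule B_sep) (use assms B_sym[of v u] B_sym[of w u] in \<open>simp_all add: T_apply q_add a_minus_def R.cring_simprules\<close>)

lemma T_iso:
  assumes "u \<in> carrier M" "v \<in> carrier M" "m \<in> carrier M" "n \<in> carrier M" "B u u = \<zero>" "B u v = \<zero>"
  shows "B (T u v m) (T u v n) = B m n"
proof -
  have "B v v = q v \<oplus> q v" using assms q_twice by simp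
  then show ?thesis
  using assms B_sym[of v u] B_sym[of m u] B_sym[of m v] by (simp add: T_apply a_minus_def R.cring_simprules)
qed

lemma T_zero: "\<lbrakk>u \<in> carrier M; m \<in> carrier M\<rbrakk> \<Longrightarrow> T u \<zero>\<^bsub>M\<^esub> m = m"
  by (simp add: T_apply q_def a_minus_def)

text \<open>Hence a parameter matters only modulo multiples of \<open>u\<close>; this absorbs the
  error terms along the axis in \<open>T_pr\<close> and \<open>T_local\<close>.\<close>

lemma T_self:
  assumes "u \<in> carrier M" "c \<in> carrier R" "m \<in> carrier M" "B u u = \<zero>"
  shows "T u (c \<odot>\<^bsub>M\<^esub> u) m = m"
  by (rule B_sep) (use assms in \<open>simp_all add: T_apply q_def a_minus_def R.cring_simprules\<close>)

section \<open>The permutation group, isometries and conjugation\<close>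

abbreviation G where "G \<equiv> BijGroup (carrier M)"

lemma group_G: "group G" by (rule group_BijGroup)

lemma G_mult: "\<lbrakk>f \<in> carrier G; g \<in> carrier G; m \<in> carrier M\<rbrakk> \<Longrightarrow> (f \<otimes>\<^bsub>G\<^esub> g) m = f (g m)"
  by (simp add: BijGroup_def compose_def)

lemma G_one: "m \<in> carrier M \<Longrightarrow> \<one>\<^bsub>G\<^esub> m = m"
  by (simp add: BijGroup_def)

lemma G_closed: "\<lbrakk>f \<in> carrier G; m \<in> carrier M\<rbrakk> \<Longrightarrow> f m \<in> carrier M"
  by (auto simp: BijGroup_def dest: Bij_imp_funcset)

lemma G_eqI: "\<lbrakk>f \<in> carrier G; g \<in> carrier G; \<And>m. m \<in> carrier M \<Longrightarrow> f m = g m\<rbrakk> \<Longrightarrow> f = g"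
  by (auto simp: BijGroup_def dest!: Bij_imp_extensional intro: extensionalityI)

lemma T_in_G:
  assumes "u \<in> carrier M" "v \<in> carrier M" "B u u = \<zero>" "B u v = \<zero>"
  shows "T u v \<in> carrier G"
proof -
  have *: "T u v (T u (\<ominus>\<^bsub>M\<^esub> v) m) = m" "T u (\<ominus>\<^bsub>M\<^esub> v) (T u v m) = m" if "m \<in> carrier M" for m
    using assms that by (simp_all add: T_add[symmetric] T_zero M.r_neg M.l_neg)
  have "bij_betw (T u v) (carrier M) (carrier M)"
    by (rule bij_betwI[where g="T u (\<ominus>\<^bsub>M\<^esub> v)"]) (use * assms in auto)
  moreover have "T u v \<in> extensional (carrier M)"
    by (simp add: T_def)
  ultimately show ?thesis
    by (simp add: BijGroup_def Bij_def)
qed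

lemma T_mult:
  assumes "u \<in> carrier M" "v \<in> carrier M" "w \<in> carrier M" "B u u = \<zero>" "B u v = \<zero>" "B u w = \<zero>"
  shows "T u (v \<oplus>\<^bsub>M\<^esub> w) = T u v \<otimes>\<^bsub>G\<^esub> T u w"
  using assms group.is_monoid[OF group_G] by (intro G_eqI) (simp_all add: T_in_G monoid.m_closed G_mult T_add)

lemma T_self_one: "\<lbrakk>u \<in> carrier M; c \<in> carrier R; B u u = \<zero>\<rbrakk> \<Longrightarrow> T u (c \<odot>\<^bsub>M\<^esub> u) = \<one>\<^bsub>G\<^esub>"
  using group.is_monoid[OF group_G] by (intro G_eqI) (simp_all add: T_in_G T_self G_one)

lemma T_zero_one: "u \<in> carrier M \<Longrightarrow> B u u = \<zero> \<Longrightarrow> T u \<zero>\<^bsub>M\<^esub> = \<one>\<^bsub>G\<^esub>"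
  using T_self_one[of u \<zero>] by simp

text \<open>For isotropic vectors the formula is bilinear and antisymmetric in axis and parameter. A
  claim about the axis \<open>v\<close> thus becomes one about an axis whose transvections are
  already under control.\<close>

lemma T_swap:
  assumes "u \<in> carrier M" "v \<in> carrier M" "B u u = \<zero>" "B v v = \<zero>" "r \<in> carrier R"
  shows "T v (r \<odot>\<^bsub>M\<^esub> u) = T u ((\<ominus> r) \<odot>\<^bsub>M\<^esub> v)"
proof -
  have "T v (r \<odot>\<^bsub>M\<^esub> u) m = T u ((\<ominus> r) \<odot>\<^bsub>M\<^esub> v) m" if "m \<in> carrier M" for m
    by (rule B_sep) (use assms that in \<open>simp_all add: T_apply q_def a_minus_def R.cring_simprules\<close>)
  then show ?thesis
    by (auto simp: T_def restrict_def fun_eq_iff)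
qed

text \<open>Linearity is not demanded: a bijection that preserves a separating form is linear, see
  \<open>Iso_smult\<close> and \<open>Iso_add\<close>.\<close>

definition Iso where "Iso = {g \<in> carrier G. \<forall>x\<in>carrier M. \<forall>y\<in>carrier M. B (g x) (g y) = B x y}"

lemma IsoD: "g \<in> Iso \<Longrightarrow> x \<in> carrier M \<Longrightarrow> y \<in> carrier M \<Longrightarrow> B (g x) (g y) = B x y"
  and Iso_G: "g \<in> Iso \<Longrightarrow> g \<in> carrier G"
  and Iso_closed [simp]: "g \<in> Iso \<Longrightarrow> x \<in> carrier M \<Longrightarrow> g x \<in> carrier M"
  by (auto simp: Iso_def G_closed)

lemma G_surj: "g \<in> carrier G \<Longrightarrow> x \<in> carrier M \<Longrightarrow> \<exists>y\<in>carrier M. x = g y"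
  unfolding BijGroup_def Bij_def bij_betw_def by auto

lemma Iso_sep:
  assumes "g \<in> Iso" "x \<in> carrier M" "y \<in> carrier M" "\<And>z. z \<in> carrier M \<Longrightarrow> B x (g z) = B y (g z)"
  shows "x = y"
  using assms G_surj[OF Iso_G[OF assms(1)]] by (metis B_sep)

lemma Iso_smult:
  assumes "g \<in> Iso" "x \<in> carrier M" "r \<in> carrier R"
  shows "g (r \<odot>\<^bsub>M\<^esub> x) = r \<odot>\<^bsub>M\<^esub> g x"
  by (rule Iso_sep[OF assms(1)]) (use assms in \<open>simp_all add: IsoD\<close>)

lemma Iso_subgroup: "subgroup Iso G"
proof (rule group.subgroupI[OF group_G])
  show "Iso \<subseteq> carrier G" by (auto simp: Iso_def)
  have "\<one>\<^bsub>G\<^esub> \<in> Iso"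
    using group.is_monoid[OF group_G] by (auto simp: Iso_def monoid.one_closed G_one)
  then show "Iso \<noteq> {}" by auto
  fix f assume f: "f \<in> Iso"
  have i: "inv\<^bsub>G\<^esub> f \<in> carrier G" using group.inv_closed[OF group_G Iso_G[OF f]] .
  have *: "f ((inv\<^bsub>G\<^esub> f) x) = x" if "x \<in> carrier M" for x
    using that G_mult[OF Iso_G[OF f] i that] by (simp add: group.r_inv[OF group_G Iso_G[OF f]] G_one)
  show "inv\<^bsub>G\<^esub> f \<in> Iso"
    using i * IsoD[OF f G_closed[OF i] G_closed[OF i]] unfolding Iso_def by auto
  fix g assume g: "g \<in> Iso"
  show "f \<otimes>\<^bsub>G\<^esub> g \<in> Iso"
    using f g group.is_monoid[OF group_G]
    by (auto simp: Iso_def G_mult monoid.m_closed G_closed)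
qed

lemma T_Iso: "\<lbrakk>u \<in> carrier M; v \<in> carrier M; B u u = \<zero>; B u v = \<zero>\<rbrakk> \<Longrightarrow> T u v \<in> Iso"
  by (simp add: Iso_def T_in_G T_iso)

lemma T_conj:
  assumes "g \<in> Iso" "u \<in> carrier M" "v \<in> carrier M" "B u u = \<zero>" "B u v = \<zero>"
  shows "T (g u) (g v) = g \<otimes>\<^bsub>G\<^esub> T u v \<otimes>\<^bsub>G\<^esub> inv\<^bsub>G\<^esub> g"
proof -
  have Tg: "T (g u) (g v) \<in> carrier G" "T u v \<in> carrier G" "g \<in> carrier G"
    using assms by (simp_all add: T_in_G IsoD Iso_G)
  have "T (g u) (g v) \<otimes>\<^bsub>G\<^esub> g = g \<otimes>\<^bsub>G\<^esub> T u v"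
  proof (rule G_eqI)
    fix m assume m: "m \<in> carrier M"
    have "T (g u) (g v) (g m) = g (T u v m)"
      by (rule Iso_sep[OF assms(1)]) (use assms m in \<open>simp_all add: IsoD T_apply q_def\<close>)
    then show "(T (g u) (g v) \<otimes>\<^bsub>G\<^esub> g) m = (g \<otimes>\<^bsub>G\<^esub> T u v) m"
      using Tg m by (simp add: G_mult)
  qed (use Tg group.is_monoid[OF group_G] in \<open>simp_all add: monoid.m_closed\<close>)
  then show ?thesis
    using Tg by (metis group.inv_solve_right group_G group.is_monoid monoid.m_closed)
qed

end

section \<open>Transvections orthogonal to a plane\<close>

context orth_space begin

text \<open>\<open>K\<close>, \<open>H\<close> and \<open>N\<close> stand for \<open>ETrans(Q)\<close>, \<open>ETrans(Q, IQ)\<close> and \<open>IQ\<close>.\<close>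

definition rel_triple where
  "rel_triple K H N \<longleftrightarrow> subgroup K G \<and> subgroup H G \<and>
     (\<forall>k\<in>K. \<forall>x\<in>H. k \<otimes>\<^bsub>G\<^esub> x \<otimes>\<^bsub>G\<^esub> inv\<^bsub>G\<^esub> k \<in> H) \<and>
     submodule N R M \<and> (\<forall>x\<in>N. \<forall>y\<in>carrier M. \<forall>z\<in>carrier M. B x y \<odot>\<^bsub>M\<^esub> z \<in> N)"

text \<open>The absolute and the relative membership travel together, because a commutator argument
  needs one factor in \<open>K\<close> and the other in \<open>H\<close>.\<close>

definition has_transvections where
  "has_transvections K H N u \<longleftrightarrow> u \<in> carrier M \<and> B u u = \<zero> \<and>
     (\<forall>w\<in>carrier M. B u w = \<zero> \<longrightarrow> T u w \<in> K) \<and> (\<forall>w\<in>N. B u w = \<zero> \<longrightarrow> T u w \<in> H)"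

text \<open>\<open>K\<close> normalizes \<open>H\<close>, so a commutator with one entry in
  \<open>H\<close> and the other in \<open>K\<close> lies in \<open>H\<close>. Therefore it suffices
  that one of \<open>v\<close> and \<open>w\<close> belongs to \<open>N\<close>.\<close>

lemma T_in_H_commutator:
  assumes KH: "rel_triple K H N"
    and e: "has_transvections K H N e" and f: "has_transvections K H N f"
    and v: "v \<in> carrier M" "B v v = \<zero>" "B e v = \<zero>" "B f v = \<zero>"
    and w: "w \<in> carrier M" "B e w = \<zero>" "B f w = \<zero>" "B v w = \<zero>"
    and N: "v \<in> N \<or> w \<in> N"
  shows "T v (B e f \<odot>\<^bsub>M\<^esub> w) \<in> H"
proof -
  note rules = KH[unfolded rel_triple_def] e[unfolded has_transvections_def] f[unfolded has_transvections_def]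
  interpret G: group G by (rule group_G)
  have K: "subgroup K G" and H: "subgroup H G" and nrm: "\<And>k x. k \<in> K \<Longrightarrow> x \<in> H \<Longrightarrow> k \<otimes>\<^bsub>G\<^esub> x \<otimes>\<^bsub>G\<^esub> inv\<^bsub>G\<^esub> k \<in> H"
    and NN: "submodule N R M" and Nz: "\<And>x y z. x \<in> N \<Longrightarrow> y \<in> carrier M \<Longrightarrow> z \<in> carrier M \<Longrightarrow> B x y \<odot>\<^bsub>M\<^esub> z \<in> N"
    using KH unfolding rel_triple_def by auto
  have em: "e \<in> carrier M" "f \<in> carrier M" "B e e = \<zero>" "B f f = \<zero>"
    using e f unfolding has_transvections_def by auto
  note sym = B_sym[OF em(2) em(1)] B_sym[OF v(1) em(1)] B_sym[OF v(1) em(2)] B_sym[OF w(1) em(1)] B_sym[OF w(1) em(2)] B_sym[OF w(1) v(1)]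
  define s where "s = B e f"
  have s: "s \<in> carrier R" using em by (simp add: s_def)
  define g where "g = T f w"
  define k where "k = T e v"
  have gI: "g \<in> Iso" unfolding g_def using em w by (intro T_Iso) auto
  have gG: "g \<in> carrier G" and kG: "k \<in> carrier G"
    unfolding g_def k_def using em v w by (auto intro: T_in_G)
  \<comment> \<open>\<open>T(e, v)\<close> conjugated by \<open>T(f, w)\<close> is \<open>T(ge, v)\<close>, and \<open>ge\<close> is \<open>e - \<langle>e, f\<rangle>w\<close> up to a multiple of \<open>f\<close>.\<close>
  have gv: "g v = v"
    unfolding g_def apply (rule B_sep)
    using em v w apply simp
    using em v w apply simp
    using em v w sym by (simp add: T_apply a_minus_def R.cring_simprules)
  have ge: "g e = \<ominus>\<^bsub>M\<^esub> (\<ominus>\<^bsub>M\<^esub> e \<oplus>\<^bsub>M\<^esub> (s \<odot>\<^bsub>M\<^esub> w \<oplus>\<^bsub>M\<^esub> (q w \<otimes> s) \<odot>\<^bsub>M\<^esub> f))"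
    unfolding g_def s_def apply (rule B_sep)
    using em v w apply simp
    using em v w apply simp
    using em v w sym by (simp add: T_apply a_minus_def R.cring_simprules)
  \<comment> \<open>\<open>?t'\<close> is the price of an anisotropic \<open>w\<close>: its
    parameter comes from the \<open>f\<close>-component of \<open>g e\<close>, which carries
    \<open>q w\<close>.\<close>
  let ?t = "T v (s \<odot>\<^bsub>M\<^esub> w)" and ?t' = "T v ((q w \<otimes> s) \<odot>\<^bsub>M\<^esub> f)"
  have t: "?t \<in> carrier G" "?t' \<in> carrier G"
    using em v w s sym by (auto intro!: T_in_G)
  have swap: "T v (\<ominus>\<^bsub>M\<^esub> x) = T x v" if "x \<in> carrier M" "B x x = \<zero>" for x
    using T_swap[of x v "\<ominus> \<one>"] that v by (simp add: smult_l_minus)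
  have "T (g e) (g v) = T v (\<ominus>\<^bsub>M\<^esub> (g e))"
    using em v gI by (simp add: gv swap IsoD)
  also have "\<dots> = T v (\<ominus>\<^bsub>M\<^esub> e \<oplus>\<^bsub>M\<^esub> (s \<odot>\<^bsub>M\<^esub> w \<oplus>\<^bsub>M\<^esub> (q w \<otimes> s) \<odot>\<^bsub>M\<^esub> f))"
    using em w s by (simp add: ge)
  also have "\<dots> = k \<otimes>\<^bsub>G\<^esub> (?t \<otimes>\<^bsub>G\<^esub> ?t')"
    using em v w s sym by (simp add: T_mult swap k_def)
  finally have eq: "k \<otimes>\<^bsub>G\<^esub> (?t \<otimes>\<^bsub>G\<^esub> ?t') = g \<otimes>\<^bsub>G\<^esub> k \<otimes>\<^bsub>G\<^esub> inv\<^bsub>G\<^esub> g"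
    using T_conj[OF gI em(1) v(1)] em v by (simp add: k_def)
  then have eq: "?t \<otimes>\<^bsub>G\<^esub> ?t' = inv\<^bsub>G\<^esub> k \<otimes>\<^bsub>G\<^esub> (g \<otimes>\<^bsub>G\<^esub> k \<otimes>\<^bsub>G\<^esub> inv\<^bsub>G\<^esub> g)"
    using t kG gG by (metis G.inv_solve_left G.m_closed G.inv_closed)
  have gK: "g \<in> K" and kK: "k \<in> K"
    using rules v w unfolding g_def k_def by auto
  have "inv\<^bsub>G\<^esub> k \<otimes>\<^bsub>G\<^esub> (g \<otimes>\<^bsub>G\<^esub> k \<otimes>\<^bsub>G\<^esub> inv\<^bsub>G\<^esub> g) \<in> H"
  \<comment> \<open>For \<open>v\<close> in \<open>N\<close> the element \<open>k\<close> is in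
    \<open>H\<close> and \<open>g\<close> conjugates it inside \<open>H\<close>. Otherwise
    \<open>g\<close> is in \<open>H\<close>, and the product is regrouped as a conjugate of
    \<open>g\<close> times the inverse of \<open>g\<close>.\<close>
  proof (cases "v \<in> N")
    case True
    then have "k \<in> H" using rules v unfolding k_def by auto
    then show ?thesis using nrm gK H by (metis subgroup.m_closed subgroup.m_inv_closed)
  next
    case False
    then have "g \<in> H" using rules w N unfolding g_def by auto
    moreover have "inv\<^bsub>G\<^esub> k \<otimes>\<^bsub>G\<^esub> g \<otimes>\<^bsub>G\<^esub> inv\<^bsub>G\<^esub> (inv\<^bsub>G\<^esub> k) \<in> H"
      using \<open>g \<in> H\<close> nrm kK K by (metis subgroup.m_inv_closed)
    ultimately have "(inv\<^bsub>G\<^esub> k \<otimes>\<^bsub>G\<^esub> g \<otimes>\<^bsub>G\<^esub> inv\<^bsub>G\<^esub> (inv\<^bsub>G\<^esub> k)) \<otimes>\<^bsub>G\<^esub> inv\<^bsub>G\<^esub> g \<in> H"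
      using H by (metis subgroup.m_closed subgroup.m_inv_closed)
    then show ?thesis using gG kG by (simp add: G.m_assoc)
  qed
  \<comment> \<open>After a swap the axis is \<open>f\<close> and the parameter a multiple of
    \<open>v\<close>. That multiple lies in \<open>N\<close> either through \<open>v\<close> itself
    or, when \<open>w\<close> is in \<open>N\<close>, because \<open>q w\<close> is half of
    \<open>B w w\<close> and \<open>N\<close> contains \<open>B w w\<close> times any
    vector.\<close>
  moreover have "?t' \<in> H"
  proof -
    have "(\<ominus> (q w \<otimes> s)) \<odot>\<^bsub>M\<^esub> v \<in> N"
    proof (cases "v \<in> N")
      case True
      then show ?thesis using submodule.smult_closed[OF NN] w s by simp
    next
      case False
      then have "B w w \<odot>\<^bsub>M\<^esub> v \<in> N" using Nz w v N by blast
      then have "(\<ominus> (h \<otimes> s)) \<odot>\<^bsub>M\<^esub> (B w w \<odot>\<^bsub>M\<^esub> v) \<in> N" using submodule.smult_closed[OF NN] s by simp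
      then show ?thesis using w s v by (simp add: smult_assoc1[symmetric] q_def R.cring_simprules)
    qed
    then have "T f ((\<ominus> (q w \<otimes> s)) \<odot>\<^bsub>M\<^esub> v) \<in> H"
      using rules em v w s by auto
    then show ?thesis using T_swap[of f v "q w \<otimes> s"] em v w s by simp
  qed
  ultimately have "?t \<otimes>\<^bsub>G\<^esub> ?t' \<otimes>\<^bsub>G\<^esub> inv\<^bsub>G\<^esub> ?t' \<in> H"
    using eq H by (metis subgroup.m_closed subgroup.m_inv_closed)
  then show ?thesis using t by (simp add: G.m_assoc s_def)
qed

text \<open>Removes the orthogonality of \<open>w\<close> to the plane. One factor
  \<open>B e f\<close> replaces the division in the projection of \<open>w\<close>, the other is the
  one that the commutator costs.\<close>

lemma T_in_H_plane:
  assumes KH: "rel_triple K H N"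
    and e: "has_transvections K H N e" and f: "has_transvections K H N f"
    and v: "v \<in> carrier M" "B v v = \<zero>" "B e v = \<zero>" "B f v = \<zero>"
    and w: "w \<in> carrier M" "B v w = \<zero>"
    and N: "v \<in> N \<or> w \<in> N"
  shows "T v ((B e f \<otimes> B e f) \<odot>\<^bsub>M\<^esub> w) \<in> H"
proof -
  have H: "subgroup H G" and NN: "submodule N R M"
    and Nz: "\<And>x y z. x \<in> N \<Longrightarrow> y \<in> carrier M \<Longrightarrow> z \<in> carrier M \<Longrightarrow> B x y \<odot>\<^bsub>M\<^esub> z \<in> N"
    using KH unfolding rel_triple_def by auto
  have em: "e \<in> carrier M" "f \<in> carrier M" "B e e = \<zero>" "B f f = \<zero>"
    using e f unfolding has_transvections_def by auto
  note sym = B_sym[OF em(2) em(1)] B_sym[OF v(1) em(1)] B_sym[OF v(1) em(2)] B_sym[OF w(1) v(1)]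
  define s where "s = B e f"
  have s: "s \<in> carrier R" using em by (simp add: s_def)
  define w' where "w' = s \<odot>\<^bsub>M\<^esub> w \<ominus>\<^bsub>M\<^esub> B f w \<odot>\<^bsub>M\<^esub> e \<ominus>\<^bsub>M\<^esub> B e w \<odot>\<^bsub>M\<^esub> f"
  have w': "w' \<in> carrier M" using em w s by (simp add: w'_def)
  have w'_orth: "B e w' = \<zero>" "B f w' = \<zero>" "B v w' = \<zero>"
    using em w v s sym by (simp_all add: w'_def s_def a_minus_def R.cring_simprules)
  have w'N: "w' \<in> N" if "w \<in> N"
  proof -
    have "B w f \<odot>\<^bsub>M\<^esub> e \<in> N" "B w e \<odot>\<^bsub>M\<^esub> f \<in> N" "s \<odot>\<^bsub>M\<^esub> w \<in> N"
      using Nz that em s submodule.smult_closed[OF NN] by auto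
    then show ?thesis
      unfolding w'_def a_minus_def using submoduleE(3,5)[OF NN] em w by (simp add: B_sym[of w])
  qed
  have in_N: "B f w \<odot>\<^bsub>M\<^esub> v \<in> N" "B e w \<odot>\<^bsub>M\<^esub> v \<in> N"
    using N Nz[of w f v] Nz[of w e v] submodule.smult_closed[OF NN, of _ v] em v w by (auto simp: B_sym[of w])
  \<comment> \<open>The components of \<open>w\<close> inside the plane need no commutator: a swap
    makes \<open>e\<close> or \<open>f\<close> the axis, with a multiple of \<open>v\<close> in
    \<open>N\<close> as parameter.\<close>
  have *: "T v ((s \<otimes> B x w) \<odot>\<^bsub>M\<^esub> y) \<in> H"
    if "B x w \<odot>\<^bsub>M\<^esub> v \<in> N" "has_transvections K H N y" "x \<in> carrier M" "B y v = \<zero>" for x y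
  proof -
    have "(\<ominus> s) \<odot>\<^bsub>M\<^esub> (B x w \<odot>\<^bsub>M\<^esub> v) \<in> N"
      using submodule.smult_closed[OF NN] that s by simp
    then have "(\<ominus> (s \<otimes> B x w)) \<odot>\<^bsub>M\<^esub> v \<in> N"
      using that s v w by (simp add: smult_assoc1[symmetric] R.cring_simprules)
    then have "T y ((\<ominus> (s \<otimes> B x w)) \<odot>\<^bsub>M\<^esub> v) \<in> H"
      using that s v w unfolding has_transvections_def by auto
    then show ?thesis
      using T_swap[of y v "s \<otimes> B x w"] that s v w unfolding has_transvections_def by simp
  qed
  have t: "T v (s \<odot>\<^bsub>M\<^esub> w') \<in> H"
    unfolding s_def by (rule T_in_H_commutator[OF KH e f v w' w'_orth]) (use N w'N in auto)
  have "(s \<otimes> s) \<odot>\<^bsub>M\<^esub> w = s \<odot>\<^bsub>M\<^esub> w' \<oplus>\<^bsub>M\<^esub> ((s \<otimes> B f w) \<odot>\<^bsub>M\<^esub> e \<oplus>\<^bsub>M\<^esub> (s \<otimes> B e w) \<odot>\<^bsub>M\<^esub> f)"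
    unfolding w'_def
    by (rule B_sep) (use em w s in \<open>simp_all add: a_minus_def R.cring_simprules\<close>)
  then have "T v ((s \<otimes> s) \<odot>\<^bsub>M\<^esub> w) = T v (s \<odot>\<^bsub>M\<^esub> w') \<otimes>\<^bsub>G\<^esub>
      (T v ((s \<otimes> B f w) \<odot>\<^bsub>M\<^esub> e) \<otimes>\<^bsub>G\<^esub> T v ((s \<otimes> B e w) \<odot>\<^bsub>M\<^esub> f))"
    using em v w w' w'_orth s sym by (simp add: T_mult)
  moreover have "T v ((s \<otimes> B f w) \<odot>\<^bsub>M\<^esub> e) \<in> H" "T v ((s \<otimes> B e w) \<odot>\<^bsub>M\<^esub> f) \<in> H"
    using * in_N e f em v by auto
  ultimately show ?thesis
    using t H unfolding s_def[symmetric] by (simp add: subgroup.m_closed)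
qed

end

section \<open>Membership tested at the maximal ideals\<close>

lemma (in cring) exists_maximalideal:
  assumes "ideal J R" "\<one> \<notin> J"
  shows "\<exists>\<mm>. maximalideal \<mm> R \<and> J \<subseteq> \<mm>"
proof -
  let ?A = "{K. ideal K R \<and> J \<subseteq> K \<and> \<one> \<notin> K}"
  have "\<exists>M\<in>?A. \<forall>X\<in>?A. M \<subseteq> X \<longrightarrow> X = M"
  proof (rule subset_Zorn_nonempty)
    have "J \<in> ?A" using assms by simp
    then show "?A \<noteq> {}" by auto
    fix C assume C: "C \<noteq> {}" "subset.chain ?A C"
    have CA: "ideal K R" "J \<subseteq> K" "\<one> \<notin> K" if "K \<in> C" for K
      using that C(2) by (auto simp: subset_chain_def)
    have sub: "K \<subseteq> carrier R" if "K \<in> C" for K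
      using ideal.Icarr[OF CA(1)[OF that]] by auto
    obtain K0 where K0: "K0 \<in> C" using C(1) by auto
    have "ideal (\<Union>C) R"
    proof (rule idealI[OF ring_axioms])
      have zero: "\<zero> \<in> \<Union>C"
        using additive_subgroup.zero_closed[OF ideal.axioms(1)[OF CA(1)[OF K0]]] K0 by auto
      have neg: "\<ominus> x \<in> \<Union>C" if "x \<in> \<Union>C" for x
        using that additive_subgroup.a_inv_closed[OF ideal.axioms(1)[OF CA(1)]] by auto
      have add: "x \<oplus> y \<in> \<Union>C" if xy: "x \<in> \<Union>C" "y \<in> \<Union>C" for x y
      proof -
        obtain X Y where XY: "X \<in> C" "Y \<in> C" "x \<in> X" "y \<in> Y" using xy by auto
        then have "X \<subseteq> Y \<or> Y \<subseteq> X" using C(2) by (auto simp: subset_chain_def)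
        then obtain K where "K \<in> C" "x \<in> K" "y \<in> K" using XY by auto
        then show ?thesis
          using additive_subgroup.a_closed[OF ideal.axioms(1)[OF CA(1)]] by auto
      qed
      show "subgroup (\<Union>C) (add_monoid R)"
      proof (rule subgroup.intro)
        show "\<Union>C \<subseteq> carrier (add_monoid R)" using sub by auto
      qed (use zero add neg[unfolded a_inv_def] in auto)
    next
      fix a x assume "a \<in> \<Union>C" "x \<in> carrier R"
      then show "x \<otimes> a \<in> \<Union>C" "a \<otimes> x \<in> \<Union>C"
        using ideal.I_l_closed[OF CA(1)] ideal.I_r_closed[OF CA(1)] by (blast, blast)
    qed
    then show "\<Union>C \<in> ?A"
      using CA K0 by auto
  qed
  then obtain M where M: "M \<in> ?A" "\<And>X. X \<in> ?A \<Longrightarrow> M \<subseteq> X \<Longrightarrow> X = M" by auto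
  have "maximalideal M R"
  proof (rule maximalidealI)
    fix X assume "ideal X R" "M \<subseteq> X" "X \<subseteq> carrier R"
    then show "X = M \<or> X = carrier R"
      using M(1) M(2)[of X] ideal.one_imp_carrier[of X R] by auto
  qed (use M in auto)
  with M show ?thesis by blast
qed

text \<open>Phrased by closure properties so that it applies directly to sets of scalars that are
  cut out by membership in a subgroup; closure under negation follows from multiplication by
  -1.\<close>

lemma (in cring) one_mem_if_locally:
  assumes J: "J \<subseteq> carrier R" "\<zero> \<in> J" "\<And>x y. x \<in> J \<Longrightarrow> y \<in> J \<Longrightarrow> x \<oplus> y \<in> J"
      "\<And>r x. r \<in> carrier R \<Longrightarrow> x \<in> J \<Longrightarrow> r \<otimes> x \<in> J"
    and loc: "\<And>\<mm>. maximalideal \<mm> R \<Longrightarrow> \<exists>t\<in>J. t \<notin> \<mm>"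
  shows "\<one> \<in> J"
proof (rule ccontr)
  assume no: "\<one> \<notin> J"
  have "ideal J R"
  proof (rule idealI[OF ring_axioms])
    have neg: "\<ominus> x \<in> J" if "x \<in> J" for x
      using J(1) J(4)[of "\<ominus> \<one>" x] that by (auto simp: l_minus subset_iff)
    show "subgroup J (add_monoid R)"
      by (rule subgroup.intro) (use J neg[unfolded a_inv_def] in auto)
    show "x \<otimes> a \<in> J" "a \<otimes> x \<in> J" if "a \<in> J" "x \<in> carrier R" for a x
      using J(4)[OF that(2,1)] J(1) that m_comm[of a x] by auto
  qed
  then show False
    using exists_maximalideal no loc by blast
qed

text \<open>AC-normalization can separate \<open>x\<close> from \<open>\<ominus> x\<close> by other summands; these rules cancel across them.\<close>

lemma (in cring) cancel_simps:
"\<lbrakk>x \<in> carrier R; y1 \<in> carrier R\<rbrakk> \<Longrightarrow> x \<oplus> (y1 \<oplus> \<ominus> x) = y1"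
    "\<lbrakk>x \<in> carrier R; y1 \<in> carrier R; z \<in> carrier R\<rbrakk> \<Longrightarrow> x \<oplus> (y1 \<oplus> (\<ominus> x \<oplus> z)) = y1 \<oplus> z"
    "\<lbrakk>x \<in> carrier R; y1 \<in> carrier R\<rbrakk> \<Longrightarrow> \<ominus> x \<oplus> (y1 \<oplus> x) = y1"
    "\<lbrakk>x \<in> carrier R; y1 \<in> carrier R; z \<in> carrier R\<rbrakk> \<Longrightarrow> \<ominus> x \<oplus> (y1 \<oplus> (x \<oplus> z)) = y1 \<oplus> z"
    "\<lbrakk>x \<in> carrier R; y1 \<in> carrier R; y2 \<in> carrier R\<rbrakk> \<Longrightarrow> x \<oplus> (y1 \<oplus> (y2 \<oplus> \<ominus> x)) = y1 \<oplus> (y2)"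
    "\<lbrakk>x \<in> carrier R; y1 \<in> carrier R; y2 \<in> carrier R; z \<in> carrier R\<rbrakk> \<Longrightarrow> x \<oplus> (y1 \<oplus> (y2 \<oplus> (\<ominus> x \<oplus> z))) = y1 \<oplus> (y2 \<oplus> z)"
    "\<lbrakk>x \<in> carrier R; y1 \<in> carrier R; y2 \<in> carrier R\<rbrakk> \<Longrightarrow> \<ominus> x \<oplus> (y1 \<oplus> (y2 \<oplus> x)) = y1 \<oplus> (y2)"
    "\<lbrakk>x \<in> carrier R; y1 \<in> carrier R; y2 \<in> carrier R; z \<in> carrier R\<rbrakk> \<Longrightarrow> \<ominus> x \<oplus> (y1 \<oplus> (y2 \<oplus> (x \<oplus> z))) = y1 \<oplus> (y2 \<oplus> z)"
    "\<lbrakk>x \<in> carrier R; y1 \<in> carrier R; y2 \<in> carrier R; y3 \<in> carrier R\<rbrakk> \<Longrightarrow> x \<oplus> (y1 \<oplus> (y2 \<oplus> (y3 \<oplus> \<ominus> x))) = y1 \<oplus> (y2 \<oplus> (y3))"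
    "\<lbrakk>x \<in> carrier R; y1 \<in> carrier R; y2 \<in> carrier R; y3 \<in> carrier R; z \<in> carrier R\<rbrakk> \<Longrightarrow> x \<oplus> (y1 \<oplus> (y2 \<oplus> (y3 \<oplus> (\<ominus> x \<oplus> z)))) = y1 \<oplus> (y2 \<oplus> (y3 \<oplus> z))"
    "\<lbrakk>x \<in> carrier R; y1 \<in> carrier R; y2 \<in> carrier R; y3 \<in> carrier R\<rbrakk> \<Longrightarrow> \<ominus> x \<oplus> (y1 \<oplus> (y2 \<oplus> (y3 \<oplus> x))) = y1 \<oplus> (y2 \<oplus> (y3))"
    "\<lbrakk>x \<in> carrier R; y1 \<in> carrier R; y2 \<in> carrier R; y3 \<in> carrier R; z \<in> carrier R\<rbrakk> \<Longrightarrow> \<ominus> x \<oplus> (y1 \<oplus> (y2 \<oplus> (y3 \<oplus> (x \<oplus> z)))) = y1 \<oplus> (y2 \<oplus> (y3 \<oplus> z))"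
    "\<lbrakk>x \<in> carrier R; y1 \<in> carrier R; y2 \<in> carrier R; y3 \<in> carrier R; y4 \<in> carrier R\<rbrakk> \<Longrightarrow> x \<oplus> (y1 \<oplus> (y2 \<oplus> (y3 \<oplus> (y4 \<oplus> \<ominus> x)))) = y1 \<oplus> (y2 \<oplus> (y3 \<oplus> (y4)))"
    "\<lbrakk>x \<in> carrier R; y1 \<in> carrier R; y2 \<in> carrier R; y3 \<in> carrier R; y4 \<in> carrier R; z \<in> carrier R\<rbrakk> \<Longrightarrow> x \<oplus> (y1 \<oplus> (y2 \<oplus> (y3 \<oplus> (y4 \<oplus> (\<ominus> x \<oplus> z))))) = y1 \<oplus> (y2 \<oplus> (y3 \<oplus> (y4 \<oplus> z)))"
    "\<lbrakk>x \<in> carrier R; y1 \<in> carrier R; y2 \<in> carrier R; y3 \<in> carrier R; y4 \<in> carrier R\<rbrakk> \<Longrightarrow> \<ominus> x \<oplus> (y1 \<oplus> (y2 \<oplus> (y3 \<oplus> (y4 \<oplus> x)))) = y1 \<oplus> (y2 \<oplus> (y3 \<oplus> (y4)))"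
    "\<lbrakk>x \<in> carrier R; y1 \<in> carrier R; y2 \<in> carrier R; y3 \<in> carrier R; y4 \<in> carrier R; z \<in> carrier R\<rbrakk> \<Longrightarrow> \<ominus> x \<oplus> (y1 \<oplus> (y2 \<oplus> (y3 \<oplus> (y4 \<oplus> (x \<oplus> z))))) = y1 \<oplus> (y2 \<oplus> (y3 \<oplus> (y4 \<oplus> z)))"
  by (simp_all add: r_neg l_neg r_neg1 r_neg2 a_lcomm[of x y1] a_lcomm[of "\<ominus> x" y1] a_lcomm[of x y2] a_lcomm[of "\<ominus> x" y2] a_lcomm[of x y3] a_lcomm[of "\<ominus> x" y3] a_lcomm[of x y4] a_lcomm[of "\<ominus> x" y4])

section \<open>Spanning by isotropic vectors orthogonal to a plane\<close>

context orth_space begin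

definition perp where "perp e f = {x \<in> carrier M. B e x = \<zero> \<and> B f x = \<zero>}"

lemmas bil = a_minus_def R.cring_simprules R.cancel_simps

lemma perp_commute: "perp e f = perp f e"
  by (auto simp: perp_def)

definition two_planes where
  "two_planes e f \<mm> \<longleftrightarrow> (\<exists>e1\<in>perp e f. \<exists>f1\<in>perp e f. \<exists>e2\<in>perp e f. \<exists>f2\<in>perp e f.
     B e1 e1 = \<zero> \<and> B f1 f1 = \<zero> \<and> B e2 e2 = \<zero> \<and> B f2 f2 = \<zero> \<and>
     B e1 e2 = \<zero> \<and> B e1 f2 = \<zero> \<and> B f1 e2 = \<zero> \<and> B f1 f2 = \<zero> \<and> B e1 f1 \<notin> \<mm> \<and> B e2 f2 \<notin> \<mm>)"

text \<open>Isotropic vectors with a spare plane beside them, which may vary with \<open>y\<close>;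
  its two vectors become the axes of the commutator in \<open>T_koszul_local\<close>.\<close>

definition plane_orth where
  "plane_orth e f \<mm> = {y \<in> perp e f. B y y = \<zero> \<and> (\<exists>e1\<in>perp e f. \<exists>f1\<in>perp e f.
     B e1 e1 = \<zero> \<and> B f1 f1 = \<zero> \<and> B e1 y = \<zero> \<and> B f1 y = \<zero> \<and> B e1 f1 \<notin> \<mm>)}"

lemma plane_orthI:
  "\<lbrakk>e1 \<in> perp e f; f1 \<in> perp e f; B e1 e1 = \<zero>; B f1 f1 = \<zero>; B e1 f1 \<notin> \<mm>;
    y \<in> perp e f; B y y = \<zero>; B e1 y = \<zero>; B f1 y = \<zero>\<rbrakk> \<Longrightarrow> y \<in> plane_orth e f \<mm>"
  unfolding plane_orth_def by blast

lemma perp_closed: "e \<in> carrier M \<Longrightarrow> f \<in> carrier M \<Longrightarrow> x \<in> perp e f \<Longrightarrow> y \<in> perp e f \<Longrightarrow> x \<oplus>\<^bsub>M\<^esub> y \<in> perp e f"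
  "e \<in> carrier M \<Longrightarrow> f \<in> carrier M \<Longrightarrow> x \<in> perp e f \<Longrightarrow> r \<in> carrier R \<Longrightarrow> r \<odot>\<^bsub>M\<^esub> x \<in> perp e f"
  by (simp_all add: perp_def)

lemma maximal_mult:
  assumes "maximalideal \<mm> R" "s \<in> carrier R" "t \<in> carrier R" "s \<notin> \<mm>" "t \<notin> \<mm>"
  shows "s \<otimes> t \<notin> \<mm>"
  using primeideal.I_prime[OF R.maximalideal_prime[OF assms(1)] assms(2,3)] assms(4,5) by auto

text \<open>Each of two orthogonal planes is a spare plane for the vectors of the other. What is
  left of \<open>p\<close> after splitting off both becomes isotropic by adding a vector of the
  first plane, and then the second is still spare. \<open>D\<close> is kept arbitrary since the
  lemma is applied to sets defined by different membership conditions.\<close>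

lemma plane_orth_spans:
  assumes ef: "e \<in> carrier M" "f \<in> carrier M" and m: "maximalideal \<mm> R" and tp: "two_planes e f \<mm>"
    and D: "plane_orth e f \<mm> \<subseteq> D" "D \<subseteq> carrier M" "\<And>x y. x \<in> D \<Longrightarrow> y \<in> D \<Longrightarrow> x \<oplus>\<^bsub>M\<^esub> y \<in> D"
       "\<And>r x. r \<in> carrier R \<Longrightarrow> x \<in> D \<Longrightarrow> r \<odot>\<^bsub>M\<^esub> x \<in> D"
    and p: "p \<in> perp e f"
  shows "\<exists>t\<in>carrier R - \<mm>. t \<odot>\<^bsub>M\<^esub> p \<in> D"
proof -
  obtain e1 f1 e2 f2 where pl: "e1 \<in> perp e f" "f1 \<in> perp e f" "e2 \<in> perp e f" "f2 \<in> perp e f"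
     "B e1 e1 = \<zero>" "B f1 f1 = \<zero>" "B e2 e2 = \<zero>" "B f2 f2 = \<zero>"
     "B e1 e2 = \<zero>" "B e1 f2 = \<zero>" "B f1 e2 = \<zero>" "B f1 f2 = \<zero>" "B e1 f1 \<notin> \<mm>" "B e2 f2 \<notin> \<mm>"
    using tp unfolding two_planes_def by blast
  have c: "e1 \<in> carrier M" "f1 \<in> carrier M" "e2 \<in> carrier M" "f2 \<in> carrier M" "p \<in> carrier M"
    using pl p by (simp_all add: perp_def)
  note pz = pl(1-4)[unfolded perp_def] p[unfolded perp_def]
  note sym = B_sym[OF c(2) c(1)] B_sym[OF c(4) c(3)] B_sym[OF c(3) c(1)] B_sym[OF c(3) c(2)]
    B_sym[OF c(4) c(1)] B_sym[OF c(4) c(2)] B_sym[OF c(5) c(1)] B_sym[OF c(5) c(2)] B_sym[OF c(5) c(3)] B_sym[OF c(5) c(4)]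
  define h1 h2 where "h1 = B e1 f1" and "h2 = B e2 f2"
  have hc: "h1 \<in> carrier R" "h2 \<in> carrier R" using c by (simp_all add: h1_def h2_def)
  \<comment> \<open>Projections off the first plane and then off the second, with multiplication by
    \<open>h1\<close> and \<open>h2\<close> in place of division by the pairings.\<close>
  define p1 where "p1 = h1 \<odot>\<^bsub>M\<^esub> p \<oplus>\<^bsub>M\<^esub> (\<ominus> B p f1) \<odot>\<^bsub>M\<^esub> e1 \<oplus>\<^bsub>M\<^esub> (\<ominus> B p e1) \<odot>\<^bsub>M\<^esub> f1"
  define p2 where "p2 = h2 \<odot>\<^bsub>M\<^esub> p1 \<oplus>\<^bsub>M\<^esub> (\<ominus> B p1 f2) \<odot>\<^bsub>M\<^esub> e2 \<oplus>\<^bsub>M\<^esub> (\<ominus> B p1 e2) \<odot>\<^bsub>M\<^esub> f2"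
  have p1c: "p1 \<in> carrier M" using c hc by (simp add: p1_def)
  have p2c: "p2 \<in> carrier M" using c hc p1c by (simp add: p2_def)
  have p1o: "p1 \<in> perp e f" "B e1 p1 = \<zero>" "B f1 p1 = \<zero>"
    using c hc pz pl sym ef by (simp_all add: p1_def h1_def perp_def R.cring_simprules)
  have p2o: "p2 \<in> perp e f" "B e1 p2 = \<zero>" "B f1 p2 = \<zero>" "B e2 p2 = \<zero>" "B f2 p2 = \<zero>"
    using c hc pz pl sym ef p1o p1c B_sym[OF p1c c(3)] B_sym[OF p1c c(4)]
    by (simp_all add: p2_def h2_def perp_def R.cring_simprules)
  \<comment> \<open>Correct \<open>p2\<close> inside the first plane to an isotropic vector, which is still orthogonal to the second.\<close>
  define y where "y = h1 \<odot>\<^bsub>M\<^esub> p2 \<oplus>\<^bsub>M\<^esub> h1 \<odot>\<^bsub>M\<^esub> e1 \<oplus>\<^bsub>M\<^esub> (\<ominus> q p2) \<odot>\<^bsub>M\<^esub> f1"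
  have "y \<in> perp e f"
    using c hc ef pz p2c p2o(1) by (simp add: y_def perp_def)
  moreover have "B y y = \<zero>" "B e2 y = \<zero>" "B f2 y = \<zero>"
    using c hc ef pz p2c p2o sym pl B_sym[OF p2c c(1)] B_sym[OF p2c c(2)] q_twice[OF p2c, symmetric]
    by (simp_all add: y_def h1_def[symmetric] R.cring_simprules)
  ultimately have yD: "y \<in> D"
    using plane_orthI[OF pl(3,4,7,8,14)] D(1) by auto
  have "e1 \<in> plane_orth e f \<mm>" "f1 \<in> plane_orth e f \<mm>"
    by (rule plane_orthI[OF pl(3,4,7,8,14)]; use pl sym in simp)+
  moreover have "e2 \<in> plane_orth e f \<mm>" "f2 \<in> plane_orth e f \<mm>"
    by (rule plane_orthI[OF pl(1,2,5,6,13)]; use pl sym in simp)+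
  ultimately have gD: "e1 \<in> D" "f1 \<in> D" and gD2: "e2 \<in> D" "f2 \<in> D"
    using D(1) by auto
  have y: "h1 \<odot>\<^bsub>M\<^esub> p2 = y \<oplus>\<^bsub>M\<^esub> ((\<ominus> h1) \<odot>\<^bsub>M\<^esub> e1 \<oplus>\<^bsub>M\<^esub> q p2 \<odot>\<^bsub>M\<^esub> f1)"
    by (rule B_sep) (use c hc p2c in \<open>simp_all add: y_def bil\<close>)
  have "h2 \<odot>\<^bsub>M\<^esub> p1 = p2 \<oplus>\<^bsub>M\<^esub> (B p1 f2 \<odot>\<^bsub>M\<^esub> e2 \<oplus>\<^bsub>M\<^esub> B p1 e2 \<odot>\<^bsub>M\<^esub> f2)"
    by (rule B_sep) (use c hc p1c in \<open>simp_all add: p2_def bil\<close>)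
  then have "(h1 \<otimes> h2) \<odot>\<^bsub>M\<^esub> p1 = h1 \<odot>\<^bsub>M\<^esub> p2 \<oplus>\<^bsub>M\<^esub> (h1 \<odot>\<^bsub>M\<^esub> (B p1 f2 \<odot>\<^bsub>M\<^esub> e2) \<oplus>\<^bsub>M\<^esub> h1 \<odot>\<^bsub>M\<^esub> (B p1 e2 \<odot>\<^bsub>M\<^esub> f2))"
    using c hc p1c p2c by (simp add: smult_assoc1 smult_r_distr)
  then have p1D: "(h1 \<otimes> h2) \<odot>\<^bsub>M\<^esub> p1 \<in> D"
    using yD gD gD2 c hc p1c p2c unfolding y by (simp add: D(3,4))
  have "h1 \<odot>\<^bsub>M\<^esub> p = p1 \<oplus>\<^bsub>M\<^esub> (B p f1 \<odot>\<^bsub>M\<^esub> e1 \<oplus>\<^bsub>M\<^esub> B p e1 \<odot>\<^bsub>M\<^esub> f1)"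
    by (rule B_sep) (use c hc in \<open>simp_all add: p1_def bil\<close>)
  then have "(h1 \<otimes> h2 \<otimes> h1) \<odot>\<^bsub>M\<^esub> p = (h1 \<otimes> h2) \<odot>\<^bsub>M\<^esub> p1 \<oplus>\<^bsub>M\<^esub>
     ((h1 \<otimes> h2) \<odot>\<^bsub>M\<^esub> (B p f1 \<odot>\<^bsub>M\<^esub> e1) \<oplus>\<^bsub>M\<^esub> (h1 \<otimes> h2) \<odot>\<^bsub>M\<^esub> (B p e1 \<odot>\<^bsub>M\<^esub> f1))"
    using c hc p1c by (simp add: smult_assoc1[of "h1 \<otimes> h2" h1 p] smult_r_distr)
  then have "(h1 \<otimes> h2 \<otimes> h1) \<odot>\<^bsub>M\<^esub> p \<in> D"
    using p1D gD c hc by (simp add: D(3,4))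
  \<comment> \<open>One factor for each construction: \<open>h1\<close> for \<open>p1\<close>,
    \<open>h2\<close> for \<open>p2\<close>, and \<open>h1\<close> again for
    \<open>y\<close>.\<close>
  moreover have "h1 \<otimes> h2 \<otimes> h1 \<notin> \<mm>"
    using maximal_mult[OF m] hc pl(13,14) unfolding h1_def[symmetric] h2_def[symmetric] by simp
  ultimately show ?thesis using hc by auto
qed


lemma T_add_in:
  assumes "subgroup X G" "u \<in> carrier M" "B u u = \<zero>" "x \<in> carrier M" "y \<in> carrier M" "B u x = \<zero>" "B u y = \<zero>"
    and "T u x \<in> X" "T u y \<in> X"
  shows "T u (x \<oplus>\<^bsub>M\<^esub> y) \<in> X"
  using assms by (simp add: T_mult subgroup.m_closed)

lemma T_zero_in: "\<lbrakk>subgroup X G; u \<in> carrier M; B u u = \<zero>\<rbrakk> \<Longrightarrow> T u \<zero>\<^bsub>M\<^esub> \<in> X"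
  by (simp add: T_zero_one subgroup.one_closed)

text \<open>The universally quantified \<open>r\<close> makes the set of admissible \<open>s\<close>
  closed under multiplication by ring elements, and additivity of \<open>T\<close> closes it under
  sums. It is thus an ideal contained in no maximal ideal.\<close>

lemma T_local_global:
  assumes X: "subgroup X G" and u: "u \<in> carrier M" "B u u = \<zero>" "v \<in> carrier M" "B u v = \<zero>"
    and loc: "\<And>\<mm>. maximalideal \<mm> R \<Longrightarrow> \<exists>s\<in>carrier R - \<mm>. \<forall>r\<in>carrier R. T u ((s \<otimes> r) \<odot>\<^bsub>M\<^esub> v) \<in> X"
  shows "T u v \<in> X"
proof -
  let ?J = "{s \<in> carrier R. \<forall>r\<in>carrier R. T u ((s \<otimes> r) \<odot>\<^bsub>M\<^esub> v) \<in> X}"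
  have "\<one> \<in> ?J"
  proof (rule one_mem_if_locally)
    show "\<zero> \<in> ?J" using X u by (simp add: T_zero_in)
    show "x \<oplus> y \<in> ?J" if "x \<in> ?J" "y \<in> ?J" for x y
      using that X u by (auto simp: smult_l_distr R.l_distr intro!: T_add_in)
    show "r \<otimes> x \<in> ?J" if "r \<in> carrier R" "x \<in> ?J" for r x
    proof -
      have "r \<otimes> x \<otimes> r' = x \<otimes> (r \<otimes> r')" if "r' \<in> carrier R" for r'
        using \<open>r \<in> carrier R\<close> \<open>x \<in> ?J\<close> that by (simp add: R.m_ac)
      with that show ?thesis by auto
    qed
  qed (use loc in auto)
  then have "T u ((\<one> \<otimes> \<one>) \<odot>\<^bsub>M\<^esub> v) \<in> X" by blast
  then show ?thesis using u by simp
qed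

text \<open>Passes from isotropic to arbitrary parameters in \<open>perp e f\<close>. The factor
  \<alpha> serves the relative case, where it is taken from \<open>I\<close>; the factor
  \<open>r\<close> keeps the set of good vectors closed under scalars.\<close>

lemma T_perp_in:
  assumes X: "subgroup X G" and ef: "e \<in> carrier M" "f \<in> carrier M" "B e e = \<zero>"
    and tp: "\<And>\<mm>. maximalideal \<mm> R \<Longrightarrow> two_planes e f \<mm>"
    and a: "\<alpha> \<in> carrier R"
    and iso: "\<And>y r. \<lbrakk>y \<in> perp e f; B y y = \<zero>; r \<in> carrier R\<rbrakk> \<Longrightarrow> T e ((r \<otimes> \<alpha>) \<odot>\<^bsub>M\<^esub> y) \<in> X"
    and p: "p \<in> perp e f"
  shows "T e (\<alpha> \<odot>\<^bsub>M\<^esub> p) \<in> X"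
proof (rule T_local_global[OF X])
  let ?D = "{y \<in> perp e f. \<forall>r\<in>carrier R. T e ((r \<otimes> \<alpha>) \<odot>\<^bsub>M\<^esub> y) \<in> X}"
  fix \<mm> assume m: "maximalideal \<mm> R"
  have "\<exists>t\<in>carrier R - \<mm>. t \<odot>\<^bsub>M\<^esub> p \<in> ?D"
  proof (rule plane_orth_spans[OF ef(1,2) m tp[OF m] _ _ _ _ p])
    show "plane_orth e f \<mm> \<subseteq> ?D" using iso by (auto simp: plane_orth_def)
    show "?D \<subseteq> carrier M" by (auto simp: perp_def)
    show "x \<oplus>\<^bsub>M\<^esub> y \<in> ?D" if "x \<in> ?D" "y \<in> ?D" for x y
      using that X ef a by (auto simp: perp_def smult_r_distr intro!: T_add_in)
    show "s \<odot>\<^bsub>M\<^esub> x \<in> ?D" if "s \<in> carrier R" "x \<in> ?D" for s x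
    proof -
      have "(r \<otimes> \<alpha>) \<odot>\<^bsub>M\<^esub> (s \<odot>\<^bsub>M\<^esub> x) = ((r \<otimes> s) \<otimes> \<alpha>) \<odot>\<^bsub>M\<^esub> x" if "r \<in> carrier R" for r
        using that \<open>s \<in> carrier R\<close> \<open>x \<in> ?D\<close> a by (simp add: perp_def smult_assoc1[symmetric] R.m_ac)
      with that show ?thesis using ef by (auto simp: perp_closed)
    qed
  qed
  then obtain t where t: "t \<in> carrier R - \<mm>" "\<And>r. r \<in> carrier R \<Longrightarrow> T e ((r \<otimes> \<alpha>) \<odot>\<^bsub>M\<^esub> (t \<odot>\<^bsub>M\<^esub> p)) \<in> X"
    by auto
  moreover have "(r \<otimes> \<alpha>) \<odot>\<^bsub>M\<^esub> (t \<odot>\<^bsub>M\<^esub> p) = (t \<otimes> r) \<odot>\<^bsub>M\<^esub> (\<alpha> \<odot>\<^bsub>M\<^esub> p)" if "r \<in> carrier R" for r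
    using that t(1) p a by (simp add: perp_def smult_assoc1[symmetric] R.m_ac)
  ultimately show "\<exists>s\<in>carrier R - \<mm>. \<forall>r\<in>carrier R. T e ((s \<otimes> r) \<odot>\<^bsub>M\<^esub> (\<alpha> \<odot>\<^bsub>M\<^esub> p)) \<in> X"
    by auto
qed (use p a ef in \<open>auto simp: perp_def\<close>)

section \<open>Projection off a hyperbolic pair and induction over the ideal submodule\<close>

definition pr where "pr e f x = x \<oplus>\<^bsub>M\<^esub> ((\<ominus> B f x) \<odot>\<^bsub>M\<^esub> e \<oplus>\<^bsub>M\<^esub> (\<ominus> B e x) \<odot>\<^bsub>M\<^esub> f)"

definition hyp_pair where
  "hyp_pair e f \<longleftrightarrow> e \<in> carrier M \<and> f \<in> carrier M \<and> B e e = \<zero> \<and> B f f = \<zero> \<and> B e f = \<one>"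

lemma hyp_pair_commute: "hyp_pair e f \<Longrightarrow> hyp_pair f e"
  by (auto simp: hyp_pair_def B_sym)

lemma pr_perp: "hyp_pair e f \<Longrightarrow> x \<in> carrier M \<Longrightarrow> pr e f x \<in> perp e f"
  using B_sym[of f e] by (simp add: hyp_pair_def pr_def perp_def R.cring_simprules)

lemma pr_add:
  assumes "hyp_pair e f" "x \<in> carrier M" "y \<in> carrier M"
  shows "pr e f (x \<oplus>\<^bsub>M\<^esub> y) = pr e f x \<oplus>\<^bsub>M\<^esub> pr e f y"
  by (rule B_sep) (use assms in \<open>simp_all add: hyp_pair_def pr_def R.cring_simprules\<close>)

lemma pr_smult:
  assumes "hyp_pair e f" "x \<in> carrier M" "r \<in> carrier R"
  shows "pr e f (r \<odot>\<^bsub>M\<^esub> x) = r \<odot>\<^bsub>M\<^esub> pr e f x"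
  by (rule B_sep) (use assms in \<open>simp_all add: hyp_pair_def pr_def R.cring_simprules\<close>)

lemma pr_zero: "hyp_pair e f \<Longrightarrow> pr e f \<zero>\<^bsub>M\<^esub> = \<zero>\<^bsub>M\<^esub>"
  using pr_smult[of e f "\<zero>\<^bsub>M\<^esub>" \<zero>] pr_perp[of e f "\<zero>\<^bsub>M\<^esub>"] by (simp add: perp_def)

text \<open>As \<open>w\<close> is orthogonal to \<open>e\<close>, it differs from its projection by
  a multiple of \<open>e\<close>, which \<open>T e\<close> does not see.\<close>

lemma T_pr:
  assumes ef: "hyp_pair e f" and w: "w \<in> carrier M" "B e w = \<zero>"
  shows "T e w = T e (pr e f w)"
proof -
  have p: "pr e f w \<in> perp e f" by (rule pr_perp) fact+
  have "w = pr e f w \<oplus>\<^bsub>M\<^esub> B f w \<odot>\<^bsub>M\<^esub> e"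
    by (rule B_sep) (use assms in \<open>simp_all add: hyp_pair_def pr_def R.cring_simprules\<close>)
  then have "T e w = T e (pr e f w \<oplus>\<^bsub>M\<^esub> B f w \<odot>\<^bsub>M\<^esub> e)" by simp
  also have "\<dots> = T e (pr e f w) \<otimes>\<^bsub>G\<^esub> T e (B f w \<odot>\<^bsub>M\<^esub> e)"
    using ef w p by (intro T_mult) (auto simp: perp_def hyp_pair_def)
  also have "\<dots> = T e (pr e f w)"
    using ef w p group.is_monoid[OF group_G] by (simp add: T_self_one hyp_pair_def perp_def T_in_G monoid.r_one)
  finally show ?thesis .
qed

text \<open>The last conjunct says that \<open>N\<close> is the smallest candidate for \<open>IM\<close>; it is used as an induction rule.\<close>

definition ideal_gen where
  "ideal_gen I N \<longleftrightarrow> I \<subseteq> carrier R \<and> (\<forall>\<alpha>\<in>I. \<forall>r\<in>carrier R. r \<otimes> \<alpha> \<in> I) \<and> (\<forall>\<alpha>\<in>I. \<forall>x\<in>carrier M. \<alpha> \<odot>\<^bsub>M\<^esub> x \<in> N) \<and>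
     (\<forall>X. \<zero>\<^bsub>M\<^esub> \<in> X \<longrightarrow> (\<forall>\<alpha>\<in>I. \<forall>x\<in>carrier M. \<alpha> \<odot>\<^bsub>M\<^esub> x \<in> X) \<longrightarrow> (\<forall>x\<in>X. \<forall>y\<in>X. x \<oplus>\<^bsub>M\<^esub> y \<in> X) \<longrightarrow> N \<subseteq> X)"

lemma ideal_gen_induct [consumes 2, case_names zero smult add]:
  assumes "ideal_gen I N" "x \<in> N" "P \<zero>\<^bsub>M\<^esub>"
    "\<And>\<alpha> x. \<alpha> \<in> I \<Longrightarrow> x \<in> carrier M \<Longrightarrow> P (\<alpha> \<odot>\<^bsub>M\<^esub> x)" "\<And>x y. P x \<Longrightarrow> P y \<Longrightarrow> P (x \<oplus>\<^bsub>M\<^esub> y)"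
  shows "P x"
proof -
  have "\<zero>\<^bsub>M\<^esub> \<in> Collect P \<longrightarrow> (\<forall>\<alpha>\<in>I. \<forall>x\<in>carrier M. \<alpha> \<odot>\<^bsub>M\<^esub> x \<in> Collect P) \<longrightarrow>
      (\<forall>x\<in>Collect P. \<forall>y\<in>Collect P. x \<oplus>\<^bsub>M\<^esub> y \<in> Collect P) \<longrightarrow> N \<subseteq> Collect P"
    using assms(1) unfolding ideal_gen_def by (elim conjE) (rule spec)
  with assms show ?thesis by auto
qed

lemma ideal_genD:
  assumes "ideal_gen I N" "\<alpha> \<in> I"
  shows "\<alpha> \<in> carrier R" "r \<in> carrier R \<Longrightarrow> r \<otimes> \<alpha> \<in> I" "x \<in> carrier M \<Longrightarrow> \<alpha> \<odot>\<^bsub>M\<^esub> x \<in> N"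
  using assms unfolding ideal_gen_def by auto

text \<open>The elementary generators supply only isotropic parameters in \<open>perp e f\<close>;
  here they are extended to everything orthogonal to \<open>e\<close>. The relative half goes by
  induction over \<open>N\<close>, because \<open>T_perp_in\<close> treats a single product of some
  \<alpha> in \<open>I\<close> with a vector.\<close>

lemma has_transvections_hyp_pair:
  assumes KH: "rel_triple K H N" and I: "ideal_gen I N" and ef: "hyp_pair e f"
    and tp: "\<And>\<mm>. maximalideal \<mm> R \<Longrightarrow> two_planes e f \<mm>"
    and K: "\<And>y. \<lbrakk>y \<in> perp e f; B y y = \<zero>\<rbrakk> \<Longrightarrow> T e y \<in> K"
    and H: "\<And>y. \<lbrakk>y \<in> perp e f; y \<in> N; B y y = \<zero>\<rbrakk> \<Longrightarrow> T e y \<in> H"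
  shows "has_transvections K H N e"
proof -
  have sg: "subgroup K G" "subgroup H G" and NN: "N \<subseteq> carrier M"
    using KH submoduleE(1) by (auto simp: rel_triple_def)
  have e: "e \<in> carrier M" "f \<in> carrier M" "B e e = \<zero>"
    using ef by (auto simp: hyp_pair_def)
  have iK: "T e p \<in> K" if "p \<in> perp e f" for p
  proof -
    have "T e (\<one> \<odot>\<^bsub>M\<^esub> p) \<in> K"
      by (rule T_perp_in[OF sg(1) e tp]) (use that K e in \<open>auto simp: perp_closed perp_def\<close>)
    then show ?thesis using that by (simp add: perp_def)
  qed
  have iH: "T e (\<alpha> \<odot>\<^bsub>M\<^esub> p) \<in> H" if "p \<in> perp e f" "\<alpha> \<in> I" for p \<alpha>
  proof (rule T_perp_in[OF sg(2) e tp])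
    fix y r assume y: "y \<in> perp e f" "B y y = \<zero>" "r \<in> carrier R"
    moreover have "r \<otimes> \<alpha> \<in> I" "(r \<otimes> \<alpha>) \<odot>\<^bsub>M\<^esub> y \<in> N" "r \<otimes> \<alpha> \<in> carrier R"
      using ideal_genD[OF I] ideal_genD(3)[OF I ideal_genD(2)[OF I]] that y by (auto simp: perp_def)
    ultimately show "T e ((r \<otimes> \<alpha>) \<odot>\<^bsub>M\<^esub> y) \<in> H"
      using e by (intro H perp_closed) (auto simp: perp_def)
  qed (use that ideal_genD[OF I] in auto)
  have "T e (pr e f x) \<in> H \<and> x \<in> carrier M" if "x \<in> N" for x
    using I that
  proof (induction rule: ideal_gen_induct)
    case zero
    then show ?case using ef e sg by (simp add: pr_zero T_zero_in)
  next
    case (smult \<alpha> x)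
    then show ?case
      using ideal_genD(1)[OF I smult(1)] ef iH[OF pr_perp[OF ef]] by (simp add: pr_smult)
  next
    case (add x y)
    then show ?case
      using ef e sg pr_perp[OF ef, of x] pr_perp[OF ef, of y]
      by (auto simp: pr_add perp_def intro!: T_add_in)
  qed
  then show ?thesis
    using e ef iK pr_perp T_pr NN unfolding has_transvections_def by auto
qed

end

section \<open>Generation of transvections at a maximal ideal\<close>

context orth_space begin

text \<open>\<open>T_in_H_plane\<close> with pairing 1, used twice: for the triple of
  \<open>K\<close>, \<open>K\<close> and the whole module, which is the absolute statement, and for
  the given triple.\<close>

lemma has_transvections_perp:
  assumes KH: "rel_triple K H N" and ef: "hyp_pair e f"
    and e: "has_transvections K H N e" and f: "has_transvections K H N f"
    and y: "y \<in> perp e f" "B y y = \<zero>"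
  shows "has_transvections K H N y"
proof -
  have c: "e \<in> carrier M" "f \<in> carrier M" "B e f = \<one>" "y \<in> carrier M" "B e y = \<zero>" "B f y = \<zero>"
    using ef y by (auto simp: hyp_pair_def perp_def)
  have N: "N \<subseteq> carrier M" and sg: "subgroup K G"
    using KH submoduleE(1) by (auto simp: rel_triple_def)
  have KK: "rel_triple K K (carrier M)"
    using sg carrier_is_submodule by (auto simp: rel_triple_def subgroup.m_closed subgroup.m_inv_closed)
  have "has_transvections K K (carrier M) e" "has_transvections K K (carrier M) f"
    using e f by (auto simp: has_transvections_def)
  then have "T y w \<in> K" if "w \<in> carrier M" "B y w = \<zero>" for w
    using T_in_H_plane[OF KK _ _ c(4) y(2) c(5,6) that] c that by simp
  moreover have "T y w \<in> H" if "w \<in> N" "B y w = \<zero>" for w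
    using T_in_H_plane[OF KH e f c(4) y(2) c(5,6) _ that(2)] c that N by auto
  ultimately show ?thesis
    using c y by (simp add: has_transvections_def)
qed

lemma smult_notin_prime:
  assumes "maximalideal \<mm> R" "s \<in> carrier R - \<mm>" "t \<in> carrier R - \<mm>"
  shows "s \<otimes> t \<in> carrier R - \<mm>"
  using maximal_mult[OF assms(1)] assms by auto

text \<open>The Koszul relation between \<open>f\<close> and \<open>y\<close> for the functional
  \<open>B u\<close>. Once \<open>B u f\<close> is inverted, these vectors exhaust the orthogonal
  complement of \<open>u\<close>, for on that complement the map is multiplication by
  \<open>B u f\<close>.\<close>

definition koszul where "koszul u f y = B u f \<odot>\<^bsub>M\<^esub> y \<ominus>\<^bsub>M\<^esub> B u y \<odot>\<^bsub>M\<^esub> f"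

lemma koszul_closed [simp]:
  "\<lbrakk>u \<in> carrier M; f \<in> carrier M; y \<in> carrier M\<rbrakk> \<Longrightarrow> koszul u f y \<in> carrier M"
  by (simp add: koszul_def)

lemma koszul_orth: "\<lbrakk>u \<in> carrier M; f \<in> carrier M; y \<in> carrier M\<rbrakk> \<Longrightarrow> B u (koszul u f y) = \<zero>"
  by (simp add: koszul_def bil)

lemma koszul_add:
  assumes "u \<in> carrier M" "f \<in> carrier M" "x \<in> carrier M" "y \<in> carrier M"
  shows "koszul u f (x \<oplus>\<^bsub>M\<^esub> y) = koszul u f x \<oplus>\<^bsub>M\<^esub> koszul u f y"
  by (rule B_sep) (use assms in \<open>simp_all add: koszul_def bil\<close>)

lemma koszul_smult:
  assumes "u \<in> carrier M" "f \<in> carrier M" "y \<in> carrier M" "r \<in> carrier R"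
  shows "koszul u f (r \<odot>\<^bsub>M\<^esub> y) = r \<odot>\<^bsub>M\<^esub> koszul u f y"
  by (rule B_sep) (use assms in \<open>simp_all add: koszul_def bil\<close>)

text \<open>If \<open>y\<close> has a spare plane in \<open>perp e f\<close>, then
  \<open>koszul u f y\<close> is isotropic and orthogonal to that plane, since \<open>f\<close> is
  isotropic and orthogonal to \<open>y\<close> and to the plane. It can therefore be the axis in
  \<open>T_in_H_plane\<close> with \<open>u\<close> as parameter, and a swap restores
  \<open>u\<close> as the axis. The scalar \<open>t\<close> is chosen before \<alpha>: then \<alpha>
  can absorb ring elements, which closes the set of good \<open>y\<close> under scalars and
  sums.\<close>

lemma T_koszul_local:
  assumes KH: "rel_triple K H N" and I: "ideal_gen I N" and ef: "hyp_pair e f"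
    and Y: "\<And>y. \<lbrakk>y \<in> perp e f; B y y = \<zero>\<rbrakk> \<Longrightarrow> has_transvections K H N y"
    and m: "maximalideal \<mm> R" and tp: "two_planes e f \<mm>"
    and u: "u \<in> carrier M" "B u u = \<zero>"
    and p: "p \<in> perp e f"
  shows "\<exists>t\<in>carrier R - \<mm>. \<forall>\<alpha>\<in>I. T u ((t \<otimes> \<alpha>) \<odot>\<^bsub>M\<^esub> koszul u f p) \<in> H"
proof -
  have c: "e \<in> carrier M" "f \<in> carrier M" "B e f = \<one>" "B f f = \<zero>"
    using ef by (auto simp: hyp_pair_def)
  have H: "subgroup H G" using KH by (auto simp: rel_triple_def)
  define k where "k = koszul u f"
  have k_closed [simp]: "k y \<in> carrier M" and k_orth: "B u (k y) = \<zero>" if "y \<in> carrier M" for y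
    using that c u by (simp_all add: k_def koszul_orth)
  have k_add: "k (x \<oplus>\<^bsub>M\<^esub> y) = k x \<oplus>\<^bsub>M\<^esub> k y" if "x \<in> carrier M" "y \<in> carrier M" for x y
    using that c u by (simp add: k_def koszul_add)
  have k_smult: "k (r \<odot>\<^bsub>M\<^esub> y) = r \<odot>\<^bsub>M\<^esub> k y" if "r \<in> carrier R" "y \<in> carrier M" for r y
    using that c u by (simp add: k_def koszul_smult)
  have P: "x \<in> carrier M" if "x \<in> perp e f" for x using that by (simp add: perp_def)
  let ?D = "{y \<in> perp e f. \<exists>t\<in>carrier R - \<mm>. \<forall>\<alpha>\<in>I. T u ((t \<otimes> \<alpha>) \<odot>\<^bsub>M\<^esub> k y) \<in> H}"
  have "\<exists>t\<in>carrier R - \<mm>. t \<odot>\<^bsub>M\<^esub> p \<in> ?D"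
  proof (rule plane_orth_spans[OF c(1,2) m tp _ _ _ _ p])
    show "?D \<subseteq> carrier M" using P by auto
    show "plane_orth e f \<mm> \<subseteq> ?D"
    proof
      fix y assume "y \<in> plane_orth e f \<mm>"
      then obtain e1 f1 where y: "y \<in> perp e f" "B y y = \<zero>"
        and ef1: "e1 \<in> perp e f" "f1 \<in> perp e f" "B e1 e1 = \<zero>" "B f1 f1 = \<zero>"
          "B e1 y = \<zero>" "B f1 y = \<zero>" "B e1 f1 \<notin> \<mm>"
        unfolding plane_orth_def by auto
      have cc: "y \<in> carrier M" "e1 \<in> carrier M" "f1 \<in> carrier M" using y ef1 by (simp_all add: P)
      define s where "s = B e1 f1 \<otimes> B e1 f1"
      have s: "s \<in> carrier R - \<mm>"
        unfolding s_def using cc ef1 by (intro smult_notin_prime[OF m]) auto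
      have sym: "B y f = \<zero>" "B f y = \<zero>" "B e1 f = \<zero>" "B f1 f = \<zero>"
        using y ef1 B_sym[OF cc(1) c(2)] B_sym[OF cc(2) c(2)] B_sym[OF cc(3) c(2)] by (simp_all add: perp_def)
      have kk: "B (k y) (k y) = \<zero>" "B e1 (k y) = \<zero>" "B f1 (k y) = \<zero>" "B (k y) u = \<zero>"
        using cc c u y ef1 sym k_orth[OF cc(1)] B_sym[OF k_closed[OF cc(1)] u(1)] by (simp_all add: k_def koszul_def a_minus_def)
      have "T u ((s \<otimes> \<alpha>) \<odot>\<^bsub>M\<^esub> k y) \<in> H" if \<alpha>: "\<alpha> \<in> I" for \<alpha>
      proof -
        have ac: "\<alpha> \<in> carrier R" "(\<ominus> \<alpha>) \<odot>\<^bsub>M\<^esub> k y \<in> N"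
          using ideal_genD(1)[OF I \<alpha>] ideal_genD(3)[OF I ideal_genD(2)[OF I \<alpha>, of "\<ominus> \<one>"], of "k y"] cc
          by (simp_all add: l_minus)
        \<comment> \<open>The factor \<alpha> puts the axis into \<open>N\<close>, and its sign
          cancels the one produced by \<open>T_swap\<close>.\<close>
        have "T ((\<ominus> \<alpha>) \<odot>\<^bsub>M\<^esub> k y) (s \<odot>\<^bsub>M\<^esub> u) \<in> H"
          unfolding s_def
          by (rule T_in_H_plane[OF KH Y[OF ef1(1,3)] Y[OF ef1(2,4)]]) (use cc ac u kk in auto)
        moreover have "T ((\<ominus> \<alpha>) \<odot>\<^bsub>M\<^esub> k y) (s \<odot>\<^bsub>M\<^esub> u) = T u ((\<ominus> s) \<odot>\<^bsub>M\<^esub> ((\<ominus> \<alpha>) \<odot>\<^bsub>M\<^esub> k y))"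
          using cc ac u kk s by (intro T_swap) auto
        moreover have "(\<ominus> s) \<odot>\<^bsub>M\<^esub> ((\<ominus> \<alpha>) \<odot>\<^bsub>M\<^esub> k y) = (s \<otimes> \<alpha>) \<odot>\<^bsub>M\<^esub> k y"
          using cc ac s by (simp add: smult_assoc1[symmetric] R.l_minus R.r_minus)
        ultimately show ?thesis by simp
      qed
      with s y show "y \<in> ?D" by auto
    qed
    fix x assume x: "x \<in> ?D"
    then obtain t where t: "t \<in> carrier R - \<mm>" "\<And>\<alpha>. \<alpha> \<in> I \<Longrightarrow> T u ((t \<otimes> \<alpha>) \<odot>\<^bsub>M\<^esub> k x) \<in> H" by auto
    have xc: "x \<in> perp e f" "x \<in> carrier M" using x P by auto
    show "r \<odot>\<^bsub>M\<^esub> x \<in> ?D" if r: "r \<in> carrier R" for r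
    proof -
      have "T u ((t \<otimes> \<alpha>) \<odot>\<^bsub>M\<^esub> k (r \<odot>\<^bsub>M\<^esub> x)) \<in> H" if \<alpha>: "\<alpha> \<in> I" for \<alpha>
      proof -
        have "(t \<otimes> \<alpha>) \<odot>\<^bsub>M\<^esub> k (r \<odot>\<^bsub>M\<^esub> x) = (t \<otimes> (r \<otimes> \<alpha>)) \<odot>\<^bsub>M\<^esub> k x"
          using r t(1) ideal_genD(1)[OF I \<alpha>] xc by (simp add: k_smult smult_assoc1[symmetric] R.m_ac)
        then show ?thesis using t(2) ideal_genD(2)[OF I \<alpha> r] by simp
      qed
      then show ?thesis using t(1) xc r c by (auto simp: perp_closed)
    qed
    fix x' assume x': "x' \<in> ?D"
    then obtain t' where t': "t' \<in> carrier R - \<mm>" "\<And>\<alpha>. \<alpha> \<in> I \<Longrightarrow> T u ((t' \<otimes> \<alpha>) \<odot>\<^bsub>M\<^esub> k x') \<in> H" by auto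
    have xc': "x' \<in> perp e f" "x' \<in> carrier M" using x' P by auto
    have "T u ((t \<otimes> t' \<otimes> \<alpha>) \<odot>\<^bsub>M\<^esub> k (x \<oplus>\<^bsub>M\<^esub> x')) \<in> H" if \<alpha>: "\<alpha> \<in> I" for \<alpha>
    proof -
      have ac: "\<alpha> \<in> carrier R" using ideal_genD(1)[OF I \<alpha>] .
      have eq: "(t \<otimes> t' \<otimes> \<alpha>) \<odot>\<^bsub>M\<^esub> k (x \<oplus>\<^bsub>M\<^esub> x') = (t \<otimes> (t' \<otimes> \<alpha>)) \<odot>\<^bsub>M\<^esub> k x \<oplus>\<^bsub>M\<^esub> (t' \<otimes> (t \<otimes> \<alpha>)) \<odot>\<^bsub>M\<^esub> k x'"
        using ac t(1) t'(1) xc xc' by (simp add: k_add smult_r_distr R.m_ac)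
      have "T u ((t \<otimes> (t' \<otimes> \<alpha>)) \<odot>\<^bsub>M\<^esub> k x) \<in> H" "T u ((t' \<otimes> (t \<otimes> \<alpha>)) \<odot>\<^bsub>M\<^esub> k x') \<in> H"
        using t t' ideal_genD(2)[OF I \<alpha>] by auto
      then show ?thesis unfolding eq
        using ac t(1) t'(1) xc xc' u H k_orth by (intro T_add_in) auto
    qed
    then show "x \<oplus>\<^bsub>M\<^esub> x' \<in> ?D"
      using smult_notin_prime[OF m t(1) t'(1)] xc xc' c by (auto simp: perp_closed)
  qed
  then obtain t t' where t: "t \<in> carrier R - \<mm>" "t' \<in> carrier R - \<mm>"
    "\<And>\<alpha>. \<alpha> \<in> I \<Longrightarrow> T u ((t' \<otimes> \<alpha>) \<odot>\<^bsub>M\<^esub> k (t \<odot>\<^bsub>M\<^esub> p)) \<in> H" by auto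
  have "(t' \<otimes> t \<otimes> \<alpha>) \<odot>\<^bsub>M\<^esub> k p = (t' \<otimes> \<alpha>) \<odot>\<^bsub>M\<^esub> k (t \<odot>\<^bsub>M\<^esub> p)" if "\<alpha> \<in> I" for \<alpha>
    using t(1,2) ideal_genD(1)[OF I that] P[OF p] by (simp add: k_smult smult_assoc1[symmetric] R.m_ac)
  then show ?thesis
    using t(3) smult_notin_prime[OF m t(2,1)] unfolding k_def[symmetric] by (intro bexI[of _ "t' \<otimes> t"]) auto
qed

text \<open>Where \<open>B u f\<close> is a unit, every parameter orthogonal to \<open>u\<close> is
  a Koszul vector modulo \<open>u\<close>. The final scalar collects \<open>t\<close> and two
  factors \<open>a\<close> from clearing denominators.\<close>

lemma T_local:
  assumes KH: "rel_triple K H N" and I: "ideal_gen I N" and ef: "hyp_pair e f"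
    and Y: "\<And>y. \<lbrakk>y \<in> perp e f; B y y = \<zero>\<rbrakk> \<Longrightarrow> has_transvections K H N y"
    and m: "maximalideal \<mm> R" and tp: "two_planes e f \<mm>"
    and u: "u \<in> carrier M" "B u u = \<zero>" "B u f \<notin> \<mm>"
    and v: "v \<in> N" "B u v = \<zero>"
  shows "\<exists>s\<in>carrier R - \<mm>. \<forall>r\<in>carrier R. T u ((s \<otimes> r) \<odot>\<^bsub>M\<^esub> v) \<in> H"
proof -
  have c: "e \<in> carrier M" "f \<in> carrier M" "B e f = \<one>" "B f f = \<zero>"
    using ef by (auto simp: hyp_pair_def)
  have H: "subgroup H G" and NN: "submodule N R M"
    and Nz: "\<And>x y z. x \<in> N \<Longrightarrow> y \<in> carrier M \<Longrightarrow> z \<in> carrier M \<Longrightarrow> B x y \<odot>\<^bsub>M\<^esub> z \<in> N"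
    using KH by (auto simp: rel_triple_def)
  have vc: "v \<in> carrier M" using v submoduleE(1)[OF NN] by auto
  define a where "a = B u f"
  have ac: "a \<in> carrier R" "a \<notin> \<mm>" using u c by (auto simp: a_def)
  define k where "k = koszul u f"
  have k_closed [simp]: "k y \<in> carrier M" and k_orth: "B u (k y) = \<zero>" if "y \<in> carrier M" for y
    using that c u by (simp_all add: k_def koszul_orth)
  have k_add: "k (x \<oplus>\<^bsub>M\<^esub> y) = k x \<oplus>\<^bsub>M\<^esub> k y" if "x \<in> carrier M" "y \<in> carrier M" for x y
    using that c u by (simp add: k_def koszul_add)
  have k_smult: "k (r \<odot>\<^bsub>M\<^esub> y) = r \<odot>\<^bsub>M\<^esub> k y" if "r \<in> carrier R" "y \<in> carrier M" for r y
    using that c u by (simp add: k_def koszul_smult)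
  have prc: "pr e f x \<in> carrier M" if "x \<in> carrier M" for x
    using pr_perp[OF ef that] by (simp add: perp_def)
  \<comment> \<open>Carried along the sums that make up \<open>N\<close>: each summand reduces to
    \<open>T_koszul_local\<close>, and the scalars \<open>t\<close> of two summands are
    multiplied.\<close>
  have N_local: "x \<in> carrier M \<and> (\<exists>t\<in>carrier R - \<mm>. \<forall>r\<in>carrier R. T u ((t \<otimes> r) \<odot>\<^bsub>M\<^esub> k (pr e f x)) \<in> H)" if "x \<in> N" for x
    using I that
  proof (induction rule: ideal_gen_induct)
    case zero
    have "k \<zero>\<^bsub>M\<^esub> = \<zero>\<^bsub>M\<^esub>" using k_smult[of \<zero> "\<zero>\<^bsub>M\<^esub>"] by simp
    moreover have "\<one> \<in> carrier R - \<mm>"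
      using ideal.one_imp_carrier[of \<mm> R] m maximalideal.I_notcarr[OF m] maximalideal.axioms(1)[OF m] by auto
    ultimately show ?case using ef H u by (auto simp: pr_zero T_zero_in)
  next
    case (smult \<alpha> x)
    obtain t where t: "t \<in> carrier R - \<mm>" "\<And>\<alpha>. \<alpha> \<in> I \<Longrightarrow> T u ((t \<otimes> \<alpha>) \<odot>\<^bsub>M\<^esub> k (pr e f x)) \<in> H"
      using T_koszul_local[OF KH I ef Y m tp u(1,2) pr_perp[OF ef smult(2)]] unfolding k_def by auto
    have al: "\<alpha> \<in> carrier R" using ideal_genD(1)[OF I smult(1)] .
    have "T u ((t \<otimes> r) \<odot>\<^bsub>M\<^esub> k (pr e f (\<alpha> \<odot>\<^bsub>M\<^esub> x))) \<in> H" if "r \<in> carrier R" for r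
    proof -
      have "(t \<otimes> r) \<odot>\<^bsub>M\<^esub> k (pr e f (\<alpha> \<odot>\<^bsub>M\<^esub> x)) = (t \<otimes> (r \<otimes> \<alpha>)) \<odot>\<^bsub>M\<^esub> k (pr e f x)"
        using that al t(1) smult(2) prc ef by (simp add: pr_smult k_smult smult_assoc1[symmetric] R.m_ac)
      then show ?thesis using t(2) ideal_genD(2)[OF I smult(1) that] by simp
    qed
    then show ?case using t(1) al smult(2) by auto
  next
    case (add x y)
    then obtain t t' where t: "t \<in> carrier R - \<mm>" "t' \<in> carrier R - \<mm>"
      "\<And>r. r \<in> carrier R \<Longrightarrow> T u ((t \<otimes> r) \<odot>\<^bsub>M\<^esub> k (pr e f x)) \<in> H"
      "\<And>r. r \<in> carrier R \<Longrightarrow> T u ((t' \<otimes> r) \<odot>\<^bsub>M\<^esub> k (pr e f y)) \<in> H" by auto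
    have "T u ((t \<otimes> t' \<otimes> r) \<odot>\<^bsub>M\<^esub> k (pr e f (x \<oplus>\<^bsub>M\<^esub> y))) \<in> H" if r: "r \<in> carrier R" for r
    proof -
      have eq: "(t \<otimes> t' \<otimes> r) \<odot>\<^bsub>M\<^esub> k (pr e f (x \<oplus>\<^bsub>M\<^esub> y)) =
          (t \<otimes> (t' \<otimes> r)) \<odot>\<^bsub>M\<^esub> k (pr e f x) \<oplus>\<^bsub>M\<^esub> (t' \<otimes> (t \<otimes> r)) \<odot>\<^bsub>M\<^esub> k (pr e f y)"
        using r t(1,2) add ef prc by (simp add: pr_add k_add smult_r_distr R.m_ac)
      show ?thesis unfolding eq
        using r t add u H k_orth prc by (intro T_add_in) auto
    qed
    then show ?case using smult_notin_prime[OF m t(1,2)] add by auto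
  qed
  \<comment> \<open>The multiple of \<open>u\<close> makes \<open>x\<close> orthogonal to
    \<open>f\<close> as well, and \<open>T u\<close> does not see it.\<close>
  define x where "x = a \<odot>\<^bsub>M\<^esub> v \<ominus>\<^bsub>M\<^esub> B v f \<odot>\<^bsub>M\<^esub> u"
  have xc: "x \<in> carrier M" using ac vc u c by (simp add: x_def)
  have "x \<in> N"
    unfolding x_def a_minus_def using ac v u c Nz submoduleE[OF NN] by simp
  then obtain t where t: "t \<in> carrier R - \<mm>" "\<And>r. r \<in> carrier R \<Longrightarrow> T u ((t \<otimes> r) \<odot>\<^bsub>M\<^esub> k (pr e f x)) \<in> H"
    using N_local[of x] by blast
  have sym: "B f u = a" "B f v = B v f" "B f e = \<one>"
    using c u vc B_sym[of f u] B_sym[of f v] B_sym[of f e] by (simp_all add: a_def)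
  have xo: "B f x = \<zero>" "B u x = \<zero>"
    using ac vc u v c sym by (simp_all add: x_def bil)
  \<comment> \<open>The projection of \<open>x\<close> differs from \<open>x\<close> by a multiple
    of \<open>f\<close>, whose Koszul vector vanishes; since \<open>B u x\<close> is zero, what
    remains is \<open>a\<close> times \<open>x\<close>.\<close>
  have kx: "k (pr e f x) = a \<odot>\<^bsub>M\<^esub> x"
    unfolding k_def koszul_def pr_def
    by (rule B_sep) (use c ac u xc xo in \<open>simp_all add: a_def[symmetric] bil\<close>)
  have "T u ((t \<otimes> (a \<otimes> a) \<otimes> r) \<odot>\<^bsub>M\<^esub> v) \<in> H" if r: "r \<in> carrier R" for r
  proof -
    have eq: "(t \<otimes> (a \<otimes> a) \<otimes> r) \<odot>\<^bsub>M\<^esub> v = (t \<otimes> r) \<odot>\<^bsub>M\<^esub> k (pr e f x) \<oplus>\<^bsub>M\<^esub> (t \<otimes> r \<otimes> a \<otimes> B v f) \<odot>\<^bsub>M\<^esub> u"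
      unfolding kx unfolding x_def
      by (rule B_sep) (use c ac u vc r t(1) in \<open>simp_all add: bil\<close>)
    have "T u ((t \<otimes> r \<otimes> a \<otimes> B v f) \<odot>\<^bsub>M\<^esub> u) \<in> H"
      using H c ac u vc r t(1) by (simp add: T_self_one subgroup.one_closed)
    then show ?thesis unfolding eq
      using t(1) t(2)[OF r] H c ac u vc r k_orth prc xc by (intro T_add_in) auto
  qed
  then show ?thesis
    using smult_notin_prime[OF m t(1) smult_notin_prime[OF m, of a a]] ac by blast
qed

lemma T_in_H:
  assumes KH: "rel_triple K H N" and I: "ideal_gen I N" and ef: "hyp_pair e f"
    and e: "has_transvections K H N e" and f: "has_transvections K H N f"
    and tp: "\<And>\<mm>. maximalideal \<mm> R \<Longrightarrow> two_planes e f \<mm>"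
    and u: "u \<in> carrier M" "B u u = \<zero>" "w \<in> carrier M" "B u w = \<one>"
    and v: "v \<in> N" "B u v = \<zero>"
  shows "T u v \<in> H"
proof -
  have c: "e \<in> carrier M" "f \<in> carrier M" "B e f = \<one>" "B e e = \<zero>" "B f f = \<zero>"
    using ef by (auto simp: hyp_pair_def)
  have K: "subgroup K G" and H: "subgroup H G" and NN: "submodule N R M"
    and nrm: "\<And>k x. k \<in> K \<Longrightarrow> x \<in> H \<Longrightarrow> k \<otimes>\<^bsub>G\<^esub> x \<otimes>\<^bsub>G\<^esub> inv\<^bsub>G\<^esub> k \<in> H"
    and Nz: "\<And>x y z. x \<in> N \<Longrightarrow> y \<in> carrier M \<Longrightarrow> z \<in> carrier M \<Longrightarrow> B x y \<odot>\<^bsub>M\<^esub> z \<in> N"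
    using KH by (auto simp: rel_triple_def)
  have vc: "v \<in> carrier M" using v submoduleE(1)[OF NN] by auto
  interpret G: group G by (rule group_G)
  note Y = has_transvections_perp[OF KH ef e f]
  have two_planes_commute: "two_planes f e \<mm>" if "two_planes e f \<mm>" for \<mm>
    using that by (simp add: two_planes_def perp_commute)
  note local1 = T_local[OF KH I ef Y]
  note local2 = T_local[OF KH I hyp_pair_commute[OF ef] Y[unfolded perp_commute[of e f]]]
  show ?thesis
  proof (rule T_local_global[OF H u(1,2) vc v(2)])
    fix \<mm> assume m: "maximalideal \<mm> R"
    interpret m: maximalideal \<mm> R by fact
    consider "B u f \<notin> \<mm>" | "B u e \<notin> \<mm>" | "B u f \<in> \<mm>" "B u e \<in> \<mm>" by blast
    then show "\<exists>s\<in>carrier R - \<mm>. \<forall>r\<in>carrier R. T u ((s \<otimes> r) \<odot>\<^bsub>M\<^esub> v) \<in> H"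
    proof cases
      case 1
      then show ?thesis using local1[OF _ _ m tp[OF m] u(1,2) _ v] by auto
    next
      case 2
      then show ?thesis using local2[OF _ _ m two_planes_commute[OF tp[OF m]] u(1,2) _ v] by auto
    next
      case 3
      \<comment> \<open>Since \<open>B u w\<close> is 1 and \<open>u\<close> pairs into \<mm> with
        both \<open>e\<close> and \<open>f\<close>, the rest \<open>y\<close> of \<open>w\<close>
        must pair with \<open>u\<close> outside \<mm>. The map \<open>T f y\<close> adds this
        pairing, modulo \<mm>, to that of \<open>u\<close> with \<open>e\<close>, so that the pair
        in the order \<open>f\<close>, \<open>e\<close> can be used.\<close>
      define y where "y = pr e f w"
      have y: "y \<in> carrier M" "B e y = \<zero>" "B f y = \<zero>" "B y e = \<zero>"
        using pr_perp[OF ef u(3)] B_sym[of "pr e f w" e] c by (auto simp: y_def perp_def)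
      have yu: "B y u \<notin> \<mm>"
      proof
        assume "B y u \<in> \<mm>"
        moreover have "\<one> = B y u \<oplus> (B f w \<otimes> B u e \<oplus> B e w \<otimes> B u f)"
          using u c B_sym[of w u] B_sym[of f u] B_sym[of e u] by (simp add: y_def pr_def bil)
        ultimately have "\<one> \<in> \<mm>"
          using 3 u c by (simp add: m.I_l_closed)
        then show False using m.one_imp_carrier m.I_notcarr by auto
      qed
      define g where "g = T f y"
      have gI: "g \<in> Iso" and gK: "g \<in> K"
        using f y c by (auto simp: g_def has_transvections_def intro: T_Iso)
      note gG = Iso_G[OF gI]
      have sym: "B f e = \<one>" "B f u = B u f" "B e u = B u e" using c u B_sym[of f e] B_sym[of f u] B_sym[of e u] by auto
      have "B (g u) e = B u e \<oplus> (B y u \<ominus> q y \<otimes> B u f)"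
        using u c y sym by (simp add: g_def T_apply a_minus_def)
      then have "B y u = B (g u) e \<oplus> (\<ominus> B u e \<oplus> q y \<otimes> B u f)"
        using u c y by (simp add: bil)
      then have ge: "B (g u) e \<notin> \<mm>"
        using 3 yu c u y by (auto simp: m.I_l_closed)
      have gv: "g v \<in> N"
      proof -
        have a: "(B v f) \<odot>\<^bsub>M\<^esub> y \<in> N" "(B v y) \<odot>\<^bsub>M\<^esub> f \<in> N" "q y \<odot>\<^bsub>M\<^esub> (B v f \<odot>\<^bsub>M\<^esub> f) \<in> N"
          using v y c Nz submoduleE[OF NN] by auto
        have "g v = v \<oplus>\<^bsub>M\<^esub> (\<ominus>\<^bsub>M\<^esub> (B v f \<odot>\<^bsub>M\<^esub> y) \<oplus>\<^bsub>M\<^esub> (B v y \<odot>\<^bsub>M\<^esub> f \<oplus>\<^bsub>M\<^esub> \<ominus>\<^bsub>M\<^esub> (q y \<odot>\<^bsub>M\<^esub> (B v f \<odot>\<^bsub>M\<^esub> f))))"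
          unfolding g_def
          by (rule B_sep) (use vc y c B_sym[of f v] B_sym[of y v] in \<open>simp_all add: T_apply bil\<close>)
        then show ?thesis using a v submoduleE[OF NN] by simp
      qed
      have gu: "g u \<in> carrier M" "B (g u) (g u) = \<zero>" "B (g u) (g v) = \<zero>"
        using gI u v vc by (simp_all add: IsoD)
      obtain s where s: "s \<in> carrier R - \<mm>" "\<And>r. r \<in> carrier R \<Longrightarrow> T (g u) ((s \<otimes> r) \<odot>\<^bsub>M\<^esub> g v) \<in> H"
        using local2[OF _ _ m two_planes_commute[OF tp[OF m]] gu(1,2) ge gv gu(3)] by auto
      have "T u ((s \<otimes> r) \<odot>\<^bsub>M\<^esub> v) \<in> H" if r: "r \<in> carrier R" for r
      proof -
        let ?t = "T u ((s \<otimes> r) \<odot>\<^bsub>M\<^esub> v)"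
        have tG: "?t \<in> carrier G" using u v vc s r by (intro T_in_G) auto
        have "T (g u) ((s \<otimes> r) \<odot>\<^bsub>M\<^esub> g v) = T (g u) (g ((s \<otimes> r) \<odot>\<^bsub>M\<^esub> v))"
          using gI vc s r by (simp add: Iso_smult)
        also have "\<dots> = g \<otimes>\<^bsub>G\<^esub> ?t \<otimes>\<^bsub>G\<^esub> inv\<^bsub>G\<^esub> g"
          using gI u v vc s r by (intro T_conj) auto
        finally have "g \<otimes>\<^bsub>G\<^esub> ?t \<otimes>\<^bsub>G\<^esub> inv\<^bsub>G\<^esub> g \<in> H" using s(2)[OF r] by simp
        then have "inv\<^bsub>G\<^esub> g \<otimes>\<^bsub>G\<^esub> (g \<otimes>\<^bsub>G\<^esub> ?t \<otimes>\<^bsub>G\<^esub> inv\<^bsub>G\<^esub> g) \<otimes>\<^bsub>G\<^esub> inv\<^bsub>G\<^esub> (inv\<^bsub>G\<^esub> g) \<in> H"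
          using nrm subgroup.m_inv_closed[OF K gK] by blast
        then show ?thesis using gG tG by (simp add: G.m_assoc G.m_assoc[symmetric, of "inv\<^bsub>G\<^esub> g" g])
      qed
      then show ?thesis using s(1) by auto
    qed
  qed
qed

end

section \<open>Torsion at a maximal ideal and Nakayama elimination\<close>

locale orth_local = orth_space +
  fixes \<mm>
  assumes max: "maximalideal \<mm> R"
begin

sublocale m: maximalideal \<mm> R by (rule max)

definition S where "S = carrier R - \<mm>"

lemma S_closed [simp]: "s \<in> S \<Longrightarrow> s \<in> carrier R" by (simp add: S_def)

lemma S_mult [simp, intro]: "\<lbrakk>s \<in> S; t \<in> S\<rbrakk> \<Longrightarrow> s \<otimes> t \<in> S"
  using smult_notin_prime[OF max] by (simp add: S_def)

lemma S_one [simp]: "\<one> \<in> S"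
  using m.one_imp_carrier m.I_notcarr by (auto simp: S_def)

lemma m_prime: "\<lbrakk>s \<in> S; a \<in> carrier R; s \<otimes> a \<in> \<mm>\<rbrakk> \<Longrightarrow> a \<in> \<mm>"
  using smult_notin_prime[OF max, of s a] by (auto simp: S_def)

text \<open>\<open>nul\<close> and \<open>nulR\<close>: the image in the localization at \<open>\<mm>\<close> vanishes.\<close>

definition nul where "nul x \<longleftrightarrow> x \<in> carrier M \<and> (\<exists>t\<in>S. t \<odot>\<^bsub>M\<^esub> x = \<zero>\<^bsub>M\<^esub>)"
definition nulR where "nulR a \<longleftrightarrow> a \<in> carrier R \<and> (\<exists>t\<in>S. t \<otimes> a = \<zero>)"

lemma nulI: "t \<in> S \<Longrightarrow> x \<in> carrier M \<Longrightarrow> t \<odot>\<^bsub>M\<^esub> x = \<zero>\<^bsub>M\<^esub> \<Longrightarrow> nul x"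
  and nulRI: "t \<in> S \<Longrightarrow> a \<in> carrier R \<Longrightarrow> t \<otimes> a = \<zero> \<Longrightarrow> nulR a"
  by (auto simp: nul_def nulR_def)

lemma nul_carrier: "nul x \<Longrightarrow> x \<in> carrier M" by (simp add: nul_def)

lemma nul_zero: "nul \<zero>\<^bsub>M\<^esub>" by (rule nulI[OF S_one]) auto

lemma nulR_m: "nulR a \<Longrightarrow> a \<in> \<mm>"
  unfolding nulR_def using m_prime m.zero_closed by auto

lemma nul_add:
  assumes "nul x" "nul y" shows "nul (x \<oplus>\<^bsub>M\<^esub> y)"
proof -
  obtain s t where st: "s \<in> S" "t \<in> S" "x \<in> carrier M" "y \<in> carrier M"
      "s \<odot>\<^bsub>M\<^esub> x = \<zero>\<^bsub>M\<^esub>" "t \<odot>\<^bsub>M\<^esub> y = \<zero>\<^bsub>M\<^esub>"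
    using assms unfolding nul_def by auto
  have "(s \<otimes> t) \<odot>\<^bsub>M\<^esub> x = t \<odot>\<^bsub>M\<^esub> (s \<odot>\<^bsub>M\<^esub> x)" "(s \<otimes> t) \<odot>\<^bsub>M\<^esub> y = s \<odot>\<^bsub>M\<^esub> (t \<odot>\<^bsub>M\<^esub> y)"
    using st(1-4) by (simp_all add: smult_assoc1[symmetric] R.m_comm)
  then show ?thesis
    using st by (intro nulI[of "s \<otimes> t"]) (auto simp: smult_r_distr)
qed

lemma nul_smult:
  assumes "nul x" "r \<in> carrier R" shows "nul (r \<odot>\<^bsub>M\<^esub> x)"
proof -
  obtain s where s: "s \<in> S" "x \<in> carrier M" "s \<odot>\<^bsub>M\<^esub> x = \<zero>\<^bsub>M\<^esub>"
    using assms unfolding nul_def by auto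
  have "s \<odot>\<^bsub>M\<^esub> (r \<odot>\<^bsub>M\<^esub> x) = r \<odot>\<^bsub>M\<^esub> (s \<odot>\<^bsub>M\<^esub> x)"
    using s(1,2) assms(2) by (simp add: smult_assoc1[symmetric] R.m_comm)
  then show ?thesis using s assms(2) by (intro nulI[of s]) auto
qed

lemma nul_cancel:
  assumes "nul (s \<odot>\<^bsub>M\<^esub> x)" "s \<in> S" "x \<in> carrier M" shows "nul x"
proof -
  obtain t where "t \<in> S" "t \<odot>\<^bsub>M\<^esub> (s \<odot>\<^bsub>M\<^esub> x) = \<zero>\<^bsub>M\<^esub>" using assms(1) unfolding nul_def by auto
  then show ?thesis using assms by (intro nulI[of "t \<otimes> s"]) (auto simp: smult_assoc1)
qed

lemma nulR_cancel:
  assumes "nulR (s \<otimes> a)" "s \<in> S" "a \<in> carrier R" shows "nulR a"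
proof -
  obtain t where "t \<in> S" "t \<otimes> (s \<otimes> a) = \<zero>" using assms(1) unfolding nulR_def by auto
  then show ?thesis using assms by (intro nulRI[of "t \<otimes> s"]) (auto simp: R.m_assoc)
qed

lemma nul_B: "nul x \<Longrightarrow> y \<in> carrier M \<Longrightarrow> nulR (B x y)"
  unfolding nul_def nulR_def by (metis B_closed B_smult_l B_zero_l S_closed)

section \<open>Finite linear combinations and elimination of generators\<close>

definition lc where "lc c a k = (\<Oplus>\<^bsub>M\<^esub>i\<in>{..<k::nat}. c i \<odot>\<^bsub>M\<^esub> a i)"

lemma lc_0 [simp]: "lc c a 0 = \<zero>\<^bsub>M\<^esub>" by (simp add: lc_def)

lemma lc_Suc:
  assumes "\<And>i. i < Suc k \<Longrightarrow> c i \<in> carrier R" "\<And>i. i < Suc k \<Longrightarrow> a i \<in> carrier M"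
  shows "lc c a (Suc k) = c k \<odot>\<^bsub>M\<^esub> a k \<oplus>\<^bsub>M\<^esub> lc c a k"
  unfolding lc_def lessThan_Suc using assms by (intro M.finsum_insert) auto

lemma lc_closed [simp]:
  assumes "\<And>i. i < k \<Longrightarrow> c i \<in> carrier R" "\<And>i. i < k \<Longrightarrow> a i \<in> carrier M"
  shows "lc c a k \<in> carrier M"
  unfolding lc_def using assms by (intro M.finsum_closed) auto

lemma lc_map:
  assumes "\<And>i. i < k \<Longrightarrow> c i \<in> carrier R" "\<And>i. i < k \<Longrightarrow> a i \<in> carrier M"
    and "\<phi> \<zero>\<^bsub>M\<^esub> = \<zero>\<^bsub>M\<^esub>" "\<And>x. x \<in> carrier M \<Longrightarrow> \<phi> x \<in> carrier M"
      "\<And>x y. x \<in> carrier M \<Longrightarrow> y \<in> carrier M \<Longrightarrow> \<phi> (x \<oplus>\<^bsub>M\<^esub> y) = \<phi> x \<oplus>\<^bsub>M\<^esub> \<phi> y"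
      "\<And>r x. r \<in> carrier R \<Longrightarrow> x \<in> carrier M \<Longrightarrow> \<phi> (r \<odot>\<^bsub>M\<^esub> x) = r \<odot>\<^bsub>M\<^esub> \<phi> x"
  shows "\<phi> (lc c a k) = lc c (\<lambda>i. \<phi> (a i)) k"
  using assms(1,2)
proof (induction k)
  case (Suc k)
  then show ?case using assms(3-) by (simp add: lc_Suc)
qed (use assms in simp)

lemma lc_smult:
  assumes "\<And>i. i < k \<Longrightarrow> c i \<in> carrier R" "\<And>i. i < k \<Longrightarrow> a i \<in> carrier M" "r \<in> carrier R"
  shows "r \<odot>\<^bsub>M\<^esub> lc c a k = lc (\<lambda>i. r \<otimes> c i) a k"
  using assms(1,2)
proof (induction k)
  case (Suc k)
  then show ?case using assms(3) by (simp add: lc_Suc smult_r_distr smult_assoc1)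
qed (use assms in simp)

lemma lc_add:
  assumes "\<And>i. i < k \<Longrightarrow> c i \<in> carrier R" "\<And>i. i < k \<Longrightarrow> d i \<in> carrier R" "\<And>i. i < k \<Longrightarrow> a i \<in> carrier M"
  shows "lc c a k \<oplus>\<^bsub>M\<^esub> lc d a k = lc (\<lambda>i. c i \<oplus> d i) a k"
  using assms
proof (induction k)
  case (Suc k)
  have "lc (\<lambda>i. c i \<oplus> d i) a (Suc k) = (c k \<odot>\<^bsub>M\<^esub> a k \<oplus>\<^bsub>M\<^esub> d k \<odot>\<^bsub>M\<^esub> a k) \<oplus>\<^bsub>M\<^esub> (lc c a k \<oplus>\<^bsub>M\<^esub> lc d a k)"
    using Suc by (simp add: lc_Suc smult_l_distr)
  then show ?case using Suc.prems by (simp add: lc_Suc M.a_ac)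
qed simp

lemma lc_add_r:
  assumes "\<And>i. i < k \<Longrightarrow> c i \<in> carrier R" "\<And>i. i < k \<Longrightarrow> a i \<in> carrier M" "\<And>i. i < k \<Longrightarrow> b i \<in> carrier M"
  shows "lc c (\<lambda>i. a i \<oplus>\<^bsub>M\<^esub> b i) k = lc c a k \<oplus>\<^bsub>M\<^esub> lc c b k"
  using assms
proof (induction k)
  case (Suc k)
  then show ?case by (simp add: lc_Suc smult_r_distr M.a_ac)
qed simp

lemma lc_in:
  assumes "X \<subseteq> carrier M" "\<zero>\<^bsub>M\<^esub> \<in> X" "\<And>x y. x \<in> X \<Longrightarrow> y \<in> X \<Longrightarrow> x \<oplus>\<^bsub>M\<^esub> y \<in> X"
     "\<And>r x. r \<in> carrier R \<Longrightarrow> x \<in> X \<Longrightarrow> r \<odot>\<^bsub>M\<^esub> x \<in> X"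
    and "\<And>i. i < k \<Longrightarrow> c i \<in> carrier R" "\<And>i. i < k \<Longrightarrow> a i \<in> X"
  shows "lc c a k \<in> X"
  using assms(5,6)
proof (induction k)
  case (Suc k)
  then have "lc c a (Suc k) = c k \<odot>\<^bsub>M\<^esub> a k \<oplus>\<^bsub>M\<^esub> lc c a k"
    using assms(1) by (intro lc_Suc) auto
  then show ?case using Suc assms(3,4) by simp
qed (use assms in simp)

lemma lc_cong: "\<lbrakk>\<And>i. i < k \<Longrightarrow> c i = d i; \<And>i. i < k \<Longrightarrow> a i = b i; \<And>i. i < k \<Longrightarrow> d i \<in> carrier R; \<And>i. i < k \<Longrightarrow> b i \<in> carrier M\<rbrakk>
   \<Longrightarrow> lc c a k = lc d b k"
  unfolding lc_def by (rule M.finsum_cong') auto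

lemma nul_lc: "\<lbrakk>\<And>i. i < k \<Longrightarrow> c i \<in> carrier R; \<And>i. i < k \<Longrightarrow> nul (a i)\<rbrakk> \<Longrightarrow> nul (lc c a k)"
  using lc_in[of "Collect nul" k c a] nul_zero nul_add nul_smult nul_carrier by blast

lemma common_denominator:
  assumes "\<And>i. i < (k::nat) \<Longrightarrow> \<exists>t\<in>S. Q i t" "\<And>i s t. Q i t \<Longrightarrow> s \<in> S \<Longrightarrow> t \<in> S \<Longrightarrow> Q i (s \<otimes> t)"
  shows "\<exists>t\<in>S. \<forall>i<k. Q i t"
  using assms(1)
proof (induction k)
  case 0 then show ?case using S_one by blast
next
  case (Suc k)
  then obtain t where t: "t \<in> S" "\<forall>i<k. Q i t" by fastforce
  obtain s where s: "s \<in> S" "Q k s" using Suc.prems[of k] by auto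
  have "Q i (s \<otimes> t)" if "i < Suc k" for i
  proof (cases "i = k")
    case True
    then show ?thesis using assms(2)[OF s(2) t(1) s(1)] s(1) t(1) by (simp add: R.m_comm)
  next
    case False
    then show ?thesis using assms(2)[of i t s] t s that by auto
  qed
  then show ?case using s t by blast
qed

text \<open>Elimination instead of a determinant: the difference of \<open>s\<close> and the last
  coefficient is outside \<mm>, so up to that factor the last generator is a combination of the
  others. Substituting it keeps all coefficients in \<mm>, and the induction applies to the shorter
  list.\<close>

lemma nakayama:
  assumes "\<And>i. i < k \<Longrightarrow> a i \<in> carrier M"
    and "\<And>j. j < k \<Longrightarrow> \<exists>s\<in>S. \<exists>c. (\<forall>i<k. c i \<in> \<mm>) \<and> s \<odot>\<^bsub>M\<^esub> a j = lc c a k"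
    and "j < k"
  shows "nul (a j)"
  using assms
proof (induction k arbitrary: j)
  case (Suc k)
  have a: "a i \<in> carrier M" if "i < Suc k" for i using Suc.prems(1) that .
  have mc: "x \<in> carrier R" if "x \<in> \<mm>" for x using that m.Icarr by simp
  obtain s c where s: "s \<in> S" and c: "\<And>i. i < Suc k \<Longrightarrow> c i \<in> \<mm>" and eq: "s \<odot>\<^bsub>M\<^esub> a k = lc c a (Suc k)"
    using Suc.prems(2)[of k] by auto
  define s' where "s' = s \<ominus> c k"
  have s': "s' \<in> S"
  proof (rule ccontr)
    assume "s' \<notin> S"
    then have "s' \<oplus> c k \<in> \<mm>" using s c mc by (auto simp: S_def s'_def)
    moreover have "s' \<oplus> c k = s" using s c[of k] mc by (simp add: s'_def a_minus_def R.cring_simprules)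
    ultimately show False using s by (simp add: S_def)
  qed
  have ak: "s' \<odot>\<^bsub>M\<^esub> a k = lc c a k"
  proof -
    have "s' \<odot>\<^bsub>M\<^esub> a k = s \<odot>\<^bsub>M\<^esub> a k \<oplus>\<^bsub>M\<^esub> \<ominus>\<^bsub>M\<^esub> (c k \<odot>\<^bsub>M\<^esub> a k)"
      using s c[of k] mc a[of k] by (simp add: s'_def a_minus_def smult_l_distr smult_l_minus)
    also have "\<dots> = (c k \<odot>\<^bsub>M\<^esub> a k \<oplus>\<^bsub>M\<^esub> lc c a k) \<oplus>\<^bsub>M\<^esub> \<ominus>\<^bsub>M\<^esub> (c k \<odot>\<^bsub>M\<^esub> a k)"
      using c a mc eq by (simp add: lc_Suc)
    also have "\<dots> = lc c a k"
      using c a mc by (simp add: M.a_ac M.r_neg M.r_neg1 M.r_neg2)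
    finally show ?thesis .
  qed
  have IH: "nul (a j)" if j: "j < k" for j
  proof (rule Suc.IH[OF _ _ j])
    fix j assume j: "j < k"
    obtain t d where t: "t \<in> S" and d: "\<And>i. i < Suc k \<Longrightarrow> d i \<in> \<mm>" and eq: "t \<odot>\<^bsub>M\<^esub> a j = lc d a (Suc k)"
      using Suc.prems(2)[of j] j by auto
    have "(s' \<otimes> t) \<odot>\<^bsub>M\<^esub> a j = s' \<odot>\<^bsub>M\<^esub> (d k \<odot>\<^bsub>M\<^esub> a k \<oplus>\<^bsub>M\<^esub> lc d a k)"
      using s' t j a d mc by (simp add: smult_assoc1 eq lc_Suc)
    also have "\<dots> = d k \<odot>\<^bsub>M\<^esub> (s' \<odot>\<^bsub>M\<^esub> a k) \<oplus>\<^bsub>M\<^esub> s' \<odot>\<^bsub>M\<^esub> lc d a k"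
      using s' a d mc by (simp add: smult_r_distr smult_assoc1[symmetric] R.m_comm)
    also have "\<dots> = lc (\<lambda>i. d k \<otimes> c i \<oplus> s' \<otimes> d i) a k"
      using s' a d c mc by (simp add: ak lc_smult lc_add)
    finally have "(s' \<otimes> t) \<odot>\<^bsub>M\<^esub> a j = lc (\<lambda>i. d k \<otimes> c i \<oplus> s' \<otimes> d i) a k" .
    moreover have "\<forall>i<k. d k \<otimes> c i \<oplus> s' \<otimes> d i \<in> \<mm>"
      using s' d c mc by (simp add: m.I_l_closed)
    ultimately show "\<exists>s\<in>S. \<exists>c. (\<forall>i<k. c i \<in> \<mm>) \<and> s \<odot>\<^bsub>M\<^esub> a j = lc c a k"
      using s' t by (intro bexI[of _ "s' \<otimes> t"] exI conjI) auto
  qed (use a in auto)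
  show ?case
  proof (cases "j = k")
    case True
    have "nul (lc c a k)" using c mc IH by (intro nul_lc) auto
    then show ?thesis using nul_cancel[of s' "a k"] s' ak a True by simp
  next
    case False
    then show ?thesis using IH Suc.prems(3) by simp
  qed
qed simp

end

section \<open>Hyperbolic planes from a Lagrangian\<close>

text \<open>\<open>N\<close> and \<open>N'\<close> are the preimages in \<open>M\<close> of a Lagrangian summand of the localization at \<open>\<mm>\<close> and of a
  complement; \<open>xs\<close> and \<open>ps\<close> form a dual basis, the functionals being represented by the form.\<close>

locale orth_lagrangian = orth_local +
  fixes N N' and k :: nat and xs ps
  assumes N: "submodule N R M" and N': "submodule N' R M"
    and N_isotropic: "\<lbrakk>x \<in> N; y \<in> N\<rbrakk> \<Longrightarrow> nulR (B x y)"
    and N_maximal: "\<lbrakk>p \<in> carrier M; \<And>x. x \<in> N \<Longrightarrow> nulR (B p x)\<rbrakk> \<Longrightarrow> p \<in> N"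
    and N_N': "\<lbrakk>x \<in> N; x \<in> N'\<rbrakk> \<Longrightarrow> nul x"
    and N_sum: "p \<in> carrier M \<Longrightarrow> \<exists>t\<in>S. \<exists>a\<in>N. \<exists>b\<in>N'. t \<odot>\<^bsub>M\<^esub> p = a \<oplus>\<^bsub>M\<^esub> b"
    and dual_closed [simp]: "i < k \<Longrightarrow> xs i \<in> carrier M" "i < k \<Longrightarrow> ps i \<in> carrier M"
    and dual: "p \<in> carrier M \<Longrightarrow> p = lc (\<lambda>i. B (ps i) p) xs k"
begin

lemma N_in: "x \<in> N \<Longrightarrow> x \<in> carrier M"
  using submoduleE(1)[OF N] by auto
lemma N_closed: "\<lbrakk>x \<in> N; y \<in> N\<rbrakk> \<Longrightarrow> x \<oplus>\<^bsub>M\<^esub> y \<in> N" "\<lbrakk>r \<in> carrier R; x \<in> N\<rbrakk> \<Longrightarrow> r \<odot>\<^bsub>M\<^esub> x \<in> N"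
    "x \<in> N \<Longrightarrow> \<ominus>\<^bsub>M\<^esub> x \<in> N" "\<lbrakk>x \<in> N; y \<in> N\<rbrakk> \<Longrightarrow> x \<ominus>\<^bsub>M\<^esub> y \<in> N" "\<zero>\<^bsub>M\<^esub> \<in> N"
  using submoduleE[OF N] subgroup.one_closed[OF submodule.axioms(1)[OF N]] by (auto simp: a_minus_def)
lemma N'_in: "x \<in> N' \<Longrightarrow> x \<in> carrier M"
  using submoduleE(1)[OF N'] by auto
lemma N'_closed: "\<lbrakk>x \<in> N'; y \<in> N'\<rbrakk> \<Longrightarrow> x \<oplus>\<^bsub>M\<^esub> y \<in> N'" "\<lbrakk>r \<in> carrier R; x \<in> N'\<rbrakk> \<Longrightarrow> r \<odot>\<^bsub>M\<^esub> x \<in> N'" "\<zero>\<^bsub>M\<^esub> \<in> N'"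
  using submoduleE[OF N'] subgroup.one_closed[OF submodule.axioms(1)[OF N']] by auto

text \<open>A direct summand of a finitely generated module is finitely generated: the
  \<open>a i\<close> are the \<open>N\<close>-components of the \<open>xs i\<close> over a common
  denominator \<open>t\<close>. The other components cancel only up to torsion, which costs the
  factor \<open>s\<close> depending on \<open>x\<close>.\<close>

lemma lagrangian_generators:
  "\<exists>t\<in>S. \<exists>a. (\<forall>i<k. a i \<in> N) \<and> (\<forall>x\<in>N. \<exists>s\<in>S. (s \<otimes> t) \<odot>\<^bsub>M\<^esub> x = lc (\<lambda>i. s \<otimes> B (ps i) x) a k)"
proof -
  have "\<exists>t\<in>S. \<forall>i<k. \<exists>a\<in>N. \<exists>b\<in>N'. t \<odot>\<^bsub>M\<^esub> xs i = a \<oplus>\<^bsub>M\<^esub> b \<and> i < k"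
  proof (rule common_denominator)
    show "\<exists>t\<in>S. \<exists>a\<in>N. \<exists>b\<in>N'. t \<odot>\<^bsub>M\<^esub> xs i = a \<oplus>\<^bsub>M\<^esub> b \<and> i < k" if "i < k" for i
      using N_sum[OF dual_closed(1)[OF that]] that by simp
    fix i s t assume "\<exists>a\<in>N. \<exists>b\<in>N'. t \<odot>\<^bsub>M\<^esub> xs i = a \<oplus>\<^bsub>M\<^esub> b \<and> i < k" "s \<in> S" "t \<in> S"
    then obtain a b where ab: "a \<in> N" "b \<in> N'" "t \<odot>\<^bsub>M\<^esub> xs i = a \<oplus>\<^bsub>M\<^esub> b" "i < k" "s \<in> S" "t \<in> S" by auto
    then have "(s \<otimes> t) \<odot>\<^bsub>M\<^esub> xs i = s \<odot>\<^bsub>M\<^esub> a \<oplus>\<^bsub>M\<^esub> s \<odot>\<^bsub>M\<^esub> b"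
      by (simp add: smult_assoc1 smult_r_distr N_in N'_in)
    then show "\<exists>a\<in>N. \<exists>b\<in>N'. (s \<otimes> t) \<odot>\<^bsub>M\<^esub> xs i = a \<oplus>\<^bsub>M\<^esub> b \<and> i < k"
      using ab N_closed(2)[of s a] N'_closed(2)[of s b] by auto
  qed
  then obtain t where t: "t \<in> S" "\<forall>i<k. \<exists>a\<in>N. \<exists>b\<in>N'. t \<odot>\<^bsub>M\<^esub> xs i = a \<oplus>\<^bsub>M\<^esub> b \<and> i < k" by (elim bexE) (rule that)
  then obtain a b where ab: "\<And>i. i < k \<Longrightarrow> a i \<in> N" "\<And>i. i < k \<Longrightarrow> b i \<in> N'"
     "\<And>i. i < k \<Longrightarrow> t \<odot>\<^bsub>M\<^esub> xs i = a i \<oplus>\<^bsub>M\<^esub> b i" by metis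
  have abc: "\<And>i. i < k \<Longrightarrow> a i \<in> carrier M" "\<And>i. i < k \<Longrightarrow> b i \<in> carrier M"
    using ab N_in N'_in by auto
  have "\<exists>s\<in>S. (s \<otimes> t) \<odot>\<^bsub>M\<^esub> x = lc (\<lambda>i. s \<otimes> B (ps i) x) a k" if x: "x \<in> N" for x
  proof -
    let ?c = "\<lambda>i. B (ps i) x"
    have xc: "x \<in> carrier M" using x N_in by auto
    have cc: "\<And>i. i < k \<Longrightarrow> ?c i \<in> carrier R" using xc by simp
    have lN: "lc ?c a k \<in> N" by (rule lc_in) (use N_in N_closed ab cc in auto)
    have lN': "lc ?c b k \<in> N'" by (rule lc_in) (use N'_in N'_closed ab cc in auto)
    have "t \<odot>\<^bsub>M\<^esub> x = t \<odot>\<^bsub>M\<^esub> lc ?c xs k" using dual[OF xc] by simp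
    also have "\<dots> = lc ?c (\<lambda>i. t \<odot>\<^bsub>M\<^esub> xs i) k"
      by (rule lc_map) (use cc t(1) in \<open>simp_all add: smult_r_distr smult_assoc1[symmetric] R.m_comm\<close>)
    also have "\<dots> = lc ?c (\<lambda>i. a i \<oplus>\<^bsub>M\<^esub> b i) k"
      by (rule lc_cong) (use cc abc ab(3) in simp_all)
    also have "\<dots> = lc ?c a k \<oplus>\<^bsub>M\<^esub> lc ?c b k"
      by (rule lc_add_r) (use cc abc in auto)
    finally have eq: "t \<odot>\<^bsub>M\<^esub> x = lc ?c a k \<oplus>\<^bsub>M\<^esub> lc ?c b k" .
    \<comment> \<open>The \<open>N'\<close>-part is a difference of two elements of
      \<open>N\<close>, hence lies in both submodules and is torsion.\<close>
    have "lc ?c b k = t \<odot>\<^bsub>M\<^esub> x \<ominus>\<^bsub>M\<^esub> lc ?c a k"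
      unfolding eq a_minus_def using N_in[OF lN] N'_in[OF lN']
      by (simp add: M.a_comm[of "lc ?c a k" "lc ?c b k"] M.a_assoc M.r_neg)
    then have "lc ?c b k \<in> N" using N_closed lN t(1) x by simp
    then have "nul (lc ?c b k)" using N_N' lN' by simp
    then obtain s where s: "s \<in> S" "s \<odot>\<^bsub>M\<^esub> lc ?c b k = \<zero>\<^bsub>M\<^esub>" by (auto simp: nul_def)
    have "(s \<otimes> t) \<odot>\<^bsub>M\<^esub> x = s \<odot>\<^bsub>M\<^esub> lc ?c a k"
      using s t(1) xc eq N_in[OF lN] N'_in[OF lN'] by (simp add: smult_assoc1 smult_r_distr)
    also have "\<dots> = lc (\<lambda>i. s \<otimes> ?c i) a k"
      by (rule lc_smult) (use s cc abc in auto)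
    finally show ?thesis using s by blast
  qed
  with t(1) ab(1) show ?thesis by blast
qed

text \<open>The choice \<open>e = f = 0\<close>, \<open>h1 = 1\<close> is admitted and produces the first plane. If no partner existed, all
  values of the form on \<open>N \<inter> f\<^sup>\<bottom>\<close> would lie in \<open>\<mm>\<close>, and Nakayama elimination on its generators would kill it.\<close>

lemma next_plane:
  assumes e: "e \<in> N" "f \<in> carrier M" "B f f = \<zero>" "B e e = \<zero>"
    and h1: "h1 \<in> S" "B e f \<odot>\<^bsub>M\<^esub> e = h1 \<odot>\<^bsub>M\<^esub> e" "B e f \<odot>\<^bsub>M\<^esub> f = h1 \<odot>\<^bsub>M\<^esub> f"
    and nonspan: "b \<in> carrier M" "\<not> nul (h1 \<odot>\<^bsub>M\<^esub> b \<ominus>\<^bsub>M\<^esub> B b f \<odot>\<^bsub>M\<^esub> e \<ominus>\<^bsub>M\<^esub> B b e \<odot>\<^bsub>M\<^esub> f)"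
  shows "\<exists>e'\<in>N. \<exists>f'\<in>carrier M. B e' e' = \<zero> \<and> B f' f' = \<zero> \<and> B e e' = \<zero> \<and> B e f' = \<zero> \<and>
    B f e' = \<zero> \<and> B f f' = \<zero> \<and> B e' f' \<in> S"
proof -
  have ec: "e \<in> carrier M" using e N_in by auto
  have h1c: "h1 \<in> carrier R" using h1 by simp
  \<comment> \<open>\<open>h1\<close> is only asked to act like \<open>B e f\<close> on
    \<open>e\<close> and \<open>f\<close>; that is how the zero pair can be combined with the value
    1.\<close>
  have he: "B e f \<otimes> B p e = h1 \<otimes> B p e" "B e f \<otimes> B p f = h1 \<otimes> B p f" if "p \<in> carrier M" for p
    using arg_cong[OF h1(2), of "B p"] arg_cong[OF h1(3), of "B p"] that ec e h1c by simp_all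
  note fe = B_sym[OF e(2) ec]
  define pj where "pj p = h1 \<odot>\<^bsub>M\<^esub> p \<ominus>\<^bsub>M\<^esub> B p f \<odot>\<^bsub>M\<^esub> e \<ominus>\<^bsub>M\<^esub> B p e \<odot>\<^bsub>M\<^esub> f" for p
  have pj: "pj p \<in> carrier M" "B (pj p) e = \<zero>" "B (pj p) f = \<zero>" if "p \<in> carrier M" for p
  proof -
    show "pj p \<in> carrier M" using that e ec h1c by (simp add: pj_def)
    show "B (pj p) e = \<zero>" "B (pj p) f = \<zero>"
      using that e ec h1c he[OF that] fe by (simp_all add: pj_def bil)
  qed
  \<comment> \<open>Projects along \<open>e\<close> onto the complement of \<open>f\<close>, up to
    \<open>h1\<close>. Unlike \<open>pj\<close> it subtracts only a multiple of \<open>e\<close>, so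
    it maps \<open>N\<close> into \<open>N\<close>.\<close>
  define \<phi> where "\<phi> x = h1 \<odot>\<^bsub>M\<^esub> x \<ominus>\<^bsub>M\<^esub> B x f \<odot>\<^bsub>M\<^esub> e" for x
  have \<phi>c: "\<phi> x \<in> carrier M" if "x \<in> carrier M" for x using that e ec h1c by (simp add: \<phi>_def)
  have \<phi>N: "\<phi> x \<in> N" if "x \<in> N" for x
    unfolding \<phi>_def using that e N_in h1c by (intro N_closed) auto
  have \<phi>f: "B (\<phi> x) f = \<zero>" if "x \<in> carrier M" for x
    using that e ec h1c he[OF that] by (simp add: \<phi>_def bil)
  let ?N2 = "{x \<in> N. B x f = \<zero>}"
  have "\<exists>x\<in>?N2. \<exists>y\<in>carrier M. B y e = \<zero> \<and> B y f = \<zero> \<and> B x y \<notin> \<mm>"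
  proof (rule ccontr)
    assume neg: "\<not> ?thesis"
    \<comment> \<open>Replacing \<open>y\<close> by \<open>pj y\<close> costs the factor
      \<open>h1\<close>, a pairing of \<open>x\<close> with \<open>f\<close>, which is zero, and a
      pairing of two vectors of \<open>N\<close>, which is torsion and so lies in \<mm>.\<close>
    have in_m: "B x y \<in> \<mm>" if x: "x \<in> ?N2" and y: "y \<in> carrier M" for x y
    proof (rule m_prime[OF h1(1)])
      have xc: "x \<in> carrier M" using x N_in by auto
      have "B x (pj y) \<in> \<mm>" using neg x pj[OF y] by blast
      moreover have "B x e \<in> \<mm>" using N_isotropic x e nulR_m by auto
      moreover have "B x f = \<zero>" using x by auto
      moreover have "h1 \<otimes> B x y = B x (pj y) \<oplus> B y f \<otimes> B x e \<oplus> B y e \<otimes> B x f"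
        using xc y e ec h1c by (simp add: pj_def bil)
      ultimately show "h1 \<otimes> B x y \<in> \<mm>" using xc y e ec by (simp add: m.I_l_closed)
    qed (use x y N_in in auto)
    obtain t a where t: "t \<in> S" and aN: "\<And>i. i < k \<Longrightarrow> a i \<in> N"
      and gen: "\<And>x. x \<in> N \<Longrightarrow> \<exists>s\<in>S. (s \<otimes> t) \<odot>\<^bsub>M\<^esub> x = lc (\<lambda>i. s \<otimes> B (ps i) x) a k"
      using lagrangian_generators by blast
    define a' where "a' = (\<lambda>i. \<phi> (a i))"
    have a': "a' i \<in> ?N2" "a' i \<in> carrier M" if "i < k" for i
      using aN[OF that] \<phi>N \<phi>f N_in \<phi>c by (auto simp: a'_def)
    have gen2: "\<exists>s\<in>S. \<exists>c. (\<forall>i<k. c i \<in> \<mm>) \<and> s \<odot>\<^bsub>M\<^esub> x = lc c a' k" if x: "x \<in> ?N2" for x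
    proof -
      have xc: "x \<in> carrier M" using x N_in by auto
      obtain s where s: "s \<in> S" "(s \<otimes> t) \<odot>\<^bsub>M\<^esub> x = lc (\<lambda>i. s \<otimes> B (ps i) x) a k"
        using gen x by blast
      have "(h1 \<otimes> (s \<otimes> t)) \<odot>\<^bsub>M\<^esub> x = \<phi> ((s \<otimes> t) \<odot>\<^bsub>M\<^esub> x)"
        using x xc s(1) t h1c e ec by (simp add: \<phi>_def smult_assoc1 a_minus_def)
      also have "\<dots> = lc (\<lambda>i. s \<otimes> B (ps i) x) (\<lambda>i. \<phi> (a i)) k"
        unfolding s(2)
      proof (rule lc_map)
        show "\<phi> (u \<oplus>\<^bsub>M\<^esub> v) = \<phi> u \<oplus>\<^bsub>M\<^esub> \<phi> v" if "u \<in> carrier M" "v \<in> carrier M" for u v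
          by (rule B_sep) (use that e ec h1c in \<open>simp_all add: \<phi>_def bil\<close>)
        show "\<phi> (r \<odot>\<^bsub>M\<^esub> u) = r \<odot>\<^bsub>M\<^esub> \<phi> u" if "r \<in> carrier R" "u \<in> carrier M" for r u
          by (rule B_sep) (use that e ec h1c in \<open>simp_all add: \<phi>_def bil\<close>)
        show "\<phi> \<zero>\<^bsub>M\<^esub> = \<zero>\<^bsub>M\<^esub>" using e ec h1c by (simp add: \<phi>_def a_minus_def)
      qed (use aN N_in \<phi>c s xc in auto)
      finally have "(h1 \<otimes> (s \<otimes> t)) \<odot>\<^bsub>M\<^esub> x = lc (\<lambda>i. s \<otimes> B (ps i) x) a' k" by (simp add: a'_def)
      moreover have "\<forall>i<k. s \<otimes> B (ps i) x \<in> \<mm>"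
        using in_m[OF x] xc B_sym[OF xc] s(1) by (auto intro!: m.I_l_closed)
      ultimately show ?thesis using s(1) t h1(1) by (intro bexI[of _ "h1 \<otimes> (s \<otimes> t)"] exI conjI) auto
    qed
    have nul_a': "nul (a' i)" if "i < k" for i
      by (rule nakayama[OF a'(2) gen2 that]) (use a' in auto)
    have nul_N2: "nul x" if x: "x \<in> ?N2" for x
    proof -
      obtain s c where s: "s \<in> S" "\<And>i. i < k \<Longrightarrow> c i \<in> \<mm>" "s \<odot>\<^bsub>M\<^esub> x = lc c a' k"
        using gen2[OF x] by blast
      have "nul (lc c a' k)" using s(2) m.Icarr nul_a' by (intro nul_lc) auto
      then show ?thesis using nul_cancel[of s x] s x N_in by simp
    qed
    \<comment> \<open>As \<open>?N2\<close> is torsion, \<open>pj b\<close> pairs to torsion with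
      all of \<open>N\<close>. Maximality of \<open>N\<close> then places \<open>pj b\<close> in
      \<open>?N2\<close>, against the choice of \<open>b\<close>.\<close>
    have "pj b \<in> N"
    proof (rule N_maximal)
      fix x assume x: "x \<in> N"
      then have xc: "x \<in> carrier M" by (rule N_in)
      have "nul (\<phi> x)" using nul_N2 \<phi>N[OF x] \<phi>f[OF xc] by auto
      then have "nulR (B (pj b) (\<phi> x))"
        using nul_B pj(1)[OF nonspan(1)] B_sym[of "pj b" "\<phi> x"] \<phi>c[OF xc] by simp
      moreover have "B (pj b) (\<phi> x) = h1 \<otimes> B (pj b) x"
        using pj[OF nonspan(1)] xc e ec h1c by (simp add: \<phi>_def a_minus_def)
      ultimately show "nulR (B (pj b) x)"
        using nulR_cancel h1(1) pj(1)[OF nonspan(1)] xc by simp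
    qed (rule pj(1)[OF nonspan(1)])
    then have "nul (pj b)" using nul_N2 pj(3)[OF nonspan(1)] by auto
    then show False using nonspan(2) by (simp add: pj_def)
  qed
  then obtain x y where x: "x \<in> N" "B x f = \<zero>" and y: "y \<in> carrier M" "B y e = \<zero>" "B y f = \<zero>"
    and xy: "B x y \<notin> \<mm>" by blast
  have xc: "x \<in> carrier M" using x N_in by auto
  obtain t where t: "t \<in> S" "t \<otimes> B x x = \<zero>" using N_isotropic[OF x(1) x(1)] by (auto simp: nulR_def)
  obtain t' where t': "t' \<in> S" "t' \<otimes> B x e = \<zero>" using N_isotropic[OF x(1) e(1)] by (auto simp: nulR_def)
  note tc = S_closed[OF t(1)] S_closed[OF t'(1)]
  \<comment> \<open>\<open>x\<close> is isotropic and orthogonal to \<open>e\<close> only up to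
    torsion; the two annihilators make both equations exact.\<close>
  define e' where "e' = (t \<otimes> t') \<odot>\<^bsub>M\<^esub> x"
  have e': "e' \<in> N" "e' \<in> carrier M" using x xc tc N_closed by (auto simp: e'_def)
  have tx: "t \<otimes> (t' \<otimes> B x x) = \<zero>"
    using t tc xc R.m_lcomm[of t t' "B x x"] by simp
  have e'o: "B e' e' = \<zero>" "B e' e = \<zero>" "B e' f = \<zero>"
    using tx t t' tc x xc e ec by (simp_all add: e'_def R.m_assoc)
  define s where "s = B e' y"
  have s: "s \<in> S"
    unfolding s_def e'_def using xy t(1) t'(1) xc y by (simp add: S_def) (intro maximal_mult[OF max], auto)
  have sc: "s \<in> carrier R" using s by simp
  \<comment> \<open>Makes \<open>y\<close> isotropic along \<open>e'\<close> without dividing: the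
    factor \<open>2s\<close> balances the cross term against the multiple of \<open>B y y\<close>.
    The pairing with \<open>e'\<close> becomes twice the square of \<open>s\<close>, still outside
    \<mm> because 2 is a unit.\<close>
  define f' where "f' = (s \<oplus> s) \<odot>\<^bsub>M\<^esub> y \<ominus>\<^bsub>M\<^esub> B y y \<odot>\<^bsub>M\<^esub> e'"
  have f'c: "f' \<in> carrier M" using sc y e' by (simp add: f'_def)
  have e'y: "B e' y = s" "B y e' = s" using B_sym[OF y(1) e'(2)] by (simp_all add: s_def)
  have f'o: "B f' f' = \<zero>" "B f' e = \<zero>" "B f' f = \<zero>"
    using sc y e' e'o ec e e'y by (simp_all add: f'_def bil)
  have e'f': "B e' f' = (s \<oplus> s) \<otimes> s"
    using sc y e' e'o e'y by (simp add: f'_def a_minus_def)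
  have "(s \<oplus> s) \<otimes> s \<in> S"
  proof (rule ccontr)
    assume "\<not> ?thesis"
    then have "h \<otimes> ((s \<oplus> s) \<otimes> s) \<in> \<mm>" using sc by (simp add: S_def m.I_l_closed)
    moreover have "h \<otimes> ((s \<oplus> s) \<otimes> s) = (h \<oplus> h) \<otimes> (s \<otimes> s)" using sc by (simp add: R.cring_simprules)
    ultimately show False using S_mult[OF s s] sc by (simp add: half S_def)
  qed
  then show ?thesis
    using e' f'c e'o f'o e'f' B_sym[OF ec e'(2)] B_sym[OF ec f'c] B_sym[OF e(2) e'(2)] B_sym[OF e(2) f'c]
    by (intro bexI[of _ e'] bexI[of _ f']) auto
qed

lemma nulR_uminus:
  assumes "nulR (\<ominus> a)" "a \<in> carrier R" shows "nulR a"
proof -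
  obtain t where t: "t \<in> S" "t \<otimes> \<ominus> a = \<zero>" using assms by (auto simp: nulR_def)
  then have "t \<otimes> a = \<ominus> (t \<otimes> \<ominus> a)" using assms by (simp add: R.r_minus)
  then show ?thesis using t assms by (intro nulRI[of t]) simp_all
qed

text \<open>\<open>next_plane\<close> is used twice. The second use needs a vector outside the span
  of the first plane at \<mm>, and one of three independent vectors is such.\<close>

lemma two_orthogonal_planes:
  assumes b: "b0 \<in> carrier M" "b1 \<in> carrier M" "b2 \<in> carrier M"
    and indep: "\<And>c0 c1 c2. \<lbrakk>c0 \<in> carrier R; c1 \<in> carrier R; c2 \<in> carrier R;
      c0 \<odot>\<^bsub>M\<^esub> b0 \<oplus>\<^bsub>M\<^esub> (c1 \<odot>\<^bsub>M\<^esub> b1 \<oplus>\<^bsub>M\<^esub> c2 \<odot>\<^bsub>M\<^esub> b2) = \<zero>\<^bsub>M\<^esub>\<rbrakk> \<Longrightarrow> nulR c0 \<and> nulR c1 \<and> nulR c2"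
  shows "\<exists>e1\<in>carrier M. \<exists>f1\<in>carrier M. \<exists>e2\<in>carrier M. \<exists>f2\<in>carrier M.
     B e1 e1 = \<zero> \<and> B f1 f1 = \<zero> \<and> B e2 e2 = \<zero> \<and> B f2 f2 = \<zero> \<and>
     B e1 e2 = \<zero> \<and> B e1 f2 = \<zero> \<and> B f1 e2 = \<zero> \<and> B f1 f2 = \<zero> \<and> B e1 f1 \<notin> \<mm> \<and> B e2 f2 \<notin> \<mm>"
proof -
  have S_not_nul: "\<not> nulR s" if "s \<in> S" for s
    using nulR_m that by (auto simp: S_def)
  have b0: "\<not> nul b0"
  proof
    assume "nul b0"
    then obtain t where t: "t \<in> S" "t \<odot>\<^bsub>M\<^esub> b0 = \<zero>\<^bsub>M\<^esub>" by (auto simp: nul_def)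
    then have "nulR t" using indep[of t \<zero> \<zero>] b by simp
    then show False using S_not_nul t by auto
  qed
  have "\<exists>e'\<in>N. \<exists>f'\<in>carrier M. B e' e' = \<zero> \<and> B f' f' = \<zero> \<and> B \<zero>\<^bsub>M\<^esub> e' = \<zero> \<and> B \<zero>\<^bsub>M\<^esub> f' = \<zero> \<and>
    B \<zero>\<^bsub>M\<^esub> e' = \<zero> \<and> B \<zero>\<^bsub>M\<^esub> f' = \<zero> \<and> B e' f' \<in> S"
    by (rule next_plane[of "\<zero>\<^bsub>M\<^esub>" "\<zero>\<^bsub>M\<^esub>" \<one> b0]) (use N_closed b b0 in \<open>simp_all add: a_minus_def smult_l_minus[OF R.zero_closed M.zero_closed, symmetric, unfolded smult_l_null[OF M.zero_closed]]\<close>)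
  then obtain e f where ef: "e \<in> N" "f \<in> carrier M" "B e e = \<zero>" "B f f = \<zero>" "B e f \<in> S" by blast
  have ec: "e \<in> carrier M" using ef N_in by auto
  define pj where "pj p = B e f \<odot>\<^bsub>M\<^esub> p \<ominus>\<^bsub>M\<^esub> B p f \<odot>\<^bsub>M\<^esub> e \<ominus>\<^bsub>M\<^esub> B p e \<odot>\<^bsub>M\<^esub> f" for p
  have "\<exists>b\<in>{b0,b1,b2}. \<not> nul (pj b)"
  proof (rule ccontr)
    assume "\<not> ?thesis"
    then have nuls: "nul (pj b0)" "nul (pj b1)" "nul (pj b2)" by auto
    have comb: "\<exists>s\<in>S. \<exists>\<alpha>\<in>carrier R. \<exists>\<beta>\<in>carrier R. s \<odot>\<^bsub>M\<^esub> p = \<alpha> \<odot>\<^bsub>M\<^esub> e \<oplus>\<^bsub>M\<^esub> \<beta> \<odot>\<^bsub>M\<^esub> f"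
      if p: "nul (pj p)" "p \<in> carrier M" for p
    proof -
      obtain t where t: "t \<in> S" "t \<odot>\<^bsub>M\<^esub> pj p = \<zero>\<^bsub>M\<^esub>" using p by (auto simp: nul_def)
      have "(t \<otimes> B e f) \<odot>\<^bsub>M\<^esub> p = t \<odot>\<^bsub>M\<^esub> pj p \<oplus>\<^bsub>M\<^esub> ((t \<otimes> B p f) \<odot>\<^bsub>M\<^esub> e \<oplus>\<^bsub>M\<^esub> (t \<otimes> B p e) \<odot>\<^bsub>M\<^esub> f)"
        by (rule B_sep) (use p t(1) ec ef in \<open>simp_all add: pj_def bil\<close>)
      then have "(t \<otimes> B e f) \<odot>\<^bsub>M\<^esub> p = (t \<otimes> B p f) \<odot>\<^bsub>M\<^esub> e \<oplus>\<^bsub>M\<^esub> (t \<otimes> B p e) \<odot>\<^bsub>M\<^esub> f"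
        using t p ec ef by simp
      then show ?thesis
        using S_mult[OF t(1) ef(5)] t(1) p ec ef by (intro bexI[of _ "t \<otimes> B e f"] bexI[of _ "t \<otimes> B p f"] bexI[of _ "t \<otimes> B p e"]) auto
    qed
    obtain s0 \<alpha>0 \<beta>0 where 0: "s0 \<in> S" "\<alpha>0 \<in> carrier R" "\<beta>0 \<in> carrier R" "s0 \<odot>\<^bsub>M\<^esub> b0 = \<alpha>0 \<odot>\<^bsub>M\<^esub> e \<oplus>\<^bsub>M\<^esub> \<beta>0 \<odot>\<^bsub>M\<^esub> f"
      using comb[OF nuls(1) b(1)] by blast
    obtain s1 \<alpha>1 \<beta>1 where 1: "s1 \<in> S" "\<alpha>1 \<in> carrier R" "\<beta>1 \<in> carrier R" "s1 \<odot>\<^bsub>M\<^esub> b1 = \<alpha>1 \<odot>\<^bsub>M\<^esub> e \<oplus>\<^bsub>M\<^esub> \<beta>1 \<odot>\<^bsub>M\<^esub> f"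
      using comb[OF nuls(2) b(2)] by blast
    obtain s2 \<alpha>2 \<beta>2 where 2: "s2 \<in> S" "\<alpha>2 \<in> carrier R" "\<beta>2 \<in> carrier R" "s2 \<odot>\<^bsub>M\<^esub> b2 = \<alpha>2 \<odot>\<^bsub>M\<^esub> e \<oplus>\<^bsub>M\<^esub> \<beta>2 \<odot>\<^bsub>M\<^esub> f"
      using comb[OF nuls(3) b(3)] by blast
    note cs = S_closed[OF 0(1)] S_closed[OF 1(1)] S_closed[OF 2(1)] 0(2,3) 1(2,3) 2(2,3)
    \<comment> \<open>Three vectors in the span of two are related through their 2x2 minors.\<close>
    define \<gamma> where "\<gamma> = \<alpha>0 \<otimes> \<beta>1 \<ominus> \<alpha>1 \<otimes> \<beta>0"
    have \<gamma>: "\<gamma> \<in> carrier R" using cs by (simp add: \<gamma>_def)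
    have Bz: "s0 \<otimes> B b0 z = \<alpha>0 \<otimes> B e z \<oplus> \<beta>0 \<otimes> B f z" "s1 \<otimes> B b1 z = \<alpha>1 \<otimes> B e z \<oplus> \<beta>1 \<otimes> B f z"
      "s2 \<otimes> B b2 z = \<alpha>2 \<otimes> B e z \<oplus> \<beta>2 \<otimes> B f z" if "z \<in> carrier M" for z
      using arg_cong[OF 0(4), of "\<lambda>x. B x z"] arg_cong[OF 1(4), of "\<lambda>x. B x z"] arg_cong[OF 2(4), of "\<lambda>x. B x z"]
        that cs b ec ef by simp_all
    have bf: "(\<ominus> (\<alpha>1 \<otimes> s0)) \<odot>\<^bsub>M\<^esub> b0 \<oplus>\<^bsub>M\<^esub> (\<alpha>0 \<otimes> s1) \<odot>\<^bsub>M\<^esub> b1 = \<gamma> \<odot>\<^bsub>M\<^esub> f"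
      apply (rule B_sep)
      using cs b \<gamma> ef apply simp
      using cs b \<gamma> ef apply simp
      using cs b ef ec apply (simp add: \<gamma>_def R.m_assoc Bz R.l_minus)
      using cs b ef ec by (simp add: bil)
    have be: "(\<beta>1 \<otimes> s0) \<odot>\<^bsub>M\<^esub> b0 \<oplus>\<^bsub>M\<^esub> (\<ominus> (\<beta>0 \<otimes> s1)) \<odot>\<^bsub>M\<^esub> b1 = \<gamma> \<odot>\<^bsub>M\<^esub> e"
      apply (rule B_sep)
      using cs b \<gamma> ef apply simp
      using cs b \<gamma> ef ec apply simp
      using cs b ef ec apply (simp add: \<gamma>_def R.m_assoc Bz R.l_minus)
      using cs b ef ec by (simp add: bil)
    have nul_comb: "nul (c0 \<odot>\<^bsub>M\<^esub> b0 \<oplus>\<^bsub>M\<^esub> c1 \<odot>\<^bsub>M\<^esub> b1) \<Longrightarrow> nulR c0 \<and> nulR c1" if c: "c0 \<in> carrier R" "c1 \<in> carrier R" for c0 c1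
    proof -
      assume "nul (c0 \<odot>\<^bsub>M\<^esub> b0 \<oplus>\<^bsub>M\<^esub> c1 \<odot>\<^bsub>M\<^esub> b1)"
      then obtain t where t: "t \<in> S" "t \<odot>\<^bsub>M\<^esub> (c0 \<odot>\<^bsub>M\<^esub> b0 \<oplus>\<^bsub>M\<^esub> c1 \<odot>\<^bsub>M\<^esub> b1) = \<zero>\<^bsub>M\<^esub>" by (auto simp: nul_def)
      then have "nulR (t \<otimes> c0) \<and> nulR (t \<otimes> c1)"
        using indep[of "t \<otimes> c0" "t \<otimes> c1" \<zero>] b c by (simp add: smult_assoc1 smult_r_distr)
      then show "nulR c0 \<and> nulR c1" using nulR_cancel t c by blast
    qed
    have "\<gamma> \<odot>\<^bsub>M\<^esub> (s2 \<odot>\<^bsub>M\<^esub> b2) = \<alpha>2 \<odot>\<^bsub>M\<^esub> (\<gamma> \<odot>\<^bsub>M\<^esub> e) \<oplus>\<^bsub>M\<^esub> \<beta>2 \<odot>\<^bsub>M\<^esub> (\<gamma> \<odot>\<^bsub>M\<^esub> f)"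
      unfolding 2(4) using cs \<gamma> ec ef by (simp add: smult_r_distr smult_assoc1[symmetric] R.m_comm)
    then have eq: "\<gamma> \<odot>\<^bsub>M\<^esub> (s2 \<odot>\<^bsub>M\<^esub> b2) = \<alpha>2 \<odot>\<^bsub>M\<^esub> ((\<beta>1 \<otimes> s0) \<odot>\<^bsub>M\<^esub> b0 \<oplus>\<^bsub>M\<^esub> (\<ominus> (\<beta>0 \<otimes> s1)) \<odot>\<^bsub>M\<^esub> b1) \<oplus>\<^bsub>M\<^esub>
        \<beta>2 \<odot>\<^bsub>M\<^esub> ((\<ominus> (\<alpha>1 \<otimes> s0)) \<odot>\<^bsub>M\<^esub> b0 \<oplus>\<^bsub>M\<^esub> (\<alpha>0 \<otimes> s1) \<odot>\<^bsub>M\<^esub> b1)" (is "_ = ?r")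
      unfolding bf be .
    have "(\<alpha>2 \<otimes> (\<beta>1 \<otimes> s0) \<oplus> \<beta>2 \<otimes> (\<ominus> (\<alpha>1 \<otimes> s0))) \<odot>\<^bsub>M\<^esub> b0 \<oplus>\<^bsub>M\<^esub>
       ((\<alpha>2 \<otimes> (\<ominus> (\<beta>0 \<otimes> s1)) \<oplus> \<beta>2 \<otimes> (\<alpha>0 \<otimes> s1)) \<odot>\<^bsub>M\<^esub> b1 \<oplus>\<^bsub>M\<^esub> (\<ominus> (\<gamma> \<otimes> s2)) \<odot>\<^bsub>M\<^esub> b2) =
       ?r \<oplus>\<^bsub>M\<^esub> \<ominus>\<^bsub>M\<^esub> (\<gamma> \<odot>\<^bsub>M\<^esub> (s2 \<odot>\<^bsub>M\<^esub> b2))"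
      by (rule B_sep) (use cs b \<gamma> in \<open>simp_all add: bil\<close>)
    also have "\<dots> = \<zero>\<^bsub>M\<^esub>"
      unfolding eq using cs b by (intro M.r_neg) simp
    finally have "(\<alpha>2 \<otimes> (\<beta>1 \<otimes> s0) \<oplus> \<beta>2 \<otimes> (\<ominus> (\<alpha>1 \<otimes> s0))) \<odot>\<^bsub>M\<^esub> b0 \<oplus>\<^bsub>M\<^esub>
       ((\<alpha>2 \<otimes> (\<ominus> (\<beta>0 \<otimes> s1)) \<oplus> \<beta>2 \<otimes> (\<alpha>0 \<otimes> s1)) \<odot>\<^bsub>M\<^esub> b1 \<oplus>\<^bsub>M\<^esub> (\<ominus> (\<gamma> \<otimes> s2)) \<odot>\<^bsub>M\<^esub> b2) = \<zero>\<^bsub>M\<^esub>" .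
    then have "nulR (\<ominus> (\<gamma> \<otimes> s2))" by (intro conjunct2[OF conjunct2[OF indep]]) (use cs \<gamma> in auto)
    then have "nulR (s2 \<otimes> \<gamma>)" using nulR_uminus[of "\<gamma> \<otimes> s2"] cs \<gamma> by (simp add: R.m_comm)
    then have "nulR \<gamma>" using nulR_cancel \<gamma> 2(1) by simp
    \<comment> \<open>With the minor torsion, \<open>bf\<close> and \<open>be\<close> are relations
      between \<open>b0\<close> and \<open>b1\<close> alone up to torsion. They force the
      coefficients of \<open>b0\<close> in terms of \<open>e\<close> and \<open>f\<close> to be
      torsion, hence \<open>b0\<close> too.\<close>
    then obtain t where t: "t \<in> S" "t \<otimes> \<gamma> = \<zero>" by (auto simp: nulR_def)
    have nulg: "nul (\<gamma> \<odot>\<^bsub>M\<^esub> x)" if "x \<in> carrier M" for x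
      using t that \<gamma> by (intro nulI[of t]) (auto simp: smult_assoc1[symmetric])
    have "nulR (\<alpha>0 \<otimes> s1)" "nulR (\<ominus> (\<beta>0 \<otimes> s1))"
      using nul_comb[of "\<ominus> (\<alpha>1 \<otimes> s0)" "\<alpha>0 \<otimes> s1"] nul_comb[of "\<beta>1 \<otimes> s0" "\<ominus> (\<beta>0 \<otimes> s1)"]
        nulg[OF ec] nulg[OF ef(2)] bf be cs by auto
    then have "nulR (s1 \<otimes> \<alpha>0)" "nulR (s1 \<otimes> \<beta>0)"
      using nulR_uminus[of "\<beta>0 \<otimes> s1"] cs by (simp_all add: R.m_comm)
    then have nul0: "nulR \<alpha>0" "nulR \<beta>0" using nulR_cancel 1(1) cs by auto
    have nul_sm: "nul (r \<odot>\<^bsub>M\<^esub> x)" if r: "nulR r" and x: "x \<in> carrier M" for r x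
    proof -
      obtain t where "t \<in> S" "t \<otimes> r = \<zero>" "r \<in> carrier R" using r by (auto simp: nulR_def)
      then show ?thesis using x by (intro nulI[of t]) (auto simp: smult_assoc1[symmetric])
    qed
    have "nul (s0 \<odot>\<^bsub>M\<^esub> b0)"
      unfolding 0(4) using nul0 ec ef by (intro nul_add nul_sm)
    then show False using nul_cancel 0(1) b(1) b0 by blast
  qed
  then obtain b where b': "b \<in> carrier M" "\<not> nul (pj b)" using b by blast
  obtain e' f' where "e' \<in> N" "f' \<in> carrier M" "B e' e' = \<zero>" "B f' f' = \<zero>" "B e e' = \<zero>" "B e f' = \<zero>"
    "B f e' = \<zero>" "B f f' = \<zero>" "B e' f' \<in> S"
    using next_plane[OF ef(1,2,4,3,5) refl refl b'(1) b'(2)[unfolded pj_def]] by blast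
  then show ?thesis
    using ef ec N_in[of e'] by (intro bexI[of _ e] bexI[of _ f] bexI[of _ e'] bexI[of _ f']) (auto simp: S_def)
qed

end

section \<open>Localization\<close>

locale localization = module R M for R (structure) and M :: "('a, 'b) module" (structure) +
  fixes S
  assumes S_subset: "S \<subseteq> carrier R" and S_one [simp]: "\<one> \<in> S"
    and S_mult [simp]: "\<lbrakk>s \<in> S; t \<in> S\<rbrakk> \<Longrightarrow> s \<otimes> t \<in> S"
begin

lemma S_carrier [simp]: "s \<in> S \<Longrightarrow> s \<in> carrier R" using S_subset by auto

abbreviation cls where "cls x s \<equiv> locM_cls R M S (x, s)"
abbreviation L where "L \<equiv> localize_mod R M S"

text \<open>Equality of fractions without subtraction, so that clearing denominators needs only
  rearranged products.\<close>

definition frac_eq where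
  "frac_eq x s y t \<longleftrightarrow> (\<exists>u\<in>S. (u \<otimes> t) \<odot>\<^bsub>M\<^esub> x = (u \<otimes> s) \<odot>\<^bsub>M\<^esub> y)"

lemma mem_cls:
  assumes "x \<in> carrier M" "s \<in> S"
  shows "(y, t) \<in> cls x s \<longleftrightarrow> y \<in> carrier M \<and> t \<in> S \<and> frac_eq x s y t"
proof -
  have "u \<odot>\<^bsub>M\<^esub> (t \<odot>\<^bsub>M\<^esub> x \<ominus>\<^bsub>M\<^esub> s \<odot>\<^bsub>M\<^esub> y) = \<zero>\<^bsub>M\<^esub> \<longleftrightarrow> (u \<otimes> t) \<odot>\<^bsub>M\<^esub> x = (u \<otimes> s) \<odot>\<^bsub>M\<^esub> y"
    if "y \<in> carrier M" "t \<in> S" "u \<in> S" for y t u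
  proof -
    have eq: "u \<odot>\<^bsub>M\<^esub> (t \<odot>\<^bsub>M\<^esub> x \<ominus>\<^bsub>M\<^esub> s \<odot>\<^bsub>M\<^esub> y) = (u \<otimes> t) \<odot>\<^bsub>M\<^esub> x \<oplus>\<^bsub>M\<^esub> \<ominus>\<^bsub>M\<^esub> ((u \<otimes> s) \<odot>\<^bsub>M\<^esub> y)"
      using that assms by (simp add: a_minus_def smult_r_distr smult_r_minus smult_assoc1)
    have "v = w" if "v \<oplus>\<^bsub>M\<^esub> \<ominus>\<^bsub>M\<^esub> w = \<zero>\<^bsub>M\<^esub>" "v \<in> carrier M" "w \<in> carrier M" for v w
      using M.minus_equality[OF that(1)] that by simp
    then show ?thesis
      unfolding eq using that assms by (auto simp: M.r_neg)
  qed
  then show ?thesis by (auto simp: locM_cls_def frac_eq_def)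
qed

lemma frac_eq_refl: "frac_eq x s x s"
  unfolding frac_eq_def using S_one by blast

lemma frac_eq_sym: "frac_eq x s y t \<Longrightarrow> frac_eq y t x s"
  unfolding frac_eq_def by metis

lemma frac_eq_trans:
  assumes "frac_eq x s y t" "frac_eq y t z r" "x \<in> carrier M" "y \<in> carrier M" "z \<in> carrier M" "s \<in> S" "t \<in> S" "r \<in> S"
  shows "frac_eq x s z r"
proof -
  obtain u v where u: "u \<in> S" "(u \<otimes> t) \<odot>\<^bsub>M\<^esub> x = (u \<otimes> s) \<odot>\<^bsub>M\<^esub> y"
    and v: "v \<in> S" "(v \<otimes> r) \<odot>\<^bsub>M\<^esub> y = (v \<otimes> t) \<odot>\<^bsub>M\<^esub> z"
    using assms unfolding frac_eq_def by blast
  have "(u \<otimes> v \<otimes> t \<otimes> r) \<odot>\<^bsub>M\<^esub> x = (v \<otimes> r) \<odot>\<^bsub>M\<^esub> ((u \<otimes> t) \<odot>\<^bsub>M\<^esub> x)"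
    using u(1) v(1) assms by (simp add: smult_assoc1[symmetric] R.m_ac)
  also have "\<dots> = (u \<otimes> s) \<odot>\<^bsub>M\<^esub> ((v \<otimes> r) \<odot>\<^bsub>M\<^esub> y)"
    unfolding u(2) using u(1) v(1) assms by (simp add: smult_assoc1[symmetric] R.m_ac)
  also have "\<dots> = (u \<otimes> v \<otimes> t \<otimes> s) \<odot>\<^bsub>M\<^esub> z"
    unfolding v(2) using u(1) v(1) assms by (simp add: smult_assoc1[symmetric] R.m_ac)
  finally show ?thesis
    unfolding frac_eq_def using u(1) v(1) assms by (intro bexI[of _ "u \<otimes> v \<otimes> t"]) simp_all
qed

lemma cls_eq_iff:
  assumes "x \<in> carrier M" "s \<in> S" "y \<in> carrier M" "t \<in> S"
  shows "cls x s = cls y t \<longleftrightarrow> frac_eq x s y t"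
proof
  assume "cls x s = cls y t"
  moreover have "(x, s) \<in> cls x s" using assms by (simp add: mem_cls frac_eq_refl)
  ultimately show "frac_eq x s y t" using assms by (simp add: mem_cls frac_eq_sym)
next
  assume *: "frac_eq x s y t"
  have "z \<in> cls x s \<longleftrightarrow> z \<in> cls y t" for z
    using assms * frac_eq_trans[OF *] frac_eq_trans[OF frac_eq_sym[OF *]]
    by (cases z) (auto simp: mem_cls)
  then show "cls x s = cls y t" by blast
qed

lemma cls_eqI:
  assumes "x \<in> carrier M" "s \<in> S" "y \<in> carrier M" "t \<in> S" "u \<in> S" "(u \<otimes> t) \<odot>\<^bsub>M\<^esub> x = (u \<otimes> s) \<odot>\<^bsub>M\<^esub> y"
  shows "cls x s = cls y t"
  using assms by (auto simp: cls_eq_iff frac_eq_def)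

text \<open>The operations of the localization choose representatives by \<open>SOME\<close>. Their
  well-definedness needs only that the chosen pair is an equal fraction.\<close>

lemma cls_some:
  assumes "x \<in> carrier M" "s \<in> S"
  obtains y t where "(SOME z. z \<in> cls x s) = (y, t)" "y \<in> carrier M" "t \<in> S" "frac_eq y t x s"
proof -
  have "(x, s) \<in> cls x s" using assms by (simp add: mem_cls frac_eq_refl)
  then have "(SOME z. z \<in> cls x s) \<in> cls x s" by (rule someI)
  moreover obtain y t where "(SOME z. z \<in> cls x s) = (y, t)" by (meson surj_pair)
  ultimately show ?thesis using that assms by (simp add: mem_cls frac_eq_sym)
qed

lemma L_cases:
  assumes "X \<in> carrier L" obtains x s where "X = cls x s" "x \<in> carrier M" "s \<in> S"
  using assms by (auto simp: localize_mod_def)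

lemma cls_in_L [simp]: "x \<in> carrier M \<Longrightarrow> s \<in> S \<Longrightarrow> cls x s \<in> carrier L"
  by (auto simp: localize_mod_def)

section \<open>Operations of the localization on fractions\<close>

lemma L_zero: "\<zero>\<^bsub>L\<^esub> = cls \<zero>\<^bsub>M\<^esub> \<one>"
  by (simp add: localize_mod_def)

lemma L_add:
  assumes "x \<in> carrier M" "s \<in> S" "y \<in> carrier M" "t \<in> S"
  shows "cls x s \<oplus>\<^bsub>L\<^esub> cls y t = cls (t \<odot>\<^bsub>M\<^esub> x \<oplus>\<^bsub>M\<^esub> s \<odot>\<^bsub>M\<^esub> y) (s \<otimes> t)"
proof -
  obtain x' s' where x': "(SOME z. z \<in> cls x s) = (x', s')" "x' \<in> carrier M" "s' \<in> S" "frac_eq x' s' x s"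
    using assms cls_some by blast
  obtain y' t' where y': "(SOME z. z \<in> cls y t) = (y', t')" "y' \<in> carrier M" "t' \<in> S" "frac_eq y' t' y t"
    using assms cls_some by blast
  obtain u v where u: "u \<in> S" "(u \<otimes> s) \<odot>\<^bsub>M\<^esub> x' = (u \<otimes> s') \<odot>\<^bsub>M\<^esub> x"
    and v: "v \<in> S" "(v \<otimes> t) \<odot>\<^bsub>M\<^esub> y' = (v \<otimes> t') \<odot>\<^bsub>M\<^esub> y"
    using x'(4) y'(4) unfolding frac_eq_def by blast
  note c = assms x'(2,3) y'(2,3) u(1) v(1)
  have "cls (t' \<odot>\<^bsub>M\<^esub> x' \<oplus>\<^bsub>M\<^esub> s' \<odot>\<^bsub>M\<^esub> y') (s' \<otimes> t') = cls (t \<odot>\<^bsub>M\<^esub> x \<oplus>\<^bsub>M\<^esub> s \<odot>\<^bsub>M\<^esub> y) (s \<otimes> t)"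
  proof (rule cls_eqI[of _ _ _ _ "u \<otimes> v"])
    have "(u \<otimes> v \<otimes> (s \<otimes> t)) \<odot>\<^bsub>M\<^esub> (t' \<odot>\<^bsub>M\<^esub> x' \<oplus>\<^bsub>M\<^esub> s' \<odot>\<^bsub>M\<^esub> y') =
        (v \<otimes> t \<otimes> t') \<odot>\<^bsub>M\<^esub> ((u \<otimes> s) \<odot>\<^bsub>M\<^esub> x') \<oplus>\<^bsub>M\<^esub> (u \<otimes> s \<otimes> s') \<odot>\<^bsub>M\<^esub> ((v \<otimes> t) \<odot>\<^bsub>M\<^esub> y')"
      using c by (simp add: smult_r_distr smult_assoc1[symmetric] R.m_ac)
    also have "\<dots> = (u \<otimes> v \<otimes> (s' \<otimes> t')) \<odot>\<^bsub>M\<^esub> (t \<odot>\<^bsub>M\<^esub> x \<oplus>\<^bsub>M\<^esub> s \<odot>\<^bsub>M\<^esub> y)"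
      unfolding u(2) v(2) using c by (simp add: smult_r_distr smult_assoc1[symmetric] R.m_ac)
    finally show "(u \<otimes> v \<otimes> (s \<otimes> t)) \<odot>\<^bsub>M\<^esub> (t' \<odot>\<^bsub>M\<^esub> x' \<oplus>\<^bsub>M\<^esub> s' \<odot>\<^bsub>M\<^esub> y') =
        (u \<otimes> v \<otimes> (s' \<otimes> t')) \<odot>\<^bsub>M\<^esub> (t \<odot>\<^bsub>M\<^esub> x \<oplus>\<^bsub>M\<^esub> s \<odot>\<^bsub>M\<^esub> y)" .
  qed (use c in simp_all)
  then show ?thesis
    by (simp add: localize_mod_def x'(1) y'(1))
qed

lemma L_add1: "x \<in> carrier M \<Longrightarrow> y \<in> carrier M \<Longrightarrow> cls x \<one> \<oplus>\<^bsub>L\<^esub> cls y \<one> = cls (x \<oplus>\<^bsub>M\<^esub> y) \<one>"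
  by (simp add: L_add)

lemma cls_cancel: "x \<in> carrier M \<Longrightarrow> s \<in> S \<Longrightarrow> t \<in> S \<Longrightarrow> cls (s \<odot>\<^bsub>M\<^esub> x) (s \<otimes> t) = cls x t"
  by (rule cls_eqI[of _ _ _ _ \<one>]) (simp_all add: smult_assoc1[symmetric] R.m_ac)

lemma cls_zero_iff: "x \<in> carrier M \<Longrightarrow> s \<in> S \<Longrightarrow> cls x s = cls \<zero>\<^bsub>M\<^esub> \<one> \<longleftrightarrow> (\<exists>u\<in>S. u \<odot>\<^bsub>M\<^esub> x = \<zero>\<^bsub>M\<^esub>)"
  by (simp add: cls_eq_iff frac_eq_def)

text \<open>The structure under which \<open>finsum\<close> over the localization can be
  unfolded.\<close>

lemma L_abelian_monoid: "abelian_monoid L"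
proof (rule abelian_monoidI)
  show "X \<oplus>\<^bsub>L\<^esub> Y \<in> carrier L" if "X \<in> carrier L" "Y \<in> carrier L" for X Y
    using that by (elim L_cases) (simp add: L_add)
  show "\<zero>\<^bsub>L\<^esub> \<in> carrier L" by (simp add: L_zero)
  show "X \<oplus>\<^bsub>L\<^esub> Y = Y \<oplus>\<^bsub>L\<^esub> X" if "X \<in> carrier L" "Y \<in> carrier L" for X Y
    using that by (elim L_cases) (simp add: L_add M.a_comm R.m_comm)
  show "\<zero>\<^bsub>L\<^esub> \<oplus>\<^bsub>L\<^esub> X = X" if "X \<in> carrier L" for X
    using that by (elim L_cases) (simp add: L_add L_zero)
  show "X \<oplus>\<^bsub>L\<^esub> Y \<oplus>\<^bsub>L\<^esub> Z = X \<oplus>\<^bsub>L\<^esub> (Y \<oplus>\<^bsub>L\<^esub> Z)" if "X \<in> carrier L" "Y \<in> carrier L" "Z \<in> carrier L" for X Y Z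
    using that by (elim L_cases) (simp add: L_add smult_r_distr smult_assoc1[symmetric] M.a_ac R.m_ac)
qed

lemma L_finsum:
  assumes "\<And>i. i < (k::nat) \<Longrightarrow> x i \<in> carrier M"
  shows "(\<Oplus>\<^bsub>L\<^esub>i\<in>{..<k}. cls (x i) \<one>) = cls (\<Oplus>\<^bsub>M\<^esub>i\<in>{..<k}. x i) \<one>"
  using assms
proof (induction k)
  case 0
  then show ?case by (simp add: L_zero abelian_monoid.finsum_empty[OF L_abelian_monoid])
next
  case (Suc k)
  have "(\<Oplus>\<^bsub>L\<^esub>i\<in>{..<Suc k}. cls (x i) \<one>) = cls (x k) \<one> \<oplus>\<^bsub>L\<^esub> (\<Oplus>\<^bsub>L\<^esub>i\<in>{..<k}. cls (x i) \<one>)"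
    unfolding lessThan_Suc using Suc.prems
    by (intro abelian_monoid.finsum_insert[OF L_abelian_monoid]) auto
  also have "\<dots> = cls (x k \<oplus>\<^bsub>M\<^esub> (\<Oplus>\<^bsub>M\<^esub>i\<in>{..<k}. x i)) \<one>"
    using Suc by (simp add: L_add1 M.finsum_closed Pi_def)
  also have "x k \<oplus>\<^bsub>M\<^esub> (\<Oplus>\<^bsub>M\<^esub>i\<in>{..<k}. x i) = (\<Oplus>\<^bsub>M\<^esub>i\<in>{..<Suc k}. x i)"
    unfolding lessThan_Suc using Suc.prems by (intro M.finsum_insert[symmetric]) auto
  finally show ?case .
qed

text \<open>The ring as a module over itself, so that fractions of ring elements are an instance of
  fractions of module elements.\<close>

definition self_module :: "('a, 'a) module" where
  "self_module = \<lparr>carrier = carrier R, mult = (\<otimes>), one = \<one>, zero = \<zero>, add = (\<oplus>), smult = (\<otimes>)\<rparr>"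

lemma self_module_simps [simp]: "carrier self_module = carrier R" "\<zero>\<^bsub>self_module\<^esub> = \<zero>"
  "a \<oplus>\<^bsub>self_module\<^esub> b = a \<oplus> b" "a \<odot>\<^bsub>self_module\<^esub> b = a \<otimes> b"
  by (simp_all add: self_module_def)

lemma self_localization: "localization R self_module S"
proof -
  have "abelian_group self_module"
    by (rule abelian_groupI) (auto simp: R.a_ac intro: R.a_inv_closed R.l_neg)
  then show ?thesis
    by (intro localization.intro moduleI localization_axioms.intro)
      (auto simp: R.is_cring R.l_distr R.r_distr R.m_assoc)
qed

sublocale self: localization R self_module S by (rule self_localization)

abbreviation clsR where "clsR a s \<equiv> locR_cls R S (a, s)"

text \<open>Subtraction depends on the additive structure alone, which the ring shares with
  \<open>self_module\<close>; so both kinds of classes are the same sets.\<close>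

lemma clsR_eq: "clsR a s = self.cls a s"
  by (simp add: locR_cls_def locM_cls_def a_minus_def a_inv_def m_inv_def self_module_def)

lemma clsR_in [simp]: "a \<in> carrier R \<Longrightarrow> s \<in> S \<Longrightarrow> clsR a s \<in> carrier (localize_ring R S)"
  by (auto simp: localize_ring_def)

lemma clsR_zero_iff: "a \<in> carrier R \<Longrightarrow> s \<in> S \<Longrightarrow> clsR a s = \<zero>\<^bsub>localize_ring R S\<^esub> \<longleftrightarrow> (\<exists>u\<in>S. u \<otimes> a = \<zero>)"
  using self.cls_zero_iff[of a s] by (simp add: clsR_eq localize_ring_def)

lemma L_smult:
  assumes "a \<in> carrier R" "s \<in> S" "x \<in> carrier M" "t \<in> S"
  shows "clsR a s \<odot>\<^bsub>L\<^esub> cls x t = cls (a \<odot>\<^bsub>M\<^esub> x) (s \<otimes> t)"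
proof -
  obtain a' s' where a': "(SOME z. z \<in> clsR a s) = (a', s')" "a' \<in> carrier R" "s' \<in> S" "self.frac_eq a' s' a s"
    using assms self.cls_some[of a s] unfolding clsR_eq by auto
  obtain x' t' where x': "(SOME z. z \<in> cls x t) = (x', t')" "x' \<in> carrier M" "t' \<in> S" "frac_eq x' t' x t"
    using assms cls_some by blast
  obtain u v where u: "u \<in> S" "(u \<otimes> s) \<otimes> a' = (u \<otimes> s') \<otimes> a"
    and v: "v \<in> S" "(v \<otimes> t) \<odot>\<^bsub>M\<^esub> x' = (v \<otimes> t') \<odot>\<^bsub>M\<^esub> x"
    using a'(4) x'(4) unfolding frac_eq_def self.frac_eq_def by auto
  note c = assms a'(2,3) x'(2,3) u(1) v(1)
  have "cls (a' \<odot>\<^bsub>M\<^esub> x') (s' \<otimes> t') = cls (a \<odot>\<^bsub>M\<^esub> x) (s \<otimes> t)"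
  proof (rule cls_eqI[of _ _ _ _ "u \<otimes> v"])
    have "(u \<otimes> v \<otimes> (s \<otimes> t)) \<odot>\<^bsub>M\<^esub> (a' \<odot>\<^bsub>M\<^esub> x') = ((u \<otimes> s) \<otimes> a') \<odot>\<^bsub>M\<^esub> ((v \<otimes> t) \<odot>\<^bsub>M\<^esub> x')"
      using c by (simp add: smult_assoc1[symmetric] R.m_ac)
    also have "\<dots> = (u \<otimes> v \<otimes> (s' \<otimes> t')) \<odot>\<^bsub>M\<^esub> (a \<odot>\<^bsub>M\<^esub> x)"
      unfolding u(2) v(2) using c by (simp add: smult_assoc1[symmetric] R.m_ac)
    finally show "(u \<otimes> v \<otimes> (s \<otimes> t)) \<odot>\<^bsub>M\<^esub> (a' \<odot>\<^bsub>M\<^esub> x') = (u \<otimes> v \<otimes> (s' \<otimes> t')) \<odot>\<^bsub>M\<^esub> (a \<odot>\<^bsub>M\<^esub> x)" .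
  qed (use c in simp_all)
  then show ?thesis
    by (simp add: localize_mod_def a'(1) x'(1))
qed

lemma L_form:
  assumes B: "\<And>x y. \<lbrakk>x \<in> carrier M; y \<in> carrier M\<rbrakk> \<Longrightarrow> B x y \<in> carrier R"
      "\<And>a x y. \<lbrakk>a \<in> carrier R; x \<in> carrier M; y \<in> carrier M\<rbrakk> \<Longrightarrow> B (a \<odot>\<^bsub>M\<^esub> x) y = a \<otimes> B x y"
      "\<And>a x y. \<lbrakk>a \<in> carrier R; x \<in> carrier M; y \<in> carrier M\<rbrakk> \<Longrightarrow> B x (a \<odot>\<^bsub>M\<^esub> y) = a \<otimes> B x y"
    and xy: "x \<in> carrier M" "s \<in> S" "y \<in> carrier M" "t \<in> S"
  shows "localize_form R M S B (cls x s) (cls y t) = clsR (B x y) (s \<otimes> t)"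
proof -
  obtain x' s' where x': "(SOME z. z \<in> cls x s) = (x', s')" "x' \<in> carrier M" "s' \<in> S" "frac_eq x' s' x s"
    using xy cls_some by blast
  obtain y' t' where y': "(SOME z. z \<in> cls y t) = (y', t')" "y' \<in> carrier M" "t' \<in> S" "frac_eq y' t' y t"
    using xy cls_some by blast
  obtain u v where u: "u \<in> S" "(u \<otimes> s) \<odot>\<^bsub>M\<^esub> x' = (u \<otimes> s') \<odot>\<^bsub>M\<^esub> x"
    and v: "v \<in> S" "(v \<otimes> t) \<odot>\<^bsub>M\<^esub> y' = (v \<otimes> t') \<odot>\<^bsub>M\<^esub> y"
    using x'(4) y'(4) unfolding frac_eq_def by blast
  note c = xy x'(2,3) y'(2,3) u(1) v(1)
  have "clsR (B x' y') (s' \<otimes> t') = clsR (B x y) (s \<otimes> t)"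
    unfolding clsR_eq
  proof (rule self.cls_eqI[of _ _ _ _ "u \<otimes> v"])
    have "(u \<otimes> v \<otimes> (s \<otimes> t)) \<otimes> B x' y' = B ((u \<otimes> s) \<odot>\<^bsub>M\<^esub> x') ((v \<otimes> t) \<odot>\<^bsub>M\<^esub> y')"
      using c by (simp add: B R.m_ac)
    also have "\<dots> = (u \<otimes> v \<otimes> (s' \<otimes> t')) \<otimes> B x y"
      unfolding u(2) v(2) using c by (simp add: B R.m_ac)
    finally show "(u \<otimes> v \<otimes> (s \<otimes> t)) \<odot>\<^bsub>self_module\<^esub> B x' y' = (u \<otimes> v \<otimes> (s' \<otimes> t')) \<odot>\<^bsub>self_module\<^esub> B x y" by simp
  qed (use c B in simp_all)
  then show ?thesis
    by (simp add: localize_form_def x'(1) y'(1))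
qed

text \<open>The vectors are numerators of a basis of the localization. A relation among them gives a
  second expansion of zero besides the trivial one, so uniqueness of coordinates makes all
  coefficients torsion.\<close>

lemma free_three_independent:
  assumes "free_of_rank (localize_ring R S) L r" "3 \<le> r"
  obtains b0 b1 b2 where "b0 \<in> carrier M" "b1 \<in> carrier M" "b2 \<in> carrier M"
    "\<And>c0 c1 c2. \<lbrakk>c0 \<in> carrier R; c1 \<in> carrier R; c2 \<in> carrier R;
      c0 \<odot>\<^bsub>M\<^esub> b0 \<oplus>\<^bsub>M\<^esub> (c1 \<odot>\<^bsub>M\<^esub> b1 \<oplus>\<^bsub>M\<^esub> c2 \<odot>\<^bsub>M\<^esub> b2) = \<zero>\<^bsub>M\<^esub>\<rbrakk> \<Longrightarrow>
      (\<exists>t\<in>S. t \<otimes> c0 = \<zero>) \<and> (\<exists>t\<in>S. t \<otimes> c1 = \<zero>) \<and> (\<exists>t\<in>S. t \<otimes> c2 = \<zero>)"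
proof -
  let ?RL = "localize_ring R S"
  obtain e where e0: "(\<forall>i<r. e i \<in> carrier L) \<and> (\<forall>m\<in>carrier L.
      \<exists>!a. a \<in> {..<r} \<rightarrow>\<^sub>E carrier ?RL \<and> m = finsum L (\<lambda>i. a i \<odot>\<^bsub>L\<^esub> e i) {..<r})"
    using assms(1) unfolding free_of_rank_def by (rule exE)
  then have e: "e i \<in> carrier L" if "i < r" for i
    using that by simp
  have uniq: "\<exists>!a. a \<in> {..<r} \<rightarrow>\<^sub>E carrier ?RL \<and> m = finsum L (\<lambda>i. a i \<odot>\<^bsub>L\<^esub> e i) {..<r}" if "m \<in> carrier L" for m
    using conjunct2[OF e0] that by (rule bspec)
  have "\<exists>p. e i = cls (fst p) (snd p) \<and> fst p \<in> carrier M \<and> snd p \<in> S" if "i < r" for i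
    using e[OF that] by (elim L_cases) auto
  then obtain p where p: "\<And>i. i < r \<Longrightarrow> e i = cls (fst (p i)) (snd (p i)) \<and> fst (p i) \<in> carrier M \<and> snd (p i) \<in> S"
    by metis
  define b s where "b i = fst (p i)" and "s i = snd (p i)" for i
  have bs: "e i = cls (b i) (s i)" "b i \<in> carrier M" "s i \<in> S" if "i < r" for i
    using p[OF that] by (simp_all add: b_def s_def)
  have indep: "\<exists>t\<in>S. t \<otimes> d i = \<zero>"
    if d: "\<And>i. d i \<in> carrier R" and sum: "(\<Oplus>\<^bsub>M\<^esub>i\<in>{..<r}. d i \<odot>\<^bsub>M\<^esub> b i) = \<zero>\<^bsub>M\<^esub>" and i: "i < r" for d i
  proof -
    \<comment> \<open>\<open>d i\<close> times \<open>b i\<close> is \<open>d i * s i\<close> times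
      the basis vector \<open>b i / s i\<close>, so the coordinate absorbs the denominator.\<close>
    define A where "A d = (\<lambda>i\<in>{..<r}. clsR (d i \<otimes> s i) \<one>)" for d
    have A: "A d \<in> {..<r} \<rightarrow>\<^sub>E carrier ?RL" "finsum L (\<lambda>i. A d i \<odot>\<^bsub>L\<^esub> e i) {..<r} = cls (\<Oplus>\<^bsub>M\<^esub>i\<in>{..<r}. d i \<odot>\<^bsub>M\<^esub> b i) \<one>"
      if d: "\<And>i. d i \<in> carrier R" for d
    proof -
      show "A d \<in> {..<r} \<rightarrow>\<^sub>E carrier ?RL" using d bs by (auto simp: A_def)
      have eq: "A d i \<odot>\<^bsub>L\<^esub> e i = cls (d i \<odot>\<^bsub>M\<^esub> b i) \<one>" if i: "i < r" for i
      proof -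
        have "A d i \<odot>\<^bsub>L\<^esub> e i = cls (s i \<odot>\<^bsub>M\<^esub> (d i \<odot>\<^bsub>M\<^esub> b i)) (s i \<otimes> \<one>)"
          using i d bs[OF i] by (simp add: A_def L_smult smult_assoc1[symmetric] R.m_comm)
        then show ?thesis using d bs[OF i] cls_cancel[of "d i \<odot>\<^bsub>M\<^esub> b i" "s i" \<one>] by simp
      qed
      have "finsum L (\<lambda>i. A d i \<odot>\<^bsub>L\<^esub> e i) {..<r} = finsum L (\<lambda>i. cls (d i \<odot>\<^bsub>M\<^esub> b i) \<one>) {..<r}"
        by (rule abelian_monoid.finsum_cong'[OF L_abelian_monoid refl]) (use d bs eq in auto)
      also have "\<dots> = cls (\<Oplus>\<^bsub>M\<^esub>i\<in>{..<r}. d i \<odot>\<^bsub>M\<^esub> b i) \<one>"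
        using d bs by (intro L_finsum) auto
      finally show "finsum L (\<lambda>i. A d i \<odot>\<^bsub>L\<^esub> e i) {..<r} = cls (\<Oplus>\<^bsub>M\<^esub>i\<in>{..<r}. d i \<odot>\<^bsub>M\<^esub> b i) \<one>" .
    qed
    have z: "(\<Oplus>\<^bsub>M\<^esub>i\<in>{..<r}. \<zero> \<odot>\<^bsub>M\<^esub> b i) = \<zero>\<^bsub>M\<^esub>"
      by (rule M.add.finprod_one_eqI) (use bs in simp)
    have ex: "\<exists>!a. a \<in> {..<r} \<rightarrow>\<^sub>E carrier ?RL \<and> cls \<zero>\<^bsub>M\<^esub> \<one> = finsum L (\<lambda>i. a i \<odot>\<^bsub>L\<^esub> e i) {..<r}"
      by (rule uniq) simp
    have "A d = A (\<lambda>_. \<zero>)"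
    proof (rule trans[OF the1_equality[OF ex, symmetric] the1_equality[OF ex]])
      show "A d \<in> {..<r} \<rightarrow>\<^sub>E carrier ?RL \<and> cls \<zero>\<^bsub>M\<^esub> \<one> = finsum L (\<lambda>i. A d i \<odot>\<^bsub>L\<^esub> e i) {..<r}"
        using A[OF d] sum by simp
      show "A (\<lambda>_. \<zero>) \<in> {..<r} \<rightarrow>\<^sub>E carrier ?RL \<and> cls \<zero>\<^bsub>M\<^esub> \<one> = finsum L (\<lambda>i. A (\<lambda>_. \<zero>) i \<odot>\<^bsub>L\<^esub> e i) {..<r}"
        using A[of "\<lambda>_. \<zero>"] z by simp
    qed
    then have "A d i = A (\<lambda>_. \<zero>) i" by simp
    then have "clsR (d i \<otimes> s i) \<one> = \<zero>\<^bsub>?RL\<^esub>"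
      using i bs by (simp add: A_def localize_ring_def)
    then obtain u where "u \<in> S" "u \<otimes> (d i \<otimes> s i) = \<zero>"
      using clsR_zero_iff[of "d i \<otimes> s i" \<one>] d bs[OF i] by auto
    then show ?thesis
      using d bs[OF i] by (intro bexI[of _ "u \<otimes> s i"]) (simp_all add: R.m_ac)
  qed
  show ?thesis
  proof (rule that[of "b 0" "b 1" "b 2"])
    show "b 0 \<in> carrier M" "b 1 \<in> carrier M" "b 2 \<in> carrier M" using bs assms(2) by auto
    fix c0 c1 c2 assume c: "c0 \<in> carrier R" "c1 \<in> carrier R" "c2 \<in> carrier R"
      "c0 \<odot>\<^bsub>M\<^esub> b 0 \<oplus>\<^bsub>M\<^esub> (c1 \<odot>\<^bsub>M\<^esub> b 1 \<oplus>\<^bsub>M\<^esub> c2 \<odot>\<^bsub>M\<^esub> b 2) = \<zero>\<^bsub>M\<^esub>"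
    define d where "d i = (if i = 0 then c0 else if i = 1 then c1 else if i = (2::nat) then c2 else \<zero>)" for i
    have d: "d i \<in> carrier R" for i using c by (simp add: d_def)
    have "(\<Oplus>\<^bsub>M\<^esub>i\<in>{..<r}. d i \<odot>\<^bsub>M\<^esub> b i) = (\<Oplus>\<^bsub>M\<^esub>i\<in>{0,1,2}. d i \<odot>\<^bsub>M\<^esub> b i)"
      by (rule M.add.finprod_mono_neutral_cong_right) (use assms(2) bs d in \<open>auto simp: d_def\<close>)
    also have "\<dots> = \<zero>\<^bsub>M\<^esub>"
      using c bs assms(2) by (simp add: d_def)
    finally have "(\<Oplus>\<^bsub>M\<^esub>i\<in>{..<r}. d i \<odot>\<^bsub>M\<^esub> b i) = \<zero>\<^bsub>M\<^esub>" .
    from indep[OF d this, of 0] indep[OF d this, of 1] indep[OF d this, of 2]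
    show "(\<exists>t\<in>S. t \<otimes> c0 = \<zero>) \<and> (\<exists>t\<in>S. t \<otimes> c1 = \<zero>) \<and> (\<exists>t\<in>S. t \<otimes> c2 = \<zero>)"
      using assms(2) by (simp add: d_def)
  qed
qed

text \<open>The preimage under \<open>x \<mapsto> x/1\<close>. Denominators may be dropped inside
  \<open>NL\<close>, because \<open>x/1\<close> is \<open>s\<close> times
  \<open>x/s\<close>.\<close>

lemma contraction_submodule:
  assumes NL: "submodule NL (localize_ring R S) L"
  shows "submodule {x \<in> carrier M. cls x \<one> \<in> NL} R M"
    and "\<And>x s. \<lbrakk>x \<in> carrier M; s \<in> S; cls x s \<in> NL\<rbrakk> \<Longrightarrow> cls x \<one> \<in> NL"
proof -
  have sm: "clsR a s \<odot>\<^bsub>L\<^esub> X \<in> NL" if "a \<in> carrier R" "s \<in> S" "X \<in> NL" for a s X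
    using submodule.smult_closed[OF NL clsR_in] that by auto
  have sg: "subgroup NL (add_monoid L)" by (rule submodule.axioms(1)[OF NL])
  show "submodule {x \<in> carrier M. cls x \<one> \<in> NL} R M"
  proof (rule submoduleI)
    show "\<zero>\<^bsub>M\<^esub> \<in> {x \<in> carrier M. cls x \<one> \<in> NL}"
      using subgroup.one_closed[OF sg] by (simp add: L_zero)
    have smM: "a \<odot>\<^bsub>M\<^esub> x \<in> {x \<in> carrier M. cls x \<one> \<in> NL}"
      if "a \<in> carrier R" "x \<in> {x \<in> carrier M. cls x \<one> \<in> NL}" for a x
      using that sm[of a \<one> "cls x \<one>"] by (simp add: L_smult)
    then show "a \<odot>\<^bsub>M\<^esub> x \<in> {x \<in> carrier M. cls x \<one> \<in> NL}"
      if "a \<in> carrier R" "x \<in> {x \<in> carrier M. cls x \<one> \<in> NL}" for a x using that .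
    show "\<ominus>\<^bsub>M\<^esub> x \<in> {x \<in> carrier M. cls x \<one> \<in> NL}" if "x \<in> {x \<in> carrier M. cls x \<one> \<in> NL}" for x
      using smM[of "\<ominus> \<one>" x] that by (simp add: smult_l_minus)
    show "x \<oplus>\<^bsub>M\<^esub> y \<in> {x \<in> carrier M. cls x \<one> \<in> NL}"
      if "x \<in> {x \<in> carrier M. cls x \<one> \<in> NL}" "y \<in> {x \<in> carrier M. cls x \<one> \<in> NL}" for x y
      using that subgroup.m_closed[OF sg, of "cls x \<one>" "cls y \<one>"] by (simp add: L_add1)
  qed auto
  fix x s assume x: "x \<in> carrier M" "s \<in> S" "cls x s \<in> NL"
  then show "cls x \<one> \<in> NL"
    using sm[of s \<one> "cls x s"] cls_cancel[of x s \<one>] by (simp add: L_smult)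
qed

text \<open>Restates splitness over the localization inside the module, each equation holding after
  multiplication by an element of \<open>S\<close>. The conclusions are the Lagrangian assumptions
  of \<open>orth_lagrangian\<close>.\<close>

lemma split_form_contraction:
  assumes B: "\<And>x y. \<lbrakk>x \<in> carrier M; y \<in> carrier M\<rbrakk> \<Longrightarrow> B x y \<in> carrier R"
      "\<And>a x y. \<lbrakk>a \<in> carrier R; x \<in> carrier M; y \<in> carrier M\<rbrakk> \<Longrightarrow> B (a \<odot>\<^bsub>M\<^esub> x) y = a \<otimes> B x y"
      "\<And>a x y. \<lbrakk>a \<in> carrier R; x \<in> carrier M; y \<in> carrier M\<rbrakk> \<Longrightarrow> B x (a \<odot>\<^bsub>M\<^esub> y) = a \<otimes> B x y"
    and split: "split_form (localize_ring R S) L (localize_form R M S B)"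
  obtains N N' where "submodule N R M" "submodule N' R M"
    "\<And>x y. \<lbrakk>x \<in> N; y \<in> N\<rbrakk> \<Longrightarrow> \<exists>t\<in>S. t \<otimes> B x y = \<zero>"
    "\<And>p. \<lbrakk>p \<in> carrier M; \<And>x. x \<in> N \<Longrightarrow> \<exists>t\<in>S. t \<otimes> B p x = \<zero>\<rbrakk> \<Longrightarrow> p \<in> N"
    "\<And>x. \<lbrakk>x \<in> N; x \<in> N'\<rbrakk> \<Longrightarrow> \<exists>t\<in>S. t \<odot>\<^bsub>M\<^esub> x = \<zero>\<^bsub>M\<^esub>"
    "\<And>p. p \<in> carrier M \<Longrightarrow> \<exists>t\<in>S. \<exists>a\<in>N. \<exists>b\<in>N'. t \<odot>\<^bsub>M\<^esub> p = a \<oplus>\<^bsub>M\<^esub> b"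
proof -
  let ?RL = "localize_ring R S" and ?BL = "localize_form R M S B"
  obtain NL where NL0: "direct_summand ?RL L NL \<and> NL = orth_compl L ?BL \<zero>\<^bsub>?RL\<^esub> NL"
    using split unfolding split_form_def by (rule exE)
  then have NL1: "submodule NL ?RL L" and perp: "NL = orth_compl L ?BL \<zero>\<^bsub>?RL\<^esub> NL"
    by (simp_all only: direct_summand_def)
  obtain NL' where NL2: "submodule NL' ?RL L \<and> NL \<inter> NL' = {\<zero>\<^bsub>L\<^esub>} \<and>
      (\<forall>m\<in>carrier L. \<exists>a\<in>NL. \<exists>b\<in>NL'. m = a \<oplus>\<^bsub>L\<^esub> b)"
    using conjunct2[OF conjunct1[OF NL0, unfolded direct_summand_def]] by (rule exE)
  then have NL: "submodule NL ?RL L" "submodule NL' ?RL L" "NL \<inter> NL' = {\<zero>\<^bsub>L\<^esub>}"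
    using NL1 by simp_all
  have sum: "\<exists>a\<in>NL. \<exists>b\<in>NL'. m = a \<oplus>\<^bsub>L\<^esub> b" if "m \<in> carrier L" for m
    using conjunct2[OF conjunct2[OF NL2]] that by (rule bspec)
  have sub: "NL \<subseteq> carrier L" "NL' \<subseteq> carrier L"
    using subgroup.subset[OF submodule.axioms(1)[OF NL(1)]] subgroup.subset[OF submodule.axioms(1)[OF NL(2)]] by auto
  have NLI: "X \<in> NL" if "X \<in> carrier L" "\<And>Y. Y \<in> NL \<Longrightarrow> ?BL X Y = \<zero>\<^bsub>?RL\<^esub>" for X
    using that by (subst perp) (auto simp: orth_compl_def)
  have NLD: "?BL X Y = \<zero>\<^bsub>?RL\<^esub>" if "X \<in> NL" "Y \<in> NL" for X Y
    using that(1) that(2) by (subst (asm) perp) (auto simp: orth_compl_def)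
  note form = L_form[of B, OF B]
  show ?thesis
  proof (rule that[OF contraction_submodule(1)[OF NL(1)] contraction_submodule(1)[OF NL(2)]])
    fix x y assume "x \<in> {x \<in> carrier M. cls x \<one> \<in> NL}" "y \<in> {x \<in> carrier M. cls x \<one> \<in> NL}"
    then show "\<exists>t\<in>S. t \<otimes> B x y = \<zero>"
      using NLD[of "cls x \<one>" "cls y \<one>"] clsR_zero_iff[of "B x y" \<one>] by (simp add: form B)
  next
    fix p assume p: "p \<in> carrier M" "\<And>x. x \<in> {x \<in> carrier M. cls x \<one> \<in> NL} \<Longrightarrow> \<exists>t\<in>S. t \<otimes> B p x = \<zero>"
    have "cls p \<one> \<in> NL"
    proof (rule NLI)
      fix Y assume Y: "Y \<in> NL"
      then obtain y s where y: "Y = cls y s" "y \<in> carrier M" "s \<in> S" using sub L_cases by blast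
      then have "cls y \<one> \<in> NL" using contraction_submodule(2)[OF NL(1)] Y by simp
      then show "?BL (cls p \<one>) Y = \<zero>\<^bsub>?RL\<^esub>"
        using p(1) p(2)[of y] y clsR_zero_iff[of "B p y" s] by (simp add: form B)
    qed (use p in simp)
    then show "p \<in> {x \<in> carrier M. cls x \<one> \<in> NL}" using p by simp
  next
    fix x assume x: "x \<in> {x \<in> carrier M. cls x \<one> \<in> NL}" "x \<in> {x \<in> carrier M. cls x \<one> \<in> NL'}"
    then have "cls x \<one> = cls \<zero>\<^bsub>M\<^esub> \<one>" using NL(3) by (auto simp: L_zero)
    then show "\<exists>t\<in>S. t \<odot>\<^bsub>M\<^esub> x = \<zero>\<^bsub>M\<^esub>" using x cls_zero_iff[of x \<one>] by simp
  next
    fix p assume p: "p \<in> carrier M"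
    obtain A D where AD: "A \<in> NL" "D \<in> NL'" "cls p \<one> = A \<oplus>\<^bsub>L\<^esub> D" using sum[of "cls p \<one>"] p by auto
    obtain a s where a: "A = cls a s" "a \<in> carrier M" "s \<in> S" using sub AD L_cases by blast
    obtain d t where d: "D = cls d t" "d \<in> carrier M" "t \<in> S" using sub AD L_cases by blast
    have "cls p \<one> = cls (t \<odot>\<^bsub>M\<^esub> a \<oplus>\<^bsub>M\<^esub> s \<odot>\<^bsub>M\<^esub> d) (s \<otimes> t)"
      using AD(3) a d by (simp add: L_add)
    then obtain u where u: "u \<in> S" "(u \<otimes> (s \<otimes> t)) \<odot>\<^bsub>M\<^esub> p = (u \<otimes> \<one>) \<odot>\<^bsub>M\<^esub> (t \<odot>\<^bsub>M\<^esub> a \<oplus>\<^bsub>M\<^esub> s \<odot>\<^bsub>M\<^esub> d)"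
      using a d p cls_eq_iff[of p \<one> "t \<odot>\<^bsub>M\<^esub> a \<oplus>\<^bsub>M\<^esub> s \<odot>\<^bsub>M\<^esub> d" "s \<otimes> t"] by (auto simp: frac_eq_def)
    have "(u \<otimes> (s \<otimes> t)) \<odot>\<^bsub>M\<^esub> p = (u \<otimes> t) \<odot>\<^bsub>M\<^esub> a \<oplus>\<^bsub>M\<^esub> (u \<otimes> s) \<odot>\<^bsub>M\<^esub> d"
      using u a d by (simp add: smult_r_distr smult_assoc1)
    moreover have "(u \<otimes> t) \<odot>\<^bsub>M\<^esub> a \<in> {x \<in> carrier M. cls x \<one> \<in> NL}"
      using submodule.smult_closed[OF contraction_submodule(1)[OF NL(1)], of "u \<otimes> t" a]
        contraction_submodule(2)[OF NL(1), of a s] AD a d u by simp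
    moreover have "(u \<otimes> s) \<odot>\<^bsub>M\<^esub> d \<in> {x \<in> carrier M. cls x \<one> \<in> NL'}"
      using submodule.smult_closed[OF contraction_submodule(1)[OF NL(2)], of "u \<otimes> s" d]
        contraction_submodule(2)[OF NL(2), of d t] AD a d u by simp
    ultimately show "\<exists>t\<in>S. \<exists>a\<in>{x \<in> carrier M. cls x \<one> \<in> NL}. \<exists>b\<in>{x \<in> carrier M. cls x \<one> \<in> NL'}. t \<odot>\<^bsub>M\<^esub> p = a \<oplus>\<^bsub>M\<^esub> b"
      using u a d by (intro bexI[of _ "u \<otimes> (s \<otimes> t)"] bexI[of _ "(u \<otimes> t) \<odot>\<^bsub>M\<^esub> a"] bexI[of _ "(u \<otimes> s) \<odot>\<^bsub>M\<^esub> d"]) simp_all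
  qed
qed

end

section \<open>The ideal submodule and planes at a maximal ideal\<close>

text \<open>Concatenation of sums; it shows that the explicit finite sums in
  \<open>ideal_submod\<close> are closed under addition.\<close>

lemma (in module) finsum_append:
  assumes "\<And>i. i < k \<Longrightarrow> f i \<in> carrier M" "\<And>i. i < l \<Longrightarrow> g i \<in> carrier M"
  shows "(\<Oplus>\<^bsub>M\<^esub>j\<in>{..<k+l::nat}. if j < k then f j else g (j - k)) = (\<Oplus>\<^bsub>M\<^esub>j\<in>{..<k}. f j) \<oplus>\<^bsub>M\<^esub> (\<Oplus>\<^bsub>M\<^esub>j\<in>{..<l}. g j)"
  using assms(2)
proof (induction l)
  case 0
  have "(\<Oplus>\<^bsub>M\<^esub>j\<in>{..<k}. if j < k then f j else g (j - k)) = (\<Oplus>\<^bsub>M\<^esub>j\<in>{..<k}. f j)"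
    by (rule M.finsum_cong') (use assms(1) in auto)
  moreover have "(\<Oplus>\<^bsub>M\<^esub>j\<in>{..<k}. f j) \<in> carrier M" using assms(1) by (intro M.finsum_closed) auto
  ultimately show ?case by simp
next
  case (Suc l)
  have c: "(\<Oplus>\<^bsub>M\<^esub>j\<in>{..<k}. f j) \<in> carrier M" "(\<Oplus>\<^bsub>M\<^esub>j\<in>{..<l}. g j) \<in> carrier M"
    using assms(1) Suc.prems by (auto intro!: M.finsum_closed)
  have "(\<Oplus>\<^bsub>M\<^esub>j\<in>{..<k + Suc l}. if j < k then f j else g (j - k)) =
     g l \<oplus>\<^bsub>M\<^esub> (\<Oplus>\<^bsub>M\<^esub>j\<in>{..<k + l}. if j < k then f j else g (j - k))"
    unfolding add_Suc_right lessThan_Suc using assms(1) Suc.prems by (subst M.finsum_insert) auto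
  moreover have "(\<Oplus>\<^bsub>M\<^esub>j\<in>{..<Suc l}. g j) = g l \<oplus>\<^bsub>M\<^esub> (\<Oplus>\<^bsub>M\<^esub>j\<in>{..<l}. g j)"
    unfolding lessThan_Suc using Suc.prems by (intro M.finsum_insert) auto
  ultimately show ?case
    using Suc c by (simp add: M.a_lcomm)
qed

context orth_space begin

lemma ideal_gen_ideal_submod:
  assumes I: "ideal I R"
  shows "ideal_gen I (ideal_submod M I)"
proof -
  interpret I: ideal I R by fact
  have "\<alpha> \<odot>\<^bsub>M\<^esub> x \<in> ideal_submod M I" if "\<alpha> \<in> I" "x \<in> carrier M" for \<alpha> x
  proof -
    have "(\<Oplus>\<^bsub>M\<^esub>j\<in>{..<1::nat}. \<alpha> \<odot>\<^bsub>M\<^esub> x) = \<alpha> \<odot>\<^bsub>M\<^esub> x"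
      using that I.Icarr[of \<alpha>] by (simp add: lessThan_Suc)
    then show ?thesis using that unfolding ideal_submod_def
      by (intro CollectI exI[of _ 1] exI[of _ "\<lambda>_. \<alpha>"] exI[of _ "\<lambda>_. x"]) simp
  qed
  moreover have "ideal_submod M I \<subseteq> X"
    if X: "\<zero>\<^bsub>M\<^esub> \<in> X" "\<forall>\<alpha>\<in>I. \<forall>x\<in>carrier M. \<alpha> \<odot>\<^bsub>M\<^esub> x \<in> X" "\<forall>x\<in>X. \<forall>y\<in>X. x \<oplus>\<^bsub>M\<^esub> y \<in> X" for X
  proof
    fix y assume "y \<in> ideal_submod M I"
    then obtain k :: nat and a x where y: "y = finsum M (\<lambda>j. a j \<odot>\<^bsub>M\<^esub> x j) {..<k}" "\<forall>j<k. a j \<in> I \<and> x j \<in> carrier M"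
      unfolding ideal_submod_def by auto
    have "finsum M (\<lambda>j. a j \<odot>\<^bsub>M\<^esub> x j) {..<k} \<in> X" using y(2)
    proof (induction k)
      case 0 then show ?case using X by simp
    next
      case (Suc k)
      have "finsum M (\<lambda>j. a j \<odot>\<^bsub>M\<^esub> x j) {..<Suc k} = a k \<odot>\<^bsub>M\<^esub> x k \<oplus>\<^bsub>M\<^esub> finsum M (\<lambda>j. a j \<odot>\<^bsub>M\<^esub> x j) {..<k}"
        unfolding lessThan_Suc using Suc.prems I.Icarr by (intro M.finsum_insert) auto
      then show ?case using Suc X by auto
    qed
    then show "y \<in> X" using y by simp
  qed
  ultimately show ?thesis
    unfolding ideal_gen_def using I.Icarr I.I_l_closed by auto
qed

text \<open>For \<open>x\<close> in \<open>IM\<close> the values \<open>B x y\<close> lie in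
  \<open>I\<close>; this is behind the second claim, which is the absorption condition of
  \<open>rel_triple\<close>.\<close>

lemma ideal_submod_closed:
  assumes I: "ideal I R"
  shows "submodule (ideal_submod M I) R M"
    and "\<And>x y z. \<lbrakk>x \<in> ideal_submod M I; y \<in> carrier M; z \<in> carrier M\<rbrakk> \<Longrightarrow> B x y \<odot>\<^bsub>M\<^esub> z \<in> ideal_submod M I"
proof -
  interpret I: ideal I R by fact
  let ?N = "ideal_submod M I"
  note gen = ideal_gen_ideal_submod[OF I]
  have zero: "\<zero>\<^bsub>M\<^esub> \<in> ?N"
    unfolding ideal_submod_def by (intro CollectI exI[of _ 0]) simp
  have add: "x \<oplus>\<^bsub>M\<^esub> y \<in> ?N" if xy: "x \<in> ?N" "y \<in> ?N" for x y
  proof -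
    obtain k :: nat and a u where x: "x = finsum M (\<lambda>j. a j \<odot>\<^bsub>M\<^esub> u j) {..<k}" "\<forall>j<k. a j \<in> I \<and> u j \<in> carrier M"
      using xy(1) unfolding ideal_submod_def by auto
    obtain l :: nat and b v where y: "y = finsum M (\<lambda>j. b j \<odot>\<^bsub>M\<^esub> v j) {..<l}" "\<forall>j<l. b j \<in> I \<and> v j \<in> carrier M"
      using xy(2) unfolding ideal_submod_def by auto
    have "x \<oplus>\<^bsub>M\<^esub> y = (\<Oplus>\<^bsub>M\<^esub>j\<in>{..<k+l}. if j < k then a j \<odot>\<^bsub>M\<^esub> u j else b (j - k) \<odot>\<^bsub>M\<^esub> v (j - k))"
      unfolding x(1) y(1) using x(2) y(2) I.Icarr by (intro finsum_append[symmetric]) auto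
    also have "\<dots> = (\<Oplus>\<^bsub>M\<^esub>j\<in>{..<k+l}. (if j < k then a j else b (j - k)) \<odot>\<^bsub>M\<^esub> (if j < k then u j else v (j - k)))"
      by (rule M.finsum_cong') (use x(2) y(2) I.Icarr in auto)
    finally show ?thesis
      unfolding ideal_submod_def using x(2) y(2)
      by (intro CollectI exI[of _ "k + l"] exI[of _ "\<lambda>j. if j < k then a j else b (j - k)"]
          exI[of _ "\<lambda>j. if j < k then u j else v (j - k)"]) auto
  qed
  have carr: "x \<in> carrier M" if "x \<in> ?N" for x
    using gen that by (induction rule: ideal_gen_induct) (auto simp: I.Icarr)
  have smult: "x \<in> carrier M \<and> r \<odot>\<^bsub>M\<^esub> x \<in> ?N" if "x \<in> ?N" "r \<in> carrier R" for x r
    using gen that(1)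
  proof (induction rule: ideal_gen_induct)
    case zero
    then show ?case using \<open>\<zero>\<^bsub>M\<^esub> \<in> ?N\<close> that by simp
  next
    case (smult \<alpha> x)
    then show ?case
      using ideal_genD[OF gen] that by (simp add: smult_assoc1[symmetric] I.I_l_closed)
  next
    case (add x y)
    then show ?case using \<open>\<And>x y. x \<in> ?N \<Longrightarrow> y \<in> ?N \<Longrightarrow> x \<oplus>\<^bsub>M\<^esub> y \<in> ?N\<close> that by (simp add: smult_r_distr)
  qed
  show "submodule ?N R M"
  proof (rule submoduleI)
    show "\<ominus>\<^bsub>M\<^esub> x \<in> ?N" if "x \<in> ?N" for x
      using smult[OF that, of "\<ominus> \<one>"] carr[OF that] by (simp add: smult_l_minus)
  qed (use carr zero add smult in auto)
  fix x y z assume x: "x \<in> ?N" and yz: "y \<in> carrier M" "z \<in> carrier M"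
  have "x \<in> carrier M \<and> B x y \<odot>\<^bsub>M\<^esub> z \<in> ?N"
    using gen x
  proof (induction rule: ideal_gen_induct)
    case zero
    then show ?case using \<open>\<zero>\<^bsub>M\<^esub> \<in> ?N\<close> yz by simp
  next
    case (smult \<alpha> x)
    then show ?case
      using ideal_genD[OF gen smult(1)] yz by (simp add: smult_assoc1)
  next
    case (add x y)
    then show ?case using \<open>\<And>x y. x \<in> ?N \<Longrightarrow> y \<in> ?N \<Longrightarrow> x \<oplus>\<^bsub>M\<^esub> y \<in> ?N\<close> yz by (simp add: smult_l_distr)
  qed
  then show "B x y \<odot>\<^bsub>M\<^esub> z \<in> ?N" by simp
qed

lemma Iso_add:
  assumes "g \<in> Iso" "x \<in> carrier M" "y \<in> carrier M"
  shows "g (x \<oplus>\<^bsub>M\<^esub> y) = g x \<oplus>\<^bsub>M\<^esub> g y"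
  by (rule Iso_sep[OF assms(1)]) (use assms in \<open>simp_all add: IsoD\<close>)

lemma Iso_ideal_submod:
  assumes I: "ideal I R" and g: "g \<in> Iso" and x: "x \<in> ideal_submod M I"
  shows "g x \<in> ideal_submod M I"
proof -
  note gen = ideal_gen_ideal_submod[OF I]
  have "x \<in> carrier M \<and> g x \<in> ideal_submod M I"
    using gen x
  proof (induction rule: ideal_gen_induct)
    case zero
    have "g \<zero>\<^bsub>M\<^esub> = \<zero>\<^bsub>M\<^esub>" using Iso_smult[OF g M.zero_closed R.zero_closed] g by simp
    then show ?case
      using subgroup.one_closed[OF submodule.axioms(1)[OF ideal_submod_closed(1)[OF I]]] by simp
  next
    case (smult \<alpha> x)
    then show ?case using ideal_genD[OF gen smult(1)] g by (simp add: Iso_smult)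
  next
    case (add x y)
    then show ?case using submoduleE(5)[OF ideal_submod_closed(1)[OF I]] g by (simp add: Iso_add)
  qed
  then show ?thesis by simp
qed

end

text \<open>Conjugation is a homomorphism, so generators suffice, and their conjugates may be any
  elements of the generated group. It gives the stability under elementary conjugation of both
  groups in the theorem.\<close>

lemma (in group) conj_generate:
  assumes "A \<subseteq> carrier G" "k \<in> carrier G" "\<And>a. a \<in> A \<Longrightarrow> k \<otimes> a \<otimes> inv k \<in> generate G A" "x \<in> generate G A"
  shows "k \<otimes> x \<otimes> inv k \<in> generate G A"
  using assms(4)
proof (induction rule: generate.induct)
  case one
  then show ?case using assms(2) by (simp add: generate.one)
next
  case (incl a)
  then show ?case using assms(3) by simp
next
  case (inv a)
  then have "inv (k \<otimes> a \<otimes> inv k) = k \<otimes> inv a \<otimes> inv k"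
    using assms(1,2) by (auto simp: inv_mult_group m_assoc)
  then show ?case using generate_m_inv_closed[OF assms(1) assms(3)[OF inv]] by simp
next
  case (eng a b)
  have "a \<in> carrier G" "b \<in> carrier G" using eng generate_in_carrier[OF assms(1)] by auto
  then have "k \<otimes> (a \<otimes> b) \<otimes> inv k = (k \<otimes> a \<otimes> inv k) \<otimes> (k \<otimes> b \<otimes> inv k)"
    using assms(2) by (simp add: m_assoc m_assoc[symmetric, of "inv k" k])
  then show ?case using generate.eng[OF eng.IH] by simp
qed

text \<open>Separation is the uniqueness half of nondegeneracy: two vectors with the same pairings
  represent the same functional.\<close>

lemma orth_space_orthogonal_module:
  assumes "cring R" "\<one>\<^bsub>R\<^esub> \<oplus>\<^bsub>R\<^esub> \<one>\<^bsub>R\<^esub> \<in> Units R" and "orthogonal_module_rank R P B r"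
  shows "orth_space R P B (inv\<^bsub>R\<^esub> (\<one>\<^bsub>R\<^esub> \<oplus>\<^bsub>R\<^esub> \<one>\<^bsub>R\<^esub>))"
proof -
  interpret module R P using assms(3) by (simp add: orthogonal_module_rank_def)
  have sb: "symmetric_bilinear R P B" and nd: "nondegenerate R P B"
    using assms(3) by (simp_all add: orthogonal_module_rank_def)
  have sym: "B x y = B y x" if "x \<in> carrier P" "y \<in> carrier P" for x y
    using sb that by (simp add: symmetric_bilinear_def)
  have lin: "lin_functional R P (\<lambda>x. B x y)" if "y \<in> carrier P" for y
    using sb that by (simp add: symmetric_bilinear_def)
  let ?h = "inv\<^bsub>R\<^esub> (\<one>\<^bsub>R\<^esub> \<oplus>\<^bsub>R\<^esub> \<one>\<^bsub>R\<^esub>)"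
  have h: "?h \<in> carrier R" "?h \<oplus>\<^bsub>R\<^esub> ?h = \<one>\<^bsub>R\<^esub>"
  proof -
    show "?h \<in> carrier R" using assms(2) by simp
    then have "?h \<oplus>\<^bsub>R\<^esub> ?h = ?h \<otimes>\<^bsub>R\<^esub> (\<one>\<^bsub>R\<^esub> \<oplus>\<^bsub>R\<^esub> \<one>\<^bsub>R\<^esub>)" by (simp add: R.r_distr)
    then show "?h \<oplus>\<^bsub>R\<^esub> ?h = \<one>\<^bsub>R\<^esub>" using assms(2) by simp
  qed
  show ?thesis
  proof (intro orth_space.intro orth_space_axioms.intro)
    fix x y z assume c: "x \<in> carrier P" "y \<in> carrier P"
    show "B x y \<in> carrier R" using lin[OF c(2)] c by (auto simp: lin_functional_def)
    show "B x y = B y x" using sym c by simp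
    show "z \<in> carrier P \<Longrightarrow> B (x \<oplus>\<^bsub>P\<^esub> y) z = B x z \<oplus>\<^bsub>R\<^esub> B y z"
      using lin[of z] c by (auto simp: lin_functional_def)
    assume eq: "\<And>z. z \<in> carrier P \<Longrightarrow> B x z = B y z"
    have "\<exists>!p. p \<in> carrier P \<and> (\<forall>z\<in>carrier P. B p z = B z x)"
      using nd lin[OF c(1)] unfolding nondegenerate_def by (elim allE impE)
    moreover have "\<forall>z\<in>carrier P. B x z = B z x" "\<forall>z\<in>carrier P. B y z = B z x"
      using c sym eq by auto
    ultimately show "x = y" using c by (elim ex1E) metis
  next
    fix a x y assume c: "a \<in> carrier R" "x \<in> carrier P" "y \<in> carrier P"
    show "B (a \<odot>\<^bsub>P\<^esub> x) y = a \<otimes>\<^bsub>R\<^esub> B x y" using lin[of y] c by (auto simp: lin_functional_def)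
  qed (use h module_axioms in auto)
qed

text \<open>The rank supplies three independent vectors, splitness the Lagrangian, and projectivity
  a dual basis, whose functionals are represented by vectors because the form is
  nondegenerate.\<close>

lemma planes_at_maximal:
  fixes R :: "'a ring" and P :: "('a, 'b) module"
  assumes os: "orth_space R P B h" and orth: "orthogonal_module_rank R P B r" "3 \<le> r"
    and split: "locally_split R P B" and m: "maximalideal \<mm> R"
  shows "\<exists>e1\<in>carrier P. \<exists>f1\<in>carrier P. \<exists>e2\<in>carrier P. \<exists>f2\<in>carrier P.
     B e1 e1 = \<zero>\<^bsub>R\<^esub> \<and> B f1 f1 = \<zero>\<^bsub>R\<^esub> \<and> B e2 e2 = \<zero>\<^bsub>R\<^esub> \<and> B f2 f2 = \<zero>\<^bsub>R\<^esub> \<and>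
     B e1 e2 = \<zero>\<^bsub>R\<^esub> \<and> B e1 f2 = \<zero>\<^bsub>R\<^esub> \<and> B f1 e2 = \<zero>\<^bsub>R\<^esub> \<and> B f1 f2 = \<zero>\<^bsub>R\<^esub> \<and> B e1 f1 \<notin> \<mm> \<and> B e2 f2 \<notin> \<mm>"
proof -
  interpret orth_local R P B h \<mm>
    using os m by (simp add: orth_local_def orth_local_axioms_def)
  have Seq: "S = carrier R - \<mm>" by (rule S_def)
  interpret loc: localization R P S
  proof (intro localization.intro localization_axioms.intro)
    show "module R P" by (rule module_axioms)
    show "S \<subseteq> carrier R" by (auto simp: S_def)
    show "\<one>\<^bsub>R\<^esub> \<in> S" by (rule S_one)
    show "s \<otimes>\<^bsub>R\<^esub> t \<in> S" if "s \<in> S" "t \<in> S" for s t using that by (rule S_mult)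
  qed
  have prime: "primeideal \<mm> R" by (rule R.maximalideal_prime[OF m])
  have "free_of_rank (localize_ring R S) (localize_mod R P S) r"
    using orth(1) prime unfolding orthogonal_module_rank_def const_rank_def Seq by blast
  then obtain b0 b1 b2 where b: "b0 \<in> carrier P" "b1 \<in> carrier P" "b2 \<in> carrier P"
    and indep: "\<And>c0 c1 c2. \<lbrakk>c0 \<in> carrier R; c1 \<in> carrier R; c2 \<in> carrier R;
      c0 \<odot>\<^bsub>P\<^esub> b0 \<oplus>\<^bsub>P\<^esub> (c1 \<odot>\<^bsub>P\<^esub> b1 \<oplus>\<^bsub>P\<^esub> c2 \<odot>\<^bsub>P\<^esub> b2) = \<zero>\<^bsub>P\<^esub>\<rbrakk> \<Longrightarrow>
      (\<exists>t\<in>S. t \<otimes>\<^bsub>R\<^esub> c0 = \<zero>\<^bsub>R\<^esub>) \<and> (\<exists>t\<in>S. t \<otimes>\<^bsub>R\<^esub> c1 = \<zero>\<^bsub>R\<^esub>) \<and> (\<exists>t\<in>S. t \<otimes>\<^bsub>R\<^esub> c2 = \<zero>\<^bsub>R\<^esub>)"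
    by (rule loc.free_three_independent[OF _ orth(2)]) (rule that)
  have split': "split_form (localize_ring R S) (localize_mod R P S) (localize_form R P S B)"
    using split m unfolding locally_split_def Seq by simp
  show ?thesis
  proof (rule loc.split_form_contraction[where B=B])
    show "split_form (localize_ring R S) (localize_mod R P S) (localize_form R P S B)" by (rule split')
  next
    fix N N' assume N: "submodule N R P" "submodule N' R P"
    "\<And>x y. \<lbrakk>x \<in> N; y \<in> N\<rbrakk> \<Longrightarrow> \<exists>t\<in>S. t \<otimes>\<^bsub>R\<^esub> B x y = \<zero>\<^bsub>R\<^esub>"
    "\<And>p. \<lbrakk>p \<in> carrier P; \<And>x. x \<in> N \<Longrightarrow> \<exists>t\<in>S. t \<otimes>\<^bsub>R\<^esub> B p x = \<zero>\<^bsub>R\<^esub>\<rbrakk> \<Longrightarrow> p \<in> N"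
    "\<And>x. \<lbrakk>x \<in> N; x \<in> N'\<rbrakk> \<Longrightarrow> \<exists>t\<in>S. t \<odot>\<^bsub>P\<^esub> x = \<zero>\<^bsub>P\<^esub>"
    "\<And>p. p \<in> carrier P \<Longrightarrow> \<exists>t\<in>S. \<exists>a\<in>N. \<exists>b\<in>N'. t \<odot>\<^bsub>P\<^esub> p = a \<oplus>\<^bsub>P\<^esub> b"
  have Nc: "x \<in> carrier P" if "x \<in> N" for x using that submoduleE(1)[OF N(1)] by auto
  have fg: "fg_projective R P" and nd: "nondegenerate R P B"
    using orth(1) by (simp_all add: orthogonal_module_rank_def)
  obtain k :: nat and x \<phi> where x: "\<forall>i<k. x i \<in> carrier P \<and> lin_functional R P (\<phi> i)"
    and dual: "\<forall>m\<in>carrier P. m = finsum P (\<lambda>i. \<phi> i m \<odot>\<^bsub>P\<^esub> x i) {..<k}"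
    using fg unfolding fg_projective_def by (elim exE conjE)
  have "\<exists>p. p \<in> carrier P \<and> (\<forall>z\<in>carrier P. B p z = \<phi> i z)" if "i < k" for i
    using nd x that unfolding nondegenerate_def by (meson ex1_implies_ex)
  then obtain p where p: "\<And>i. i < k \<Longrightarrow> p i \<in> carrier P \<and> (\<forall>z\<in>carrier P. B (p i) z = \<phi> i z)"
    by metis
  have dual': "m = lc (\<lambda>i. B (p i) m) x k" if m: "m \<in> carrier P" for m
  proof -
    have "m = finsum P (\<lambda>i. \<phi> i m \<odot>\<^bsub>P\<^esub> x i) {..<k}" using dual m by simp
    also have "\<dots> = lc (\<lambda>i. B (p i) m) x k"
    proof -
      have "\<phi> i m = B (p i) m" "p i \<in> carrier P" "x i \<in> carrier P" if "i < k" for i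
        using p[OF that] x that m by simp_all
      then show ?thesis
        unfolding lc_def using m by (intro M.finsum_cong') auto
    qed
    finally show ?thesis .
  qed
  interpret orth_lagrangian R P B h \<mm> N N' k x p
  proof (intro orth_lagrangian.intro orth_lagrangian_axioms.intro)
    show "orth_local R P B h \<mm>" by (rule orth_local_axioms)
    show "nulR (B x y)" if "x \<in> N" "y \<in> N" for x y
      using N(3)[OF that] Nc that by (auto simp: nulR_def)
    show "q \<in> N" if "q \<in> carrier P" "\<And>x. x \<in> N \<Longrightarrow> nulR (B q x)" for q
      using N(4)[OF that(1)] that(2) by (auto simp: nulR_def)
    show "nul x" if "x \<in> N" "x \<in> N'" for x
      using N(5)[OF that] Nc that by (auto simp: nul_def)
  qed (use N x p dual' in auto)
  show ?thesis
  proof (rule two_orthogonal_planes[OF b])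
    fix c0 c1 c2 assume c: "c0 \<in> carrier R" "c1 \<in> carrier R" "c2 \<in> carrier R"
      "c0 \<odot>\<^bsub>P\<^esub> b0 \<oplus>\<^bsub>P\<^esub> (c1 \<odot>\<^bsub>P\<^esub> b1 \<oplus>\<^bsub>P\<^esub> c2 \<odot>\<^bsub>P\<^esub> b2) = \<zero>\<^bsub>P\<^esub>"
    then show "nulR c0 \<and> nulR c1 \<and> nulR c2" using indep[OF c] by (simp add: nulR_def)
  qed
  qed simp_all
qed

section \<open>The hyperbolic sum\<close>

locale hyperbolic_sum = orth_space R P B h
  for R (structure) and P :: "('a, 'b) module" (structure) and B h
begin

abbreviation "Q \<equiv> hyp_sum R P"
abbreviation "BQ \<equiv> hyp_form R B"

lemma Q_carrier: "(a, b, p) \<in> carrier Q \<longleftrightarrow> a \<in> carrier R \<and> b \<in> carrier R \<and> p \<in> carrier P"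
  and Q_zero: "\<zero>\<^bsub>Q\<^esub> = (\<zero>, \<zero>, \<zero>\<^bsub>P\<^esub>)"
  and Q_add: "(a, b, p) \<oplus>\<^bsub>Q\<^esub> (a', b', p') = (a \<oplus> a', b \<oplus> b', p \<oplus>\<^bsub>P\<^esub> p')"
  and Q_smult: "r \<odot>\<^bsub>Q\<^esub> (a, b, p) = (r \<otimes> a, r \<otimes> b, r \<odot>\<^bsub>P\<^esub> p)"
  and Q_form: "BQ (a, b, p) (a', b', p') = a \<otimes> b' \<oplus> a' \<otimes> b \<oplus> B p p'"
  by (simp_all add: hyp_sum_def hyp_form_def)

lemmas Q_simps = Q_carrier Q_zero Q_add Q_smult Q_form

lemma Q_cases:
  assumes "x \<in> carrier Q"
  obtains a b p where "x = (a, b, p)" "a \<in> carrier R" "b \<in> carrier R" "p \<in> carrier P"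
  using assms by (auto simp: hyp_sum_def)

lemma Q_module: "module R Q"
proof (rule moduleI)
  show "cring R" by (rule R.is_cring)
  show "abelian_group Q"
  proof (rule abelian_groupI)
    show "\<exists>y\<in>carrier Q. y \<oplus>\<^bsub>Q\<^esub> x = \<zero>\<^bsub>Q\<^esub>" if "x \<in> carrier Q" for x
    proof -
      obtain a b p where x: "x = (a, b, p)" "a \<in> carrier R" "b \<in> carrier R" "p \<in> carrier P"
        using \<open>x \<in> carrier Q\<close> by (rule Q_cases)
      then show ?thesis
        by (intro bexI[of _ "(\<ominus> a, \<ominus> b, \<ominus>\<^bsub>P\<^esub> p)"]) (simp_all add: Q_simps R.l_neg M.l_neg)
    qed
  qed (auto elim!: Q_cases simp: Q_simps R.a_ac M.a_ac)
qed (auto elim!: Q_cases simp: Q_simps R.l_distr R.r_distr R.m_assoc smult_l_distr smult_r_distr smult_assoc1)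

lemma Q_orth_space: "orth_space R Q BQ h"
proof (intro orth_space.intro orth_space_axioms.intro)
  show "module R Q" by (rule Q_module)
  show "BQ x y \<in> carrier R" if "x \<in> carrier Q" "y \<in> carrier Q" for x y
    using that by (elim Q_cases) (simp add: Q_simps)
  show "BQ x y = BQ y x" if "x \<in> carrier Q" "y \<in> carrier Q" for x y
    using that by (elim Q_cases) (simp add: Q_simps B_sym R.a_comm R.m_comm)
  show "BQ (x \<oplus>\<^bsub>Q\<^esub> y) z = BQ x z \<oplus> BQ y z" if "x \<in> carrier Q" "y \<in> carrier Q" "z \<in> carrier Q" for x y z
    using that by (elim Q_cases) (simp add: Q_simps R.l_distr R.r_distr R.a_ac)
  show "BQ (r \<odot>\<^bsub>Q\<^esub> x) y = r \<otimes> BQ x y" if "r \<in> carrier R" "x \<in> carrier Q" "y \<in> carrier Q" for r x y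
    using that by (elim Q_cases) (simp add: Q_simps R.r_distr R.m_ac)
  fix x y assume xy: "x \<in> carrier Q" "y \<in> carrier Q" and eq: "\<And>z. z \<in> carrier Q \<Longrightarrow> BQ x z = BQ y z"
  obtain a b p where x: "x = (a, b, p)" "a \<in> carrier R" "b \<in> carrier R" "p \<in> carrier P"
    using xy(1) by (rule Q_cases)
  obtain a' b' p' where y: "y = (a', b', p')" "a' \<in> carrier R" "b' \<in> carrier R" "p' \<in> carrier P"
    using xy(2) by (rule Q_cases)
  have "B p z = B p' z" if "z \<in> carrier P" for z
    using eq[of "(\<zero>, \<zero>, z)"] x y that by (simp add: Q_simps)
  then have "p = p'" using x y by (intro B_sep) auto
  moreover have "a = a'" "b = b'"
    using eq[of "(\<zero>, \<one>, \<zero>\<^bsub>P\<^esub>)"] eq[of "(\<one>, \<zero>, \<zero>\<^bsub>P\<^esub>)"] x y by (simp_all add: Q_simps)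
  ultimately show "x = y" using x y by simp
qed (simp_all add: half)

sublocale Q: orth_space R Q BQ h by (rule Q_orth_space)

section \<open>The standard hyperbolic pair and the elementary generators\<close>

definition "e0 = (\<one>, \<zero>, \<zero>\<^bsub>P\<^esub>)"
definition "f0 = (\<zero>, \<one>, \<zero>\<^bsub>P\<^esub>)"
definition "emb p = (\<zero>, \<zero>, p)"

lemma ef0_hyp_pair: "Q.hyp_pair e0 f0"
  by (simp add: Q.hyp_pair_def e0_def f0_def Q_simps)

lemma ef0_closed: "e0 \<in> carrier Q" "f0 \<in> carrier Q"
  using ef0_hyp_pair by (auto simp: Q.hyp_pair_def)

lemma perp_ef0: "Q.perp e0 f0 = emb ` carrier P"
proof -
  have "x \<in> Q.perp e0 f0 \<longleftrightarrow> x \<in> emb ` carrier P" for x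
  proof (cases "x \<in> carrier Q")
    case True
    then obtain a b p where x: "x = (a, b, p)" "a \<in> carrier R" "b \<in> carrier R" "p \<in> carrier P"
      by (rule Q_cases)
    then show ?thesis
      by (auto simp: Q.perp_def e0_def f0_def emb_def Q_simps image_iff)
  next
    case False
    then show ?thesis by (auto simp: Q.perp_def emb_def Q_simps)
  qed
  then show ?thesis by blast
qed

lemma emb_closed: "p \<in> carrier P \<Longrightarrow> emb p \<in> carrier Q"
  by (simp add: emb_def Q_simps)

lemma BQ_emb: "p \<in> carrier P \<Longrightarrow> p' \<in> carrier P \<Longrightarrow> BQ (emb p) (emb p') = B p p'"
  by (simp add: emb_def Q_simps)

lemma Q_uminus: "a \<in> carrier R \<Longrightarrow> b \<in> carrier R \<Longrightarrow> p \<in> carrier P \<Longrightarrow>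
  \<ominus>\<^bsub>Q\<^esub> (a, b, p) = (\<ominus> a, \<ominus> b, \<ominus>\<^bsub>P\<^esub> p)"
  by (rule Q.M.minus_equality) (simp_all add: Q_simps R.l_neg M.l_neg)

lemma transvection_eq_T:
  assumes "u \<in> carrier Q" "v \<in> carrier Q" "BQ v v = \<zero>"
  shows "orth_transv Q BQ u v = Q.T u v"
  using assms by (auto simp: orth_transv_def Q.T_def Q.q_def restrict_def fun_eq_iff a_minus_def)

text \<open>The axis is \<open>f0\<close> because the coefficient \<open>a\<close> in
  \<open>rho\<close> is the pairing with \<open>f0\<close>; in \<open>mu\<close> the coefficient is
  \<open>b\<close>, the pairing with \<open>e0\<close>.\<close>

lemma rho_eq_T:
  assumes "p \<in> carrier P" "B p p = \<zero>"
  shows "rho_tr R P B p = Q.T f0 (emb p)"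
proof -
  have "rho_tr R P B p m = Q.T f0 (emb p) m" if m: "m \<in> carrier Q" for m
  proof -
    obtain a b x where x: "m = (a, b, x)" "a \<in> carrier R" "b \<in> carrier R" "x \<in> carrier P"
      using m by (rule Q_cases)
    then show ?thesis
      using assms B_sym[of p x]
      by (simp add: rho_tr_def Q.T_def Q.q_def a_minus_def f0_def emb_def Q_uminus Q_simps)
  qed
  then show ?thesis by (auto simp: rho_tr_def Q.T_def restrict_def fun_eq_iff)
qed

lemma mu_eq_T:
  assumes "p \<in> carrier P" "B p p = \<zero>"
  shows "mu_tr R P B p = Q.T e0 (emb p)"
proof -
  have "mu_tr R P B p m = Q.T e0 (emb p) m" if m: "m \<in> carrier Q" for m
  proof -
    obtain a b x where x: "m = (a, b, x)" "a \<in> carrier R" "b \<in> carrier R" "x \<in> carrier P"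
      using m by (rule Q_cases)
    then show ?thesis
      using assms B_sym[of p x]
      by (simp add: mu_tr_def Q.T_def Q.q_def a_minus_def e0_def emb_def Q_uminus Q_simps)
  qed
  then show ?thesis by (auto simp: mu_tr_def Q.T_def restrict_def fun_eq_iff)
qed

lemma elem_gens_eq:
  assumes "X \<subseteq> carrier P"
  shows "elem_gens R P B X = {Q.T f0 (emb p) | p. p \<in> X \<and> B p p = \<zero>} \<union> {Q.T e0 (emb p) | p. p \<in> X \<and> B p p = \<zero>}"
  unfolding elem_gens_def
  by (intro arg_cong2[where f="(\<union>)"] Collect_cong ex_cong1) (use rho_eq_T mu_eq_T assms in auto)

text \<open>Links the parameters in \<open>IP\<close> of the relative generators with the submodule
  \<open>IQ\<close> of the general theory: the third component of an element of \<open>IQ\<close>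
  lies in \<open>IP\<close>.\<close>

lemma emb_ideal_submod:
  assumes I: "ideal I R" and p: "p \<in> carrier P"
  shows "emb p \<in> ideal_submod Q I \<longleftrightarrow> p \<in> ideal_submod P I"
proof
  note genQ = Q.ideal_gen_ideal_submod[OF I] and gen = ideal_gen_ideal_submod[OF I]
  assume "emb p \<in> ideal_submod Q I"
  with genQ have "emb p \<in> carrier Q \<and> snd (snd (emb p)) \<in> ideal_submod P I"
  proof (induction rule: Q.ideal_gen_induct)
    case zero
    then show ?case
      using subgroup.one_closed[OF submodule.axioms(1)[OF ideal_submod_closed(1)[OF I]]] by (simp add: Q_simps)
  next
    case (smult \<alpha> x)
    from smult(2) obtain a b y where x: "x = (a, b, y)" "a \<in> carrier R" "b \<in> carrier R" "y \<in> carrier P"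
      by (rule Q_cases)
    then show ?case using ideal_genD[OF gen smult(1)] by (simp add: Q_simps)
  next
    case (add x y)
    then show ?case
      using submoduleE(5)[OF ideal_submod_closed(1)[OF I]] by (auto elim!: Q_cases simp: Q_simps)
  qed
  then show "p \<in> ideal_submod P I" by (simp add: emb_def)
next
  note genQ = Q.ideal_gen_ideal_submod[OF I] and gen = ideal_gen_ideal_submod[OF I]
  assume "p \<in> ideal_submod P I"
  with gen have "p \<in> carrier P \<and> emb p \<in> ideal_submod Q I"
  proof (induction rule: ideal_gen_induct)
    case zero
    then show ?case
      using subgroup.one_closed[OF submodule.axioms(1)[OF Q.ideal_submod_closed(1)[OF I]]]
      by (simp add: Q_simps emb_def)
  next
    case (smult \<alpha> x)
    then show ?case
      using ideal_genD(1)[OF gen smult(1)] Q.ideal_genD(3)[OF genQ smult(1) emb_closed[OF smult(2)]]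
      by (simp add: Q_simps emb_def)
  next
    case (add x y)
    then show ?case
      using Q.submoduleE(5)[OF Q.ideal_submod_closed(1)[OF I], of "emb x" "emb y"]
      by (simp add: Q_simps emb_def)
  qed
  then show "emb p \<in> ideal_submod Q I" by simp
qed

text \<open>A functional on \<open>Q\<close> is represented by a vector: on \<open>P\<close> by
  nondegeneracy, and on the plane by exchanging its values at \<open>e0\<close> and
  \<open>f0\<close>, since these two pair with each other.\<close>

lemma unimodular_iff:
  assumes nd: "nondegenerate R P B" and u: "u \<in> carrier Q"
  shows "unimodular R Q u \<longleftrightarrow> (\<exists>w\<in>carrier Q. BQ u w = \<one>)"
proof
  assume "unimodular R Q u"
  then obtain \<phi> where \<phi>: "lin_functional R Q \<phi>" "\<phi> u = \<one>" by (auto simp: unimodular_def)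
  have add: "\<phi> (x \<oplus>\<^bsub>Q\<^esub> y) = \<phi> x \<oplus> \<phi> y" if "x \<in> carrier Q" "y \<in> carrier Q" for x y
    using \<phi>(1) that by (simp add: lin_functional_def)
  have sm: "\<phi> (r \<odot>\<^bsub>Q\<^esub> x) = r \<otimes> \<phi> x" if "r \<in> carrier R" "x \<in> carrier Q" for r x
    using \<phi>(1) that by (simp add: lin_functional_def)
  have cl: "\<phi> x \<in> carrier R" if "x \<in> carrier Q" for x
    using \<phi>(1) that by (auto simp: lin_functional_def)
  have "lin_functional R P (\<lambda>p. \<phi> (emb p))"
    unfolding lin_functional_def
  proof (intro conjI ballI)
    show "(\<lambda>p. \<phi> (emb p)) \<in> carrier P \<rightarrow> carrier R" using cl emb_closed by auto
    show "\<phi> (emb (x \<oplus>\<^bsub>P\<^esub> y)) = \<phi> (emb x) \<oplus> \<phi> (emb y)" if "x \<in> carrier P" "y \<in> carrier P" for x y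
      using add[OF emb_closed[OF that(1)] emb_closed[OF that(2)]] by (simp add: emb_def Q_simps)
    show "\<phi> (emb (r \<odot>\<^bsub>P\<^esub> x)) = r \<otimes> \<phi> (emb x)" if "r \<in> carrier R" "x \<in> carrier P" for r x
      using sm[OF that(1) emb_closed[OF that(2)]] that by (simp add: emb_def Q_simps)
  qed
  then obtain p0 where p0: "p0 \<in> carrier P" "\<And>x. x \<in> carrier P \<Longrightarrow> B p0 x = \<phi> (emb x)"
    using nd unfolding nondegenerate_def by (metis (no_types, lifting))
  obtain a b p where x: "u = (a, b, p)" "a \<in> carrier R" "b \<in> carrier R" "p \<in> carrier P"
    using u by (rule Q_cases)
  have "u = a \<odot>\<^bsub>Q\<^esub> e0 \<oplus>\<^bsub>Q\<^esub> (b \<odot>\<^bsub>Q\<^esub> f0 \<oplus>\<^bsub>Q\<^esub> emb p)"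
    using x by (simp add: Q_simps e0_def f0_def emb_def)
  then have "\<phi> u = a \<otimes> \<phi> e0 \<oplus> (b \<otimes> \<phi> f0 \<oplus> B p p0)"
    using x p0 ef0_closed emb_closed B_sym[of p p0] by (simp add: add sm)
  then have "BQ u (\<phi> f0, \<phi> e0, p0) = \<one>"
    using \<phi>(2) x p0 cl ef0_closed by (simp add: Q_simps R.a_ac R.m_ac)
  moreover have "(\<phi> f0, \<phi> e0, p0) \<in> carrier Q" using p0 cl ef0_closed by (simp add: Q_simps)
  ultimately show "\<exists>w\<in>carrier Q. BQ u w = \<one>" by blast
next
  assume "\<exists>w\<in>carrier Q. BQ u w = \<one>"
  then obtain w where w: "w \<in> carrier Q" "BQ u w = \<one>" by blast
  then have "lin_functional R Q (\<lambda>x. BQ x w)" by (auto simp: lin_functional_def)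
  then show "unimodular R Q u" using w unfolding unimodular_def by blast
qed

lemma two_planes_Q:
  assumes "\<exists>e1\<in>carrier P. \<exists>f1\<in>carrier P. \<exists>e2\<in>carrier P. \<exists>f2\<in>carrier P.
     B e1 e1 = \<zero> \<and> B f1 f1 = \<zero> \<and> B e2 e2 = \<zero> \<and> B f2 f2 = \<zero> \<and>
     B e1 e2 = \<zero> \<and> B e1 f2 = \<zero> \<and> B f1 e2 = \<zero> \<and> B f1 f2 = \<zero> \<and> B e1 f1 \<notin> \<mm> \<and> B e2 f2 \<notin> \<mm>"
  shows "Q.two_planes e0 f0 \<mm>"
proof -
  from assms obtain e1 f1 e2 f2 where c: "e1 \<in> carrier P" "f1 \<in> carrier P" "e2 \<in> carrier P" "f2 \<in> carrier P"
    and *: "B e1 e1 = \<zero> \<and> B f1 f1 = \<zero> \<and> B e2 e2 = \<zero> \<and> B f2 f2 = \<zero> \<and>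
     B e1 e2 = \<zero> \<and> B e1 f2 = \<zero> \<and> B f1 e2 = \<zero> \<and> B f1 f2 = \<zero> \<and> B e1 f1 \<notin> \<mm> \<and> B e2 f2 \<notin> \<mm>"
    by (elim bexE)
  show ?thesis
    unfolding Q.two_planes_def perp_ef0
    using c * by (intro bexI[of _ "emb e1"] bexI[of _ "emb f1"] bexI[of _ "emb e2"] bexI[of _ "emb f2"])
      (simp_all add: BQ_emb)
qed

text \<open>One inclusion is \<open>T_in_H\<close> after possibly exchanging \<open>u\<close> and
  \<open>v\<close>. For the other, isometries permute the relative transvections, so the group they
  generate contains the conjugates of the relative elementary generators.\<close>

lemma Trans_eq_ETrans:
  assumes I: "ideal I R" and nd: "nondegenerate R P B"
    and planes: "\<And>\<mm>. maximalideal \<mm> R \<Longrightarrow> Q.two_planes e0 f0 \<mm>"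
  shows "Trans_O_rel R Q BQ I = ETrans_O_rel R P B I"
proof -
  interpret G: group Q.G by (rule Q.group_G)
  define N where "N = ideal_submod Q I"
  define K where "K = ETrans_O R P B"
  define KI where "KI = ETrans_O_ideal R P B I"
  define H where "H = ETrans_O_rel R P B I"
  define A where "A = {orth_transv Q BQ u v | u v. transv_data R Q BQ u v \<and> (u \<in> N \<or> v \<in> N)}"
  define C where "C = {g \<otimes>\<^bsub>Q.G\<^esub> x \<otimes>\<^bsub>Q.G\<^esub> inv\<^bsub>Q.G\<^esub> g | g x. g \<in> K \<and> x \<in> KI}"
  have Trans: "Trans_O_rel R Q BQ I = generate Q.G A" by (simp add: Trans_O_rel_def A_def N_def)
  have HC: "H = generate Q.G C" by (simp add: H_def ETrans_O_rel_def C_def K_def KI_def Let_def)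
  have NN: "submodule N R Q" and Nz: "\<And>x y z. \<lbrakk>x \<in> N; y \<in> carrier Q; z \<in> carrier Q\<rbrakk> \<Longrightarrow> BQ x y \<odot>\<^bsub>Q\<^esub> z \<in> N"
    using Q.ideal_submod_closed[OF I] unfolding N_def by auto
  have Ngen: "Q.ideal_gen I N" unfolding N_def by (rule Q.ideal_gen_ideal_submod[OF I])
  have Nc: "x \<in> carrier Q" if "x \<in> N" for x using that Q.submoduleE(1)[OF NN] by auto
  have IP: "ideal_submod P I \<subseteq> carrier P" using submoduleE(1)[OF ideal_submod_closed(1)[OF I]] .
  have ef0: "u \<in> carrier Q" "BQ u u = \<zero>" "p \<in> carrier P \<Longrightarrow> BQ u (emb p) = \<zero>" if "u \<in> {e0, f0}" for u p
    using that ef0_hyp_pair perp_ef0 by (auto simp: Q.hyp_pair_def Q.perp_def)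
  have gens_Iso: "elem_gens R P B (carrier P) \<subseteq> Q.Iso"
    unfolding elem_gens_eq[OF subset_refl]
    using ef0[of e0, simplified] ef0[of f0, simplified] emb_closed by (auto intro!: Q.T_Iso)
  have gens_mono: "elem_gens R P B (ideal_submod P I) \<subseteq> elem_gens R P B (carrier P)"
    using IP unfolding elem_gens_def by blast
  have gens_G: "elem_gens R P B (carrier P) \<subseteq> carrier Q.G" using gens_Iso Q.Iso_G by auto
  have K_eq: "K = generate Q.G (elem_gens R P B (carrier P))" by (simp add: K_def ETrans_O_def)
  have KI_eq: "KI = generate Q.G (elem_gens R P B (ideal_submod P I))" by (simp add: KI_def ETrans_O_ideal_def)
  have K: "subgroup K Q.G" unfolding K_eq by (rule G.generate_is_subgroup[OF gens_G])
  have KIso: "K \<subseteq> Q.Iso"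
    unfolding K_eq by (rule G.generate_subgroup_incl[OF gens_Iso Q.Iso_subgroup])
  have KG: "g \<in> carrier Q.G" if "g \<in> K" for g using subgroup.mem_carrier[OF K that] .
  have KIK: "KI \<subseteq> K" unfolding K_eq KI_eq by (rule G.mono_generate[OF gens_mono])
  have CK: "C \<subseteq> K"
    using KIK subgroup.m_closed[OF K] subgroup.m_inv_closed[OF K] unfolding C_def by auto
  have CG: "C \<subseteq> carrier Q.G" using CK KG by auto
  have H: "subgroup H Q.G" unfolding HC by (rule G.generate_is_subgroup[OF CG])
  have nrm: "k \<otimes>\<^bsub>Q.G\<^esub> x \<otimes>\<^bsub>Q.G\<^esub> inv\<^bsub>Q.G\<^esub> k \<in> H" if k: "k \<in> K" and x: "x \<in> H" for k x
    unfolding HC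
  proof (rule G.conj_generate[OF CG KG[OF k] _ x[unfolded HC]])
    fix a assume "a \<in> C"
    then obtain g y where a: "a = g \<otimes>\<^bsub>Q.G\<^esub> y \<otimes>\<^bsub>Q.G\<^esub> inv\<^bsub>Q.G\<^esub> g" "g \<in> K" "y \<in> KI" by (auto simp: C_def)
    have "k \<otimes>\<^bsub>Q.G\<^esub> a \<otimes>\<^bsub>Q.G\<^esub> inv\<^bsub>Q.G\<^esub> k = (k \<otimes>\<^bsub>Q.G\<^esub> g) \<otimes>\<^bsub>Q.G\<^esub> y \<otimes>\<^bsub>Q.G\<^esub> inv\<^bsub>Q.G\<^esub> (k \<otimes>\<^bsub>Q.G\<^esub> g)"
      using a k KG KIK by (auto simp: G.m_assoc G.inv_mult_group)
    then have "k \<otimes>\<^bsub>Q.G\<^esub> a \<otimes>\<^bsub>Q.G\<^esub> inv\<^bsub>Q.G\<^esub> k \<in> C"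
      using a(2,3) subgroup.m_closed[OF K k a(2)] unfolding C_def by blast
    then show "k \<otimes>\<^bsub>Q.G\<^esub> a \<otimes>\<^bsub>Q.G\<^esub> inv\<^bsub>Q.G\<^esub> k \<in> generate Q.G C" by (rule generate.incl)
  qed
  have KH: "Q.rel_triple K H N"
    unfolding Q.rel_triple_def using K H nrm NN Nz by auto
  have KI_H: "x \<in> H" if "x \<in> KI" for x
  proof -
    have "\<one>\<^bsub>Q.G\<^esub> \<otimes>\<^bsub>Q.G\<^esub> x \<otimes>\<^bsub>Q.G\<^esub> inv\<^bsub>Q.G\<^esub> \<one>\<^bsub>Q.G\<^esub> \<in> C"
      using that subgroup.one_closed[OF K] unfolding C_def by blast
    moreover have "x \<in> carrier Q.G" using that KIK KG by auto
    ultimately show ?thesis unfolding HC by (auto intro: generate.incl)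
  qed
  have T_K: "Q.T u y \<in> K" if uy: "u \<in> {e0, f0}" "y \<in> Q.perp e0 f0" "BQ y y = \<zero>" for u y
  proof -
    obtain p where p: "y = emb p" "p \<in> carrier P" using uy(2) perp_ef0 by auto
    then have "Q.T u y \<in> elem_gens R P B (carrier P)"
      unfolding elem_gens_eq[OF subset_refl] using uy by (auto simp: BQ_emb)
    then show ?thesis unfolding K_eq by (rule generate.incl)
  qed
  have T_H: "Q.T u y \<in> H" if uy: "u \<in> {e0, f0}" "y \<in> Q.perp e0 f0" "y \<in> N" "BQ y y = \<zero>" for u y
  proof -
    obtain p where p: "y = emb p" "p \<in> carrier P" using uy(2) perp_ef0 by auto
    then have "p \<in> ideal_submod P I" using uy(3) emb_ideal_submod[OF I] by (simp add: N_def)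
    then have "Q.T u y \<in> elem_gens R P B (ideal_submod P I)"
      unfolding elem_gens_eq[OF IP] using uy p by (auto simp: BQ_emb)
    then show ?thesis using KI_H unfolding KI_eq by (auto intro: generate.incl)
  qed
  have planes': "Q.two_planes f0 e0 \<mm>" if "maximalideal \<mm> R" for \<mm>
    using planes[OF that] by (simp add: Q.two_planes_def Q.perp_commute)
  have e0: "Q.has_transvections K H N e0"
    by (rule Q.has_transvections_hyp_pair[OF KH Ngen ef0_hyp_pair planes]) (use T_K T_H in auto)
  have f0: "Q.has_transvections K H N f0"
    by (rule Q.has_transvections_hyp_pair[OF KH Ngen Q.hyp_pair_commute[OF ef0_hyp_pair] planes'])
      (use T_K T_H Q.perp_commute in auto)
  have unim: "Q.T u v \<in> H"
    if "u \<in> carrier Q" "BQ u u = \<zero>" "unimodular R Q u" "v \<in> N" "BQ u v = \<zero>" for u v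
    using that unimodular_iff[OF nd that(1)] Q.T_in_H[OF KH Ngen ef0_hyp_pair e0 f0 planes] by blast
  have A_char: "\<exists>u v. a = Q.T u v \<and> u \<in> carrier Q \<and> v \<in> carrier Q \<and> BQ u u = \<zero> \<and> BQ v v = \<zero> \<and> BQ u v = \<zero> \<and>
      (unimodular R Q u \<or> unimodular R Q v) \<and> (u \<in> N \<or> v \<in> N)" if "a \<in> A" for a
    using that transvection_eq_T unfolding A_def transv_data_def by blast
  have A_intro: "Q.T u v \<in> A" if "u \<in> carrier Q" "v \<in> carrier Q" "BQ u u = \<zero>" "BQ v v = \<zero>" "BQ u v = \<zero>"
      "unimodular R Q u \<or> unimodular R Q v" "u \<in> N \<or> v \<in> N" for u v
    unfolding A_def transv_data_def using that transvection_eq_T[of u v, symmetric] by blast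
  have A_H: "A \<subseteq> H"
  proof
    fix a assume "a \<in> A"
    then obtain u v where a: "a = Q.T u v" and uv: "u \<in> carrier Q" "v \<in> carrier Q" "BQ u u = \<zero>"
      "BQ v v = \<zero>" "BQ u v = \<zero>" and um: "unimodular R Q u \<or> unimodular R Q v" and nn: "u \<in> N \<or> v \<in> N"
      using A_char by blast
    \<comment> \<open>A unimodular vector in \<open>IQ\<close> forces \<open>IQ\<close> to be
      everything. This settles the case in which the same one of \<open>u\<close> and
      \<open>v\<close> is unimodular and relative.\<close>
    have N_all: "z \<in> N" if xz: "x \<in> N" "unimodular R Q x" "z \<in> carrier Q" for x z
    proof -
      obtain w where w: "w \<in> carrier Q" "BQ x w = \<one>"
        using xz unimodular_iff[OF nd Nc[OF xz(1)]] by blast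
      show ?thesis using Nz[OF xz(1) w(1) xz(3)] xz w by simp
    qed
    show "a \<in> H"
    proof (cases "unimodular R Q u \<and> v \<in> N")
      case True
      then show ?thesis using a uv unim by simp
    next
      case False
      then have v: "unimodular R Q v" "u \<in> N" using um nn N_all uv by blast+
      have "Q.T u v = Q.T v (\<ominus>\<^bsub>Q\<^esub> u)"
        using Q.T_swap[of v u \<one>] uv by (simp add: Q.smult_l_minus)
      moreover have "BQ v (\<ominus>\<^bsub>Q\<^esub> u) = \<zero>" using uv Q.B_sym[of v u] by simp
      moreover have "\<ominus>\<^bsub>Q\<^esub> u \<in> N" using Q.submoduleE(3)[OF NN] v by simp
      ultimately show ?thesis using a uv v unim[of v "\<ominus>\<^bsub>Q\<^esub> u"] by simp
    qed
  qed
  have AG: "A \<subseteq> carrier Q.G" using A_H subgroup.subset[OF H] by auto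
  have "generate Q.G A \<subseteq> H" by (rule G.generate_subgroup_incl[OF A_H H])
  moreover have "H \<subseteq> generate Q.G A"
    unfolding HC
  proof (rule G.generate_subgroup_incl[OF _ G.generate_is_subgroup[OF AG]])
    have "elem_gens R P B (ideal_submod P I) \<subseteq> A"
    proof
      fix x assume "x \<in> elem_gens R P B (ideal_submod P I)"
      then obtain u p where x: "x = Q.T u (emb p)" "u \<in> {e0, f0}" "p \<in> ideal_submod P I" "B p p = \<zero>"
        unfolding elem_gens_eq[OF IP] by blast
      have p: "p \<in> carrier P" "emb p \<in> N" using x(3) IP emb_ideal_submod[OF I] by (auto simp: N_def)
      have "BQ e0 f0 = \<one>" "BQ f0 e0 = \<one>"
        using ef0_hyp_pair Q.hyp_pair_commute[OF ef0_hyp_pair] by (simp_all add: Q.hyp_pair_def)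
      then have "unimodular R Q u"
        using unimodular_iff[OF nd ef0(1)[OF x(2)]] x(2) ef0_closed by auto
      then show "x \<in> A"
        unfolding x(1) using ef0[OF x(2)] p emb_closed x(4) by (intro A_intro) (auto simp: BQ_emb)
    qed
    then have KIA: "KI \<subseteq> generate Q.G A" unfolding KI_eq by (rule G.mono_generate)
    show "C \<subseteq> generate Q.G A"
    proof
      fix c assume "c \<in> C"
      then obtain g x where c: "c = g \<otimes>\<^bsub>Q.G\<^esub> x \<otimes>\<^bsub>Q.G\<^esub> inv\<^bsub>Q.G\<^esub> g" "g \<in> K" "x \<in> KI" by (auto simp: C_def)
      have g: "g \<in> Q.Iso" using c(2) KIso by auto
      show "c \<in> generate Q.G A"
        unfolding c(1)
      proof (rule G.conj_generate[OF AG KG[OF c(2)]])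
        show "x \<in> generate Q.G A" using c(3) KIA by auto
        fix a assume "a \<in> A"
        then obtain u v where a: "a = Q.T u v" and uv: "u \<in> carrier Q" "v \<in> carrier Q" "BQ u u = \<zero>"
          "BQ v v = \<zero>" "BQ u v = \<zero>" and um: "unimodular R Q u \<or> unimodular R Q v" and nn: "u \<in> N \<or> v \<in> N"
          using A_char by blast
        have gN: "g y \<in> N" if "y \<in> N" for y
          using Q.Iso_ideal_submod[OF I g] that unfolding N_def by simp
        have gu: "unimodular R Q (g y)" if y: "unimodular R Q y" "y \<in> carrier Q" for y
        proof -
          obtain w where "w \<in> carrier Q" "BQ y w = \<one>" using y unimodular_iff[OF nd y(2)] by blast
          then have "g w \<in> carrier Q" "BQ (g y) (g w) = \<one>" using g y by (simp_all add: Q.IsoD)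
          then show ?thesis using unimodular_iff[OF nd, of "g y"] g y by auto
        qed
        have "Q.T (g u) (g v) \<in> A"
          using g uv um nn gN[of u] gN[of v] gu[of u] gu[of v] by (intro A_intro) (auto simp: Q.IsoD)
        then show "g \<otimes>\<^bsub>Q.G\<^esub> a \<otimes>\<^bsub>Q.G\<^esub> inv\<^bsub>Q.G\<^esub> g \<in> generate Q.G A"
          using Q.T_conj[OF g uv(1,2,3,5)] a by (simp add: generate.incl)
      qed
    qed
  qed
  ultimately show ?thesis unfolding Trans H_def by simp
qed

end

theorem mainTheorem1:
  fixes R :: "'a ring" and P :: "('a, 'b) module" and B :: "'b \<Rightarrow> 'b \<Rightarrow> 'a"
    and I :: "'a set" and n :: nat
  assumes "cring R"
    and "\<one>\<^bsub>R\<^esub> \<oplus>\<^bsub>R\<^esub> \<one>\<^bsub>R\<^esub> \<in> Units R"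
    and "ideal I R"
    and "orthogonal_module_rank R P B (2 * n)"
    and "locally_split R P B"
    and "n \<ge> 2"
  shows "Trans_O_rel R (hyp_sum R P) (hyp_form R B) I = ETrans_O_rel R P B I"
proof -
  have os: "orth_space R P B (inv\<^bsub>R\<^esub> (\<one>\<^bsub>R\<^esub> \<oplus>\<^bsub>R\<^esub> \<one>\<^bsub>R\<^esub>))"
    by (rule orth_space_orthogonal_module[OF assms(1,2,4)])
  interpret hyperbolic_sum R P B "inv\<^bsub>R\<^esub> (\<one>\<^bsub>R\<^esub> \<oplus>\<^bsub>R\<^esub> \<one>\<^bsub>R\<^esub>)"
    using os by (rule hyperbolic_sum.intro)
  show ?thesis
  proof (rule Trans_eq_ETrans[OF assms(3)])
    show "nondegenerate R P B" using assms(4) by (simp add: orthogonal_module_rank_def)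
    \<comment> \<open>The bound \<open>n \<ge> 2\<close> makes the rank at least 4, which leaves
      room for three independent vectors.\<close>
    show "Q.two_planes e0 f0 \<mm>" if "maximalideal \<mm> R" for \<mm>
      using planes_at_maximal[OF os assms(4) _ assms(5) that] assms(6) by (intro two_planes_Q) simp
  qed
qed

end
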